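(* There exist an algorithm for the random order single sample secretary problem and an absolute constant $C$ with the following property. For every $\epsilon\in(0,1)$ and every instance whose random variables $X_1,\dots,X_n$ satisfy the no-$\epsilon$-superstars assumption, the algorithm accepts $\max_i X_i$ with probability at least $\gamma - C/\log(1/\epsilon)$.
   Context: Random order single sample secretary problem: there are independent random variables $X_1,\dots,X_n$ with $X_i\sim\mathcal D_i$. The distributions $\mathcal D_i$ are unknown. The algorithm is given one independent sample $Y_i\sim\mathcal D_i$ for each $i$. The $X_i$ are revealed one by one in uniformly random order. After each one, the algorithm must irrevocably accept it or move on. It succeeds if it accepts the largest of $X_1,\dots,X_n$. No-$\epsilon$-superstars assumption: for every $i$, $\Pr[X_i=\max_{1\le j\le n}X_j]\le\epsilon$. $\gamma\approx 0.5024$ is the optimal asymptotic (as $n\to\infty$) success probability, for comparison-based algorithms, in the secretary problem where $n$ unknown values arrive in uniformly random order, the first $n/2$ can only be observed, and the goal is to accept the maximum of the last $n/2$. *)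

theory Defs
  imports "HOL-Probability.Probability" "HOL-Combinatorics.Permutations"
begin

text \<open>
  A stopping rule is a predicate on the list of values observed so far: ``accept the last one''.
  The rule is only consulted from time \<open>k\<close> on; the first \<open>k\<close> values can merely be observed.
\<close>

definition accepts_at :: "(real list \<Rightarrow> bool) \<Rightarrow> nat \<Rightarrow> real list \<Rightarrow> nat \<Rightarrow> bool" where
  "accepts_at R k xs t \<longleftrightarrow>
     k \<le> t \<and> t < length xs \<and> R (take (Suc t) xs) \<and> (\<forall>s. k \<le> s \<and> s < t \<longrightarrow> \<not> R (take (Suc s) xs))"

definition accepts_max :: "(real list \<Rightarrow> bool) \<Rightarrow> nat \<Rightarrow> real list \<Rightarrow> bool" where
  "accepts_max R k xs \<longleftrightarrow> (\<exists>t. accepts_at R k xs t \<and> xs ! t = Max (set (drop k xs)))"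

text \<open>
  Algorithms may be randomized: their internal randomness is an infinite sequence of
  independent uniform numbers in the unit interval.
\<close>

definition seed :: "(nat \<Rightarrow> real) measure" where
  "seed = (\<Pi>\<^sub>M i\<in>UNIV. uniform_measure lborel {0..1})"

definition arrival_order :: "nat \<Rightarrow> (nat \<Rightarrow> nat) measure" where
  "arrival_order n = uniform_count_measure {p. p permutes {..<n}}"


section \<open>The secretary problem with an observation-only first half\<close>

definition comparison_based :: "((nat \<Rightarrow> real) \<Rightarrow> real list \<Rightarrow> bool) \<Rightarrow> bool" where
  "comparison_based A \<longleftrightarrow>
     (\<forall>xs. Measurable.pred seed (\<lambda>\<omega>. A \<omega> xs)) \<and>
     (\<forall>\<omega> xs ys. length xs = length ys \<and>
        (\<forall>i<length xs. \<forall>j<length xs. xs ! i < xs ! j \<longleftrightarrow> ys ! i < ys ! j) \<longrightarrow> A \<omega> xs = A \<omega> ys)"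

definition half_secretary_success ::
  "((nat \<Rightarrow> real) \<Rightarrow> real list \<Rightarrow> bool) \<Rightarrow> nat \<Rightarrow> (nat \<Rightarrow> real) \<Rightarrow> real" where
  "half_secretary_success A m v =
     \<P>((\<omega>, p) in seed \<Otimes>\<^sub>M arrival_order (2 * m).
        accepts_max (A \<omega>) m (map (\<lambda>t. v (p t)) [0..<2 * m]))"

text \<open>
  The total number of values is \<open>2 * m\<close>. The values are unknown but distinct, hence the
  worst case over all injective \<open>v\<close>.
\<close>

definition half_secretary_opt :: "nat \<Rightarrow> real" where
  "half_secretary_opt m =
     (SUP A\<in>{A. comparison_based A}. INF v\<in>{v. inj_on v {..<2 * m}}. half_secretary_success A m v)"

definition gamma_opt :: real where
  "gamma_opt = lim half_secretary_opt"


section \<open>The random order single sample secretary problem\<close>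

text \<open>
  An algorithm maps its seed and the list of samples to a stopping rule. It learns \<open>n\<close> as the
  length of the list of samples, and nothing else about the distributions.
\<close>

definition single_sample_algorithm ::
  "((nat \<Rightarrow> real) \<Rightarrow> real list \<Rightarrow> real list \<Rightarrow> bool) \<Rightarrow> bool" where
  "single_sample_algorithm A \<longleftrightarrow>
     (\<forall>n t. Measurable.pred (seed \<Otimes>\<^sub>M (\<Pi>\<^sub>M i\<in>{..<n}. borel) \<Otimes>\<^sub>M (\<Pi>\<^sub>M i\<in>{..<t}. borel))
        (\<lambda>(\<omega>, y, h). A \<omega> (map y [0..<n]) (map h [0..<t])))"

definition single_sample_success ::
  "((nat \<Rightarrow> real) \<Rightarrow> real list \<Rightarrow> real list \<Rightarrow> bool) \<Rightarrow> nat \<Rightarrow> (nat \<Rightarrow> real measure) \<Rightarrow> real" where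
  "single_sample_success A n D =
     \<P>((\<omega>, y, x, p) in seed \<Otimes>\<^sub>M (\<Pi>\<^sub>M i\<in>{..<n}. D i) \<Otimes>\<^sub>M (\<Pi>\<^sub>M i\<in>{..<n}. D i) \<Otimes>\<^sub>M
          arrival_order n.
        accepts_max (A \<omega> (map y [0..<n])) 0 (map (\<lambda>t. x (p t)) [0..<n]))"

definition no_superstars :: "real \<Rightarrow> nat \<Rightarrow> (nat \<Rightarrow> real measure) \<Rightarrow> bool" where
  "no_superstars \<epsilon> n D \<longleftrightarrow>
     (\<forall>i<n. \<P>(x in (\<Pi>\<^sub>M j\<in>{..<n}. D j). x i = Max (x ` {..<n})) \<le> \<epsilon>)"

end

theory Submission
  imports Defs
begin

text \<open>
  In the half-observed secretary problem the relative ranks \<open>R\<^sub>s\<close> of the arriving values are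
  independent and uniform on \<open>{1..s}\<close>, and stopping at the maximum of the second half means stopping at
  the last position where \<open>R\<close> attains its minimum. Backward induction over the pair (time, running
  minimum) gives the optimal value \<open>half_value m\<close>; comparing this recursion with its \<open>q\<close>-fold
  refinement shows that it converges, with a polynomial rate.

  The single sample algorithm breaks ties at random and applies the optimal rule of the half-observed
  problem to the samples followed by the arrivals. Exchanging the two draws of a pair preserves their
  law, so each draw is a sample or an arrival with probability 1/2. If the top \<open>K\<close> of all \<open>2n\<close> draws
  belong to different pairs, their positions are distributed almost as the positions of the top \<open>K\<close>
  values in a uniformly random order of \<open>2n\<close> values, and outside an event of probability \<open>O(1/K)\<close> these
  positions determine whether the rule wins.

  Choose a threshold which all \<open>n\<close> arrivals stay below with probability exactly \<open>\<surd>\<epsilon>\<close>. Without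
  \<open>\<epsilon>\<close>-superstars each draw exceeds it with probability at most \<open>\<surd>\<epsilon>\<close>, so no pair exceeds it twice
  while the number of arrivals above it is of order \<open>log (1/\<epsilon>)\<close>, up to small probability. Hence
  \<open>K\<close> can be taken of order \<open>log (1/\<epsilon>)\<close>.
\<close>

section \<open>The value of the half-observed problem\<close>

text \<open>\<open>gamma_opt\<close> is a \<open>lim\<close>, so convergence of the finite values
  has to be proved, and a bound for every single \<open>n\<close> needs a rate as well. A polynomial
  rate is enough: without \<epsilon>-superstars \<open>n\<close> is at least
  \<open>1 / \<epsilon>\<close>, which dominates every fixed power of
  \<open>log (1 / \<epsilon>)\<close>. The obstacle is that the two draws of a pair never play the
  same role, since exactly one of them is a sample. If both belong to the largest values, their
  roles are perfectly anticorrelated and the comparison with a uniformly random order breaks down.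
  The absence of superstars excludes this. If draw \<open>i\<close> exceeds the threshold with
  probability \<open>q i\<close>, then it is the maximum with probability at least
  \<open>q i * \<surd>\<epsilon>\<close>, so \<open>q i\<close> is at most
  \<open>\<surd>\<epsilon>\<close>. The product of all \<open>1 - q i\<close> being
  \<open>\<surd>\<epsilon>\<close>, the sum of the \<open>q i\<close> is of order
  \<open>log (1 / \<epsilon>)\<close>, whereas the sum of their squares, which bounds the
  probability that some pair exceeds the threshold twice, is tiny.\<close>

text \<open>
  With \<open>N\<close> values in total, \<open>d\<close> of them still to come and running minimum \<open>r\<close>: \<open>miss_prob N d r\<close> is
  the probability that no later relative rank is at most \<open>r\<close>, and \<open>cont_value N d r\<close> the optimal winning
  probability after rejecting the current candidate. Initially every rank is a record, whence the
  running minimum \<open>Suc m\<close> in \<open>half_value\<close>.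
\<close>

fun miss_prob :: "nat \<Rightarrow> nat \<Rightarrow> nat \<Rightarrow> real" where
  "miss_prob N 0 r = 1"
| "miss_prob N (Suc d) r = (1 - real r / real (N - d)) * miss_prob N d r"

fun cont_value :: "nat \<Rightarrow> nat \<Rightarrow> nat \<Rightarrow> real" where
  "cont_value N 0 r = 0"
| "cont_value N (Suc d) r =
     (1 - real r / real (N - d)) * cont_value N d r +
     (\<Sum>j=1..r. max (miss_prob N d j) (cont_value N d j)) / real (N - d)"

definition half_value :: "nat \<Rightarrow> real" where
  "half_value m = cont_value (2 * m) m (Suc m)"

text \<open>The hypothesis \<open>r + d \<le> Suc N\<close> says that \<open>r\<close> is at most
  each denominator \<open>N - d'\<close> with \<open>d' < d\<close>, so all factors lie in [0,1].
  The \<open>Suc\<close> admits the initial state \<open>r = Suc m\<close>, \<open>d = m\<close>,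
  \<open>N = 2 * m\<close>. The same range recurs below.\<close>

lemma miss_prob_bounds:
  assumes "r + d \<le> Suc N" "d \<le> N"
  shows "0 \<le> miss_prob N d r \<and> miss_prob N d r \<le> 1"
  using assms
proof (induction d)
  case (Suc d)
  have "0 \<le> 1 - real r / real (N - d)" "1 - real r / real (N - d) \<le> 1"
    using Suc.prems by (auto simp: divide_le_eq_1)
  then show ?case using Suc by (auto intro: mult_le_one)
qed auto

lemma miss_prob_pos:
  assumes "r + d \<le> N"
  shows "0 < miss_prob N d r"
  using assms
  by (induction d) (auto simp: divide_less_eq_1)

lemma miss_prob_antimono:
  assumes "r \<le> r'" "r' + d \<le> Suc N" "d \<le> N"
  shows "miss_prob N d r' \<le> miss_prob N d r"
  using assms(2,3)
proof (induction d)
  case (Suc d)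
  have "1 - real r' / real (N - d) \<le> 1 - real r / real (N - d)"
    using assms(1) by (simp add: divide_right_mono)
  moreover have "0 \<le> 1 - real r' / real (N - d)"
    using Suc.prems by (auto simp: divide_le_eq_1)
  ultimately have "(1 - real r' / real (N - d)) * miss_prob N d r' \<le> (1 - real r / real (N - d)) * miss_prob N d r"
    using Suc miss_prob_bounds[of r' d N] by (intro mult_mono) linarith+
  then show ?case by simp
qed auto

text \<open>Both recursions become Euler steps \<open>U + (\<Sum>j=1..r. G j - U) / s\<close>: here
  \<open>G\<close> is the better of stopping and continuing, in \<open>miss_prob_step\<close> it is
  0. \<open>refine_drift\<close> and \<open>refine_step\<close> treat this common form.\<close>

lemma cont_value_step:
  "cont_value N (Suc d) r =
     cont_value N d r + (\<Sum>j=1..r. max (miss_prob N d j) (cont_value N d j) - cont_value N d r) / real (N - d)"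
  by (simp add: sum_subtractf algebra_simps diff_divide_distrib)

lemma miss_prob_step:
  "miss_prob N (Suc d) r = miss_prob N d r + (\<Sum>j=1..r. 0 - miss_prob N d r) / real (N - d)"
  by (simp add: sum_subtractf algebra_simps diff_divide_distrib)

lemma cont_value_bounds:
  assumes "r + d \<le> Suc N" "d \<le> N"
  shows "0 \<le> cont_value N d r \<and> cont_value N d r \<le> 1"
  using assms
proof (induction d arbitrary: r)
  case (Suc d)
  define s where "s = real (N - d)"
  have s: "s > 0" "real r \<le> s" using Suc.prems by (auto simp: s_def)
  let ?G = "\<lambda>j. max (miss_prob N d j) (cont_value N d j)"
  have G: "0 \<le> ?G j \<and> ?G j \<le> 1" if "j \<in> {1..r}" for j
    using Suc.IH[of j] miss_prob_bounds[of j d N] Suc.prems that by auto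
  have "(\<Sum>j=1..r. ?G j) \<le> (\<Sum>j=1..r. 1)" "0 \<le> (\<Sum>j=1..r. ?G j)"
    using G by (auto intro!: sum_mono sum_nonneg simp del: sum_constant)
  then have g: "(\<Sum>j=1..r. ?G j) / s \<le> real r / s" "0 \<le> (\<Sum>j=1..r. ?G j) / s"
    using s by (auto intro!: divide_right_mono)
  have c: "0 \<le> 1 - real r / s" using s by (simp add: divide_le_eq_1)
  have "(1 - real r / s) * cont_value N d r \<le> (1 - real r / s) * 1"
    "0 \<le> (1 - real r / s) * cont_value N d r"
    using Suc.IH[of r] Suc.prems c by (intro mult_left_mono mult_nonneg_nonneg; auto)+
  with g have "0 \<le> (1 - real r / s) * cont_value N d r + (\<Sum>j=1..r. ?G j) / s"
    "(1 - real r / s) * cont_value N d r + (\<Sum>j=1..r. ?G j) / s \<le> (1 - real r / s) * 1 + real r / s"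
    by (auto intro: add_mono add_nonneg_nonneg)
  then show ?case unfolding cont_value.simps s_def[symmetric] by simp
qed auto

text \<open>If a rank at most \<open>r\<close> is still to come, the running minima \<open>r\<close>
  and \<open>Suc r\<close> lead to the same last record. The additional admissible rank can
  therefore help only when no such rank follows, which has probability
  \<open>miss_prob N d r\<close>.\<close>

lemma cont_value_le_Suc:
  assumes "Suc r + d \<le> Suc N" "d \<le> N"
  shows "cont_value N d r \<le> cont_value N d (Suc r) \<and>
         cont_value N d (Suc r) \<le> cont_value N d r + miss_prob N d r"
  using assms
proof (induction d)
  case (Suc d)
  define s where "s = real (N - d)"
  have s: "s > 0" "real (Suc r) \<le> s" using Suc.prems by (auto simp: s_def)
  define v where "v = cont_value N d r"
  define v' where "v' = cont_value N d (Suc r)"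
  define g where "g = max (miss_prob N d (Suc r)) v'"
  have v': "v \<le> v'" "v' \<le> v + miss_prob N d r"
    using Suc by (auto simp: v_def v'_def)
  have g: "v' \<le> g" "g \<le> v + miss_prob N d r"
    using miss_prob_antimono[of r "Suc r" d N] Suc.prems v'
      cont_value_bounds[of r d N] by (auto simp: g_def v_def)
  define c where "c = 1 - real (Suc r) / s"
  have c: "0 \<le> c" using s by (simp add: divide_le_eq_1 c_def)
  have split: "1 - real r / s = c + 1 / s" using s by (simp add: c_def field_simps)
  have eq: "cont_value N (Suc d) (Suc r) - cont_value N (Suc d) r = c * v' + g / s - (c + 1 / s) * v"
    unfolding split[symmetric] by (simp add: v_def v'_def g_def c_def s_def add_divide_distrib)
  have "c * v \<le> c * v'" "v / s \<le> g / s"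
    using c v' g s by (auto intro!: mult_left_mono divide_right_mono)
  then have 1: "cont_value N (Suc d) r \<le> cont_value N (Suc d) (Suc r)"
    using eq by (simp add: algebra_simps)
  have "c * v' \<le> c * (v + miss_prob N d r)" "g / s \<le> (v + miss_prob N d r) / s"
    using c v' g s by (auto intro!: mult_left_mono divide_right_mono)
  then have "cont_value N (Suc d) (Suc r) - cont_value N (Suc d) r \<le> (c + 1 / s) * miss_prob N d r"
    using eq by (simp add: algebra_simps add_divide_distrib)
  then show ?case using 1 unfolding miss_prob.simps s_def[symmetric] split by auto
qed auto

lemma cont_value_mono:
  assumes "r \<le> r'" "r' + d \<le> Suc N" "d \<le> N"
  shows "cont_value N d r \<le> cont_value N d r'"
  using assms
proof (induction r' rule: dec_induct)
  case (step k)
  then show ?case using cont_value_le_Suc[of k d N] by force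
qed auto

text \<open>The reason is that of \<open>cont_value_le_Suc\<close>. Telescoping that lemma would add
  up \<open>r' - r\<close> miss probabilities; bounding every extra term of the recursion by the
  same \<open>b\<close> leaves a single one.\<close>

lemma cont_value_upper:
  assumes "r \<le> r'" "r' + d \<le> Suc N" "d \<le> N"
  shows "cont_value N d r' \<le> cont_value N d r + miss_prob N d r"
  using assms(2,3)
proof (induction d)
  case (Suc d)
  define s where "s = real (N - d)"
  have s: "s > 0" "real r' \<le> s" using Suc.prems by (auto simp: s_def)
  let ?G = "\<lambda>j. max (miss_prob N d j) (cont_value N d j)"
  define b where "b = cont_value N d r + miss_prob N d r"
  have b0: "cont_value N d r \<le> b" "miss_prob N d r \<le> b"
    using miss_prob_bounds[of r d N] cont_value_bounds[of r d N] assms(1) Suc.prems by (auto simp: b_def)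
  have IH: "cont_value N d r' \<le> b" using Suc by (auto simp: b_def)
  have G: "?G j \<le> b" if "j \<in> {Suc r..r'}" for j
    using that miss_prob_antimono[of r j d N] cont_value_mono[of j r' d N] IH b0 Suc.prems by auto
  have "(\<Sum>j=Suc r..r'. ?G j) \<le> (\<Sum>j=Suc r..r'. b)" using G by (intro sum_mono) auto
  also have "\<dots> = (real r' - real r) * b" using assms(1) by (simp add: of_nat_diff)
  finally have g: "(\<Sum>j=Suc r..r'. ?G j) / s \<le> (real r' - real r) * b / s"
    using s by (intro divide_right_mono) auto
  have sp: "(\<Sum>j=1..r'. ?G j) = (\<Sum>j=1..r. ?G j) + (\<Sum>j=Suc r..r'. ?G j)"
    using sum.ub_add_nat[of 1 r ?G "r' - r"] assms(1) by simp
  have c: "0 \<le> 1 - real r' / s" using s by (simp add: divide_le_eq_1)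
  have "(1 - real r' / s) * cont_value N d r' \<le> (1 - real r' / s) * b"
    using IH c by (intro mult_left_mono) auto
  then have "cont_value N (Suc d) r' \<le> (1 - real r' / s) * b + (\<Sum>j=1..r. ?G j) / s + (real r' - real r) * b / s"
    using g unfolding cont_value.simps s_def[symmetric] sp add_divide_distrib by linarith
  also have "\<dots> = cont_value N (Suc d) r + miss_prob N (Suc d) r"
    unfolding cont_value.simps miss_prob.simps s_def[symmetric] b_def using s by (simp add: field_simps)
  finally show ?case .
qed auto

text \<open>The factor multiplying \<open>miss_prob\<close> bounds the odds that exactly one more record follows;
  beyond 1 it makes accepting suboptimal.\<close>

lemma cont_value_ge_miss_prob:
  assumes "r + d \<le> Suc N" "d \<le> N"
  shows "miss_prob N d r * (real r * real d / real N) \<le> cont_value N d r"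
  using assms
proof (induction d)
  case (Suc d)
  define s where "s = real (N - d)"
  have s: "s > 0" "real r \<le> s" "s \<le> real N" using Suc.prems by (auto simp: s_def)
  let ?G = "\<lambda>j. max (miss_prob N d j) (cont_value N d j)"
  let ?q = "miss_prob N d r"
  have q: "0 \<le> ?q" using miss_prob_bounds[of r d N] Suc.prems by auto
  have c: "0 \<le> 1 - real r / s" "1 - real r / s \<le> 1" using s by (auto simp: divide_le_eq_1)
  have "(\<Sum>j=1..r. ?q) \<le> (\<Sum>j=1..r. ?G j)"
    using miss_prob_antimono[of _ r d N] Suc.prems by (intro sum_mono) (auto simp: le_max_iff_disj)
  then have "real r * ?q / s \<le> (\<Sum>j=1..r. ?G j) / s" using s by (intro divide_right_mono) auto
  moreover have "(1 - real r / s) * ?q * (real r / real N) \<le> ?q * (real r / s)"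
    using c q s by (intro mult_mono) (auto intro!: divide_left_mono mult_left_le_one_le simp: mult_left_le_one_le)
  moreover have "(1 - real r / s) * (?q * (real r * real d / real N)) \<le> (1 - real r / s) * cont_value N d r"
    using Suc c by (intro mult_left_mono) auto
  moreover have "miss_prob N (Suc d) r * (real r * real (Suc d) / real N) =
     (1 - real r / s) * (?q * (real r * real d / real N)) + (1 - real r / s) * ?q * (real r / real N)"
    unfolding miss_prob.simps s_def[symmetric] by (simp add: distrib_left add_divide_distrib mult.assoc)
  ultimately show ?case unfolding cont_value.simps s_def[symmetric] by (simp add: mult.commute)
qed auto

lemma cont_value_gt_miss_prob:
  assumes "r + d \<le> N" "N < r * d"
  shows "miss_prob N d r < cont_value N d r"
proof -
  have N: "0 < N" using assms by (cases "N = 0") auto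
  have "real N < real r * real d" using assms by (metis of_nat_less_iff of_nat_mult)
  then have "1 < real r * real d / real N" using N by simp
  then have "miss_prob N d r * 1 < miss_prob N d r * (real r * real d / real N)"
    using miss_prob_pos[OF assms(1)] by (intro mult_strict_left_mono) auto
  also have "\<dots> \<le> cont_value N d r" using assms by (intro cont_value_ge_miss_prob) auto
  finally show ?thesis by simp
qed

section \<open>Truncation and refinement of the recursion\<close>

text \<open>No denominator exceeds \<open>2 * m\<close>, so each of the \<open>m\<close> factors is
  at most \<open>1 - K / (2 * m)\<close>, which gives \<open>exp (- K / 2)\<close>. The weaker bound
  \<open>2 / K\<close> suffices, since errors of order \<open>1 / K\<close> occur elsewhere
  anyway.\<close>

lemma miss_prob_half_le:
  assumes "K \<le> m" "0 < K"
  shows "miss_prob (2 * m) m K \<le> 2 / real K"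
proof -
  have "miss_prob (2 * m) d K \<le> (1 - real K / real (2 * m)) ^ d" if "d \<le> m" for d
    using that
  proof (induction d)
    case (Suc d)
    have "real K / real (2 * m) \<le> real K / real (2 * m - d)"
      using Suc.prems assms by (intro divide_left_mono) auto
    then show ?case using Suc miss_prob_bounds[of K d "2 * m"] assms
      by (auto intro!: mult_mono simp: divide_le_eq_1)
  qed auto
  then have "miss_prob (2 * m) m K \<le> (1 - real K / real (2 * m)) ^ m" by simp
  also have "\<dots> \<le> exp (- (real K / real (2 * m))) ^ m"
    using exp_ge_add_one_self[of "- (real K / real (2 * m))"] assms
    by (intro power_mono) (auto simp: divide_le_eq_1)
  also have "\<dots> = exp (- (real K / 2))"
    using assms by (simp flip: exp_of_nat_mult)
  also have "\<dots> = inverse (exp (real K / 2))" by (simp add: exp_minus)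
  also have "\<dots> \<le> inverse (real K / 2)"
    using exp_ge_add_one_self[of "real K / 2"] assms by (intro le_imp_inverse_le; linarith)
  also have "\<dots> = 2 / real K" by simp
  finally show ?thesis .
qed

text \<open>Started at running minimum \<open>K\<close>, the recursion involves only ranks up to
  \<open>K\<close>, whatever \<open>m\<close> is. This makes values for different \<open>m\<close>
  comparable.\<close>

lemma half_value_trunc:
  assumes "0 < K" "K \<le> m"
  shows "cont_value (2 * m) m K \<le> half_value m" "half_value m \<le> cont_value (2 * m) m K + 2 / real K"
  unfolding half_value_def
  using cont_value_mono[of K "Suc m" m "2 * m"] cont_value_upper[of K "Suc m" m "2 * m"]
    miss_prob_half_le[of K m] assms by auto

text \<open>\<open>U\<close> follows one quantity with fixed rank through the \<open>q\<close> fine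
  steps that replace a coarse step with denominator \<open>s\<close>. The fine denominators exceed
  \<open>q * m\<close> and each numerator is at most \<open>K\<close> in absolute value, so all
  \<open>q\<close> steps together move \<open>U\<close> by at most \<open>K / m\<close>.\<close>

lemma refine_drift:
  fixes U :: "nat \<Rightarrow> real" and G :: "nat \<Rightarrow> nat \<Rightarrow> real"
  assumes step: "\<And>i. i < q \<Longrightarrow> U (Suc i) = U i + (\<Sum>j=1..r. G i j - U i) / real (q * s - i)"
    and U01: "\<And>i. i \<le> q \<Longrightarrow> 0 \<le> U i \<and> U i \<le> 1"
    and G01: "\<And>i j. i \<le> q \<Longrightarrow> j \<in> {1..r} \<Longrightarrow> 0 \<le> G i j \<and> G i j \<le> 1"
    and rK: "r \<le> K" and s: "m < s" "0 < m" and q: "0 < q"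
  shows "\<And>i. i < q \<Longrightarrow> 1 / real (q * s - i) \<le> 1 / (real q * real m)"
    and "\<And>i. i \<le> q \<Longrightarrow> \<bar>\<Sum>j=1..r. G i j - U i\<bar> \<le> real K"
    and "\<And>i. i \<le> q \<Longrightarrow> \<bar>U i - U 0\<bar> \<le> real K / real m"
proof -
  have qm: "0 < real q * real m" using q s by simp
  show inv: "1 / real (q * s - i) \<le> 1 / (real q * real m)" if "i < q" for i
  proof -
    have "q * Suc m \<le> q * s" using s by (intro mult_le_mono) auto
    then have "q * m \<le> q * s - i" using that by auto
    then have "real q * real m \<le> real (q * s - i)" by (metis of_nat_le_iff of_nat_mult)
    then show ?thesis using qm by (intro frac_le; linarith)
  qed
  show dS: "\<bar>\<Sum>j=1..r. G i j - U i\<bar> \<le> real K" if "i \<le> q" for i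
  proof -
    have "\<bar>\<Sum>j=1..r. G i j - U i\<bar> \<le> (\<Sum>j=1..r. \<bar>G i j - U i\<bar>)" by (rule sum_abs)
    also have "\<dots> \<le> (\<Sum>j=1..r. 1)" using G01[OF that] U01[OF that] by (intro sum_mono) (auto simp: abs_le_iff, smt+)
    finally show ?thesis using rK by simp
  qed
  have drift: "\<bar>U i - U 0\<bar> \<le> real i * (real K / (real q * real m))" if "i \<le> q" for i
    using that
  proof (induction i)
    case (Suc i)
    have "\<bar>U (Suc i) - U i\<bar> = \<bar>\<Sum>j=1..r. G i j - U i\<bar> * (1 / real (q * s - i))"
      using step[of i] Suc.prems by (simp add: abs_mult)
    also have "\<dots> \<le> real K * (1 / (real q * real m))"
      using dS[of i] inv[of i] Suc.prems by (intro mult_mono) auto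
    finally show ?case using Suc by (simp add: algebra_simps add_divide_distrib)
  qed auto
  show "\<bar>U i - U 0\<bar> \<le> real K / real m" if "i \<le> q" for i
  proof -
    have "real i * (real K / (real q * real m)) \<le> real q * (real K / (real q * real m))"
      using that by (intro mult_right_mono) auto
    then show ?thesis using drift[OF that] q by simp
  qed
qed

text \<open>One coarse Euler step against \<open>q\<close> fine ones.\<close>

lemma refine_step:
  fixes U :: "nat \<Rightarrow> real" and G :: "nat \<Rightarrow> nat \<Rightarrow> real"
  assumes step: "\<And>i. i < q \<Longrightarrow> U (Suc i) = U i + (\<Sum>j=1..r. G i j - U i) / real (q * s - i)"
    and U01: "\<And>i. i \<le> q \<Longrightarrow> 0 \<le> U i \<and> U i \<le> 1"
    and G01: "\<And>i j. i \<le> q \<Longrightarrow> j \<in> {1..r} \<Longrightarrow> 0 \<le> G i j \<and> G i j \<le> 1"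
    and Gv: "\<And>i j. i \<le> q \<Longrightarrow> j \<in> {1..r} \<Longrightarrow> \<bar>G i j - G 0 j\<bar> \<le> real K / real m"
    and rK: "r \<le> K" and s: "m < s" "0 < m" and q: "0 < q"
  shows "\<bar>U q - (U 0 + (\<Sum>j=1..r. G 0 j - U 0) / real s)\<bar> \<le> 3 * (real K / real m)\<^sup>2"
proof -
  have inv: "1 / real (q * s - i) \<le> 1 / (real q * real m)" if "i < q" for i
    by (rule refine_drift(1)[OF step]) (use assms that in auto)
  have dS: "\<bar>\<Sum>j=1..r. G i j - U i\<bar> \<le> real K" if "i \<le> q" for i
    by (rule refine_drift(2)[OF step U01 G01]) (use assms that in auto)
  have driftm: "\<bar>U i - U 0\<bar> \<le> real K / real m" if "i \<le> q" for i
    by (rule refine_drift(3)[OF step U01 G01]) (use assms that in auto)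
  have inv': "1 / (real q * real s) \<le> 1 / real (q * s - i)" if "i < q" for i
  proof -
    have "i < q * s" using that s by (metis One_nat_def Suc_leI gr_implies_not0 le_trans less_le_trans mult_le_mono2 nat_mult_1_right neq0_conv)
    moreover have "real (q * s - i) \<le> real q * real s" by (metis diff_le_self of_nat_le_iff of_nat_mult)
    moreover have "0 < real (q * s - i)" using calculation(1) by (intro of_nat_0_less_iff[THEN iffD2]) simp
    ultimately show ?thesis by (intro frac_le; linarith)
  qed
  define S where "S i = (\<Sum>j=1..r. G i j - U i)" for i
  have SS: "\<bar>S i - S 0\<bar> \<le> 2 * (real K)\<^sup>2 / real m" if "i \<le> q" for i
  proof -
    have "\<bar>S i - S 0\<bar> = \<bar>\<Sum>j=1..r. (G i j - G 0 j) - (U i - U 0)\<bar>"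
      unfolding S_def by (subst sum_subtractf[symmetric]) (simp add: algebra_simps)
    also have "\<dots> \<le> (\<Sum>j=1..r. \<bar>(G i j - G 0 j) - (U i - U 0)\<bar>)" by (rule sum_abs)
    also have "\<dots> \<le> (\<Sum>j=1..r. 2 * (real K / real m))"
    proof (intro sum_mono)
      fix j assume "j \<in> {1..r}"
      then show "\<bar>(G i j - G 0 j) - (U i - U 0)\<bar> \<le> 2 * (real K / real m)"
        using Gv[OF that, of j] driftm[OF that] abs_triangle_ineq4[of "G i j - G 0 j" "U i - U 0"] by linarith
    qed
    also have "\<dots> = real r * (2 * (real K / real m))" by simp
    also have "\<dots> \<le> real K * (2 * (real K / real m))" using rK by (intro mult_right_mono) auto
    finally show ?thesis by (simp add: power2_eq_square mult_ac)
  qed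
  have tel: "U k = U 0 + (\<Sum>i<k. S i / real (q * s - i))" if "k \<le> q" for k
    using that by (induction k) (auto simp: step S_def)
  \<comment> \<open>\<open>H\<close> is the total weight of the fine steps and takes the place of
    \<open>1 / s\<close>.\<close>
  define H where "H = (\<Sum>i<q. 1 / real (q * s - i))"
  have H: "H \<le> 1 / real m" "1 / real s \<le> H"
  proof -
    have "H \<le> (\<Sum>i<q. 1 / (real q * real m))" unfolding H_def using inv by (intro sum_mono) auto
    then show "H \<le> 1 / real m" using q by simp
    have "(\<Sum>i<q. 1 / (real q * real s)) \<le> H" unfolding H_def using inv' by (intro sum_mono) auto
    then show "1 / real s \<le> H" using q by simp
  qed
  \<comment> \<open>Two sources of error: the numerators \<open>S i\<close> drift during the fine
    steps, and the total weight \<open>H\<close> differs from \<open>1 / s\<close>.\<close>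
  have "U q - (U 0 + S 0 / real s) = (\<Sum>i<q. (S i - S 0) / real (q * s - i)) + S 0 * (H - 1 / real s)"
    unfolding tel[OF order_refl] H_def
    by (simp add: diff_divide_distrib sum_subtractf algebra_simps sum_distrib_left)
  also have "\<bar>\<dots>\<bar> \<le> \<bar>\<Sum>i<q. (S i - S 0) / real (q * s - i)\<bar> + \<bar>S 0 * (H - 1 / real s)\<bar>" by (rule abs_triangle_ineq)
  also have "\<bar>\<Sum>i<q. (S i - S 0) / real (q * s - i)\<bar> \<le> (\<Sum>i<q. \<bar>(S i - S 0) / real (q * s - i)\<bar>)" by (rule sum_abs)
  also have "\<dots> \<le> (\<Sum>i<q. (2 * (real K)\<^sup>2 / real m) * (1 / real (q * s - i)))"
  proof (intro sum_mono)
    fix i assume i: "i \<in> {..<q}"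
    have "\<bar>(S i - S 0) / real (q * s - i)\<bar> = \<bar>S i - S 0\<bar> * (1 / real (q * s - i))" by (simp add: abs_divide)
    also have "\<dots> \<le> (2 * (real K)\<^sup>2 / real m) * (1 / real (q * s - i))"
      using SS[of i] i by (intro mult_right_mono) auto
    finally show "\<bar>(S i - S 0) / real (q * s - i)\<bar> \<le> (2 * (real K)\<^sup>2 / real m) * (1 / real (q * s - i))" .
  qed
  also have "\<dots> = (2 * (real K)\<^sup>2 / real m) * H" unfolding H_def by (simp add: sum_distrib_left)
  also have "\<dots> \<le> (2 * (real K)\<^sup>2 / real m) * (1 / real m)" using H by (intro mult_left_mono) auto
  also have "\<dots> = 2 * (real K / real m)\<^sup>2" by (simp add: power2_eq_square)
  also have "\<bar>S 0 * (H - 1 / real s)\<bar> \<le> (real K / real m)\<^sup>2"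
  proof (cases "K = 0")
    case True then show ?thesis using rK by (simp add: S_def)
  next
    case False
    \<comment> \<open>All fine denominators are at least \<open>q * (s - 1)\<close>, so
      \<open>H\<close> is at most \<open>1 / (s - 1)\<close>.\<close>
    have "H - 1 / real s \<le> 1 / real m * (1 / real m)"
    proof -
      have ms: "0 < real m" "0 < real s" using s by auto
      have *: "1 / real (q * s - i) \<le> 1 / (real q * real (s - 1))" if "i < q" for i
      proof -
        have "q * (s - 1) \<le> q * s - i" using that by (simp add: algebra_simps)
        then have "real q * real (s - 1) \<le> real (q * s - i)" by (metis of_nat_le_iff of_nat_mult)
        moreover have "0 < real q * real (s - 1)" using q s by (intro mult_pos_pos of_nat_0_less_iff[THEN iffD2]) auto
        ultimately show ?thesis by (intro frac_le; linarith)
      qed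
      have "H \<le> (\<Sum>i<q. 1 / (real q * real (s - 1)))" unfolding H_def using * by (intro sum_mono) auto
      also have "\<dots> = 1 / real (s - 1)" using q by simp
      finally have "H - 1 / real s \<le> 1 / real (s - 1) - 1 / real s" by simp
      also have "\<dots> = 1 / real (s - 1) * (1 / real s)" using s by (simp add: field_simps of_nat_diff)
      also have "\<dots> \<le> 1 / real m * (1 / real m)" using s by (intro mult_mono divide_left_mono) auto
      finally show ?thesis .
    qed
    then have "\<bar>S 0 * (H - 1 / real s)\<bar> \<le> real K * (1 / real m * (1 / real m))"
      using H dS[of 0] unfolding abs_mult S_def[symmetric] by (intro mult_mono) auto
    also have "\<dots> \<le> (real K)\<^sup>2 * (1 / real m * (1 / real m))"
      using False by (intro mult_right_mono) (auto simp: power2_eq_square)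
    finally show ?thesis by (simp add: power2_eq_square)
  qed
  finally show ?thesis by (simp add: S_def)
qed

text \<open>A coarse step is an averaging: the weights \<open>1 - r / s\<close> and \<open>r\<close>
  times \<open>1 / s\<close> add up to 1, and taking maxima does not enlarge errors. The error
  inherited from the induction hypothesis is thus passed on unamplified, and each of the
  \<open>d\<close> steps adds only the local error of \<open>refine_step\<close>. Both bounds go
  together because the value recursion takes maxima with \<open>miss_prob\<close>.\<close>

lemma refine_error:
  assumes "K \<le> m" "0 < m" "0 < q" "d \<le> m" "r \<le> K"
  shows "\<bar>miss_prob (2 * m) d r - miss_prob (2 * (q * m)) (q * d) r\<bar> \<le> 3 * real d * (real K / real m)\<^sup>2 \<and>
         \<bar>cont_value (2 * m) d r - cont_value (2 * (q * m)) (q * d) r\<bar> \<le> 3 * real d * (real K / real m)\<^sup>2"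
  using assms(4,5)
proof (induction d arbitrary: r)
  case (Suc d)
  define s where "s = 2 * m - d"
  define M where "M = 2 * (q * m)"
  have s: "m < s" using Suc.prems by (auto simp: s_def)
  have qd: "q * d + q \<le> q * m" using Suc.prems(1) by (metis add.commute mult_Suc_right mult_le_mono2)
  have qmd: "M - (q * d + i) = q * s - i" for i
    by (simp add: M_def s_def algebra_simps diff_mult_distrib2)
  have Kqm: "K \<le> q * m" using assms by (metis le_trans le_add1 mult_le_mono1 nat_mult_1 Suc_leI One_nat_def)
  have rng: "j + (q * d + i) \<le> Suc M \<and> q * d + i \<le> M" if "i \<le> q" "j \<le> K" for i j
    using qd that Kqm by (auto simp: M_def)
  let ?Q = "\<lambda>i j. miss_prob M (q * d + i) j"
  let ?V = "\<lambda>i j. cont_value M (q * d + i) j"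
  have Q01: "0 \<le> ?Q i j \<and> ?Q i j \<le> 1" and V01: "0 \<le> ?V i j \<and> ?V i j \<le> 1" if "i \<le> q" "j \<le> K" for i j
    using miss_prob_bounds cont_value_bounds rng[OF that] by blast+
  have Qs: "?Q (Suc i) j = ?Q i j + (\<Sum>k=1..j. 0 - ?Q i j) / real (q * s - i)" for i j
    unfolding add_Suc_right miss_prob_step qmd ..
  have Vs: "?V (Suc i) j = ?V i j + (\<Sum>k=1..j. max (?Q i k) (?V i k) - ?V i j) / real (q * s - i)" for i j
    unfolding add_Suc_right cont_value_step qmd ..
  have Qd: "\<bar>?Q i j - ?Q 0 j\<bar> \<le> real K / real m" if "i \<le> q" "j \<le> K" for i j
    by (rule refine_drift(3)[where G = "\<lambda>_ _. 0" and U = "\<lambda>i. ?Q i j" and r = j and q = q and s = s])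
      (use Qs in blast, use Q01 s assms that in auto)
  have Qe: "\<bar>?Q q j - (?Q 0 j + (\<Sum>k=1..j. 0 - ?Q 0 j) / real s)\<bar> \<le> 3 * (real K / real m)\<^sup>2" if "j \<le> K" for j
    by (rule refine_step[where G = "\<lambda>_ _. 0" and U = "\<lambda>i. ?Q i j" and r = j])
      (use Qs in blast, use Q01 s assms that in auto)
  have Vd: "\<bar>?V i j - ?V 0 j\<bar> \<le> real K / real m" if "i \<le> q" "j \<le> K" for i j
  proof (rule refine_drift(3)[where G = "\<lambda>i k. max (?Q i k) (?V i k)" and U = "\<lambda>i. ?V i j" and r = j and q = q and s = s])
    fix i k assume "i \<le> q" "k \<in> {1..j}"
    then show "0 \<le> max (?Q i k) (?V i k) \<and> max (?Q i k) (?V i k) \<le> 1"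
      using Q01[of i k] V01[of i k] that by auto
  qed (use Vs in blast, use V01 s assms that in auto)
  have Ve: "\<bar>?V q r - (?V 0 r + (\<Sum>k=1..r. max (?Q 0 k) (?V 0 k) - ?V 0 r) / real s)\<bar> \<le> 3 * (real K / real m)\<^sup>2"
  proof (rule refine_step[where G = "\<lambda>i k. max (?Q i k) (?V i k)" and U = "\<lambda>i. ?V i r" and r = r])
    fix i j assume ij: "i \<le> q" "j \<in> {1..r}"
    then have jK: "j \<le> K" using Suc.prems by auto
    show "\<bar>max (?Q i j) (?V i j) - max (?Q 0 j) (?V 0 j)\<bar> \<le> real K / real m"
      using Qd[OF ij(1) jK] Vd[OF ij(1) jK] by (auto simp: max_def)
    show "0 \<le> max (?Q i j) (?V i j) \<and> max (?Q i j) (?V i j) \<le> 1"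
      using Q01[OF ij(1) jK] V01[OF ij(1) jK] by auto
  qed (use Vs in blast, use V01 s assms Suc.prems in auto)
  define e where "e = 3 * real d * (real K / real m)\<^sup>2"
  have IHQ: "\<bar>miss_prob (2 * m) d j - ?Q 0 j\<bar> \<le> e" and IHV: "\<bar>cont_value (2 * m) d j - ?V 0 j\<bar> \<le> e" if "j \<le> K" for j
    using Suc.IH[of j] Suc.prems that by (auto simp: e_def M_def)
  have sr: "real r \<le> real s" "0 < real s" using Suc.prems s assms by auto
  have c: "0 \<le> 1 - real r / real s" using sr by (simp add: divide_le_eq_1)
  have Q1: "\<bar>miss_prob (2 * m) (Suc d) r - (?Q 0 r + (\<Sum>k=1..r. 0 - ?Q 0 r) / real s)\<bar> \<le> e"
  proof -
    have "miss_prob (2 * m) (Suc d) r - (?Q 0 r + (\<Sum>k=1..r. 0 - ?Q 0 r) / real s) =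
       (1 - real r / real s) * (miss_prob (2 * m) d r - ?Q 0 r)"
      unfolding miss_prob.simps s_def[symmetric] using sr by (simp add: field_simps)
    also have "\<bar>\<dots>\<bar> \<le> 1 * e"
      unfolding abs_mult abs_of_nonneg[OF c] by (rule mult_mono[OF _ IHQ[OF Suc.prems(2)]]) auto
    finally show ?thesis by simp
  qed
  have V1: "\<bar>cont_value (2 * m) (Suc d) r - (?V 0 r + (\<Sum>k=1..r. max (?Q 0 k) (?V 0 k) - ?V 0 r) / real s)\<bar> \<le> e"
  proof -
    let ?g = "\<lambda>k. max (miss_prob (2 * m) d k) (cont_value (2 * m) d k)"
    let ?h = "\<lambda>k. max (?Q 0 k) (?V 0 k)"
    let ?x = "(1 - real r / real s) * (cont_value (2 * m) d r - ?V 0 r)" and ?y = "(\<Sum>k=1..r. ?g k - ?h k) / real s"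
    have eq: "cont_value (2 * m) (Suc d) r - (?V 0 r + (\<Sum>k=1..r. ?h k - ?V 0 r) / real s) = ?x + ?y"
      unfolding cont_value.simps s_def[symmetric] using sr by (simp add: sum_subtractf field_simps)
    have x: "\<bar>?x\<bar> \<le> (1 - real r / real s) * e"
      unfolding abs_mult abs_of_nonneg[OF c] by (rule mult_left_mono[OF IHV[OF Suc.prems(2)] c])
    have "\<bar>\<Sum>k=1..r. ?g k - ?h k\<bar> \<le> (\<Sum>k=1..r. \<bar>?g k - ?h k\<bar>)" by (rule sum_abs)
    also have "\<dots> \<le> (\<Sum>k=1..r. e)"
    proof (intro sum_mono)
      fix k assume "k \<in> {1..r}"
      then have "k \<le> K" using Suc.prems by auto
      then show "\<bar>?g k - ?h k\<bar> \<le> e" using IHQ[of k] IHV[of k] by (auto simp: max_def)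
    qed
    finally have y: "\<bar>?y\<bar> \<le> real r * e / real s" using sr by (simp add: abs_divide divide_right_mono)
    have "\<bar>?x + ?y\<bar> \<le> (1 - real r / real s) * e + real r * e / real s"
      using add_mono[OF x y] by (rule order_trans[OF abs_triangle_ineq])
    also have "\<dots> = e" using sr by (simp add: field_simps)
    finally show ?thesis unfolding eq .
  qed
  have "q * Suc d = q * d + q" by simp
  moreover have "3 * real (Suc d) * (real K / real m)\<^sup>2 = e + 3 * (real K / real m)\<^sup>2"
    by (simp add: e_def algebra_simps)
  ultimately show ?case using Q1 V1 Qe[OF Suc.prems(2)] Ve unfolding M_def by (smt (verit) add_0_right)
qed auto

text \<open>The accumulated error \<open>3 * K^2 / m\<close> is balanced against the truncation
  error: \<open>K ^ 3 \<le> m\<close> makes it at most \<open>3 / K\<close>. Truncation errs in one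
  direction only, for \<open>m\<close> and for \<open>q * m\<close> alike, so its
  \<open>2 / K\<close> enters once.\<close>

lemma half_value_refine:
  assumes "0 < K" "K ^ 3 \<le> m" "0 < q"
  shows "\<bar>half_value m - half_value (q * m)\<bar> \<le> 5 / real K"
proof -
  have "K ^ 1 \<le> K ^ 3" using assms by (intro power_increasing) auto
  then have Km: "K \<le> m" "0 < m" using assms by auto
  then have Kqm: "K \<le> q * m" using assms by (metis le_trans le_add1 mult_le_mono1 nat_mult_1 Suc_leI One_nat_def)
  have "3 * real m * (real K / real m)\<^sup>2 = 3 * ((real K)^3 / real m) / real K"
    using Km assms by (simp add: power2_eq_square power3_eq_cube field_simps)
  also have "\<dots> \<le> 3 * 1 / real K"
  proof -
    have "(real K)^3 \<le> real m" using assms by (metis of_nat_le_iff of_nat_power)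
    then show ?thesis using Km assms by (intro divide_right_mono mult_left_mono) (auto simp: divide_le_eq_1)
  qed
  finally have "\<bar>cont_value (2 * m) m K - cont_value (2 * (q * m)) (q * m) K\<bar> \<le> 3 / real K"
    using refine_error[of K m q m K] Km assms by auto
  moreover have "3 / real K + 2 / real K = 5 / real K" by (simp add: add_divide_distrib[symmetric])
  ultimately show ?thesis
    using half_value_trunc[of K m] half_value_trunc[of K "q * m"] Km Kqm assms by linarith
qed

lemma half_value_bounds: "0 \<le> half_value m \<and> half_value m \<le> 1"
  unfolding half_value_def by (rule cont_value_bounds) auto

lemma convergent_half_value: "convergent half_value"
proof -
  have "Cauchy half_value"
  proof (rule metric_CauchyI)
    fix e :: real assume e: "0 < e"
    obtain K :: nat where K: "10 / e < real K" using reals_Archimedean2 by blast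
    then have K0: "0 < K" using e by (cases "K = 0") (auto simp: field_simps)
    have *: "\<bar>half_value m - half_value k\<bar> < e" if "K ^ 3 \<le> m" "K ^ 3 \<le> k" for m k
    proof -
      have "0 < m" "0 < k" using that K0 by (auto intro: Nat.gr0I)
      \<comment> \<open>Two indices are compared through their common multiple
        \<open>k * m\<close>.\<close>
      then have "\<bar>half_value m - half_value (k * m)\<bar> \<le> 5 / real K" "\<bar>half_value k - half_value (m * k)\<bar> \<le> 5 / real K"
        using half_value_refine[of K m k] half_value_refine[of K k m] K0 that by auto
      then have "\<bar>half_value m - half_value k\<bar> \<le> 10 / real K" by (simp add: mult.commute)
      also have "\<dots> < e" using K K0 e by (simp add: field_simps)
      finally show ?thesis .
    qed
    show "\<exists>M. \<forall>m\<ge>M. \<forall>n\<ge>M. dist (half_value m) (half_value n) < e"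
      using * by (auto simp: dist_real_def)
  qed
  then show ?thesis by (rule Cauchy_convergent)
qed

text \<open>Along the multiples of \<open>m\<close> the values still tend to \<open>L\<close>, and
  there \<open>half_value_refine\<close> bounds them uniformly.\<close>

lemma half_value_ge_limit:
  assumes "half_value \<longlonglongrightarrow> L" "0 < K" "K ^ 3 \<le> m"
  shows "L - 5 / real K \<le> half_value m"
proof -
  have m: "0 < m" using assms by (auto intro: Nat.gr0I)
  have "strict_mono (\<lambda>q. Suc q * m)" using m by (auto simp: strict_mono_def)
  from LIMSEQ_subseq_LIMSEQ[OF assms(1) this]
  have "(\<lambda>q. half_value (Suc q * m)) \<longlonglongrightarrow> L" by (simp add: o_def)
  moreover have "half_value (Suc q * m) \<le> half_value m + 5 / real K" for q
    using half_value_refine[of K m "Suc q"] assms by (auto simp: abs_le_iff)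
  ultimately have "L \<le> half_value m + 5 / real K" by (auto intro: LIMSEQ_le_const2)
  then show ?thesis by simp
qed

section \<open>Relative ranks of a random permutation\<close>

definition rel_rank :: "(nat \<Rightarrow> real) \<Rightarrow> nat \<Rightarrow> nat" where
  "rel_rank x t = Suc (card {u. u < t \<and> x t < x u})"

lemma rel_rank_le: "rel_rank x t \<le> Suc t"
proof -
  have "card {u. u < t \<and> x t < x u} \<le> card {..<t}" by (intro card_mono) auto
  then show ?thesis by (simp add: rel_rank_def)
qed

text \<open>By induction the first \<open>k\<close> values are ordered alike in \<open>x\<close> and
  \<open>y\<close>. The earlier values above the newest one form an upper set of this common order,
  upper sets of a linear order are nested, and the relative rank gives their cardinality; hence the
  two sets coincide.\<close>

lemma order_determined_by_rel_rank:
  assumes "inj_on x {..<k}" "inj_on y {..<k}" "\<And>t. t < k \<Longrightarrow> rel_rank x t = rel_rank y t"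
  shows "i < k \<Longrightarrow> j < k \<Longrightarrow> x i < x j \<longleftrightarrow> y i < y j"
  using assms
proof (induction k arbitrary: i j)
  case (Suc k)
  have IH: "x i < x j \<longleftrightarrow> y i < y j" if "i < k" "j < k" for i j
    by (rule Suc.IH) (use Suc.prems that in \<open>auto simp: inj_on_def\<close>)
  let ?A = "{u. u < k \<and> x k < x u}" and ?B = "{u. u < k \<and> y k < y u}"
  have card: "card ?A = card ?B" using Suc.prems(5)[of k] by (simp add: rel_rank_def)
  have "?A \<subseteq> ?B \<or> ?B \<subseteq> ?A"
  proof (rule ccontr)
    assume "\<not> ?thesis"
    then obtain a b where "a \<in> ?A - ?B" "b \<in> ?B - ?A" by blast
    then show False using IH[of b a] by auto
  qed
  then have AB: "?A = ?B"
  proof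
    assume "?A \<subseteq> ?B" then show ?thesis by (intro card_subset_eq card) simp
  next
    assume "?B \<subseteq> ?A" then show ?thesis by (intro card_subset_eq[symmetric] card[symmetric]) simp
  qed
  have new: "x k < x u \<longleftrightarrow> y k < y u" if "u < k" for u using AB that by blast
  have new': "x u < x k \<longleftrightarrow> y u < y k" if "u < k" for u
  proof -
    have "x u \<noteq> x k" "y u \<noteq> y k" using Suc.prems(3,4) that by (auto dest: inj_onD)
    then show ?thesis using new[OF that] by linarith
  qed
  show ?case using Suc.prems(1,2) IH new new' by (cases "i = k"; cases "j = k") auto
qed auto

text \<open>Only values before time \<open>m\<close> can exceed a record, and they also exceed every
  other value since \<open>m\<close>, so the sets counted by \<open>rel_rank\<close> are nested.
  Conversely, if \<open>x t\<close> is not a record, the largest value since \<open>m\<close> has a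
  strictly smaller relative rank.\<close>

lemma record_iff_rel_rank:
  assumes inj: "inj_on x {..<N}" and t: "m \<le> t" "t < N"
  shows "(\<forall>s\<in>{m..<t}. x s < x t) \<longleftrightarrow> (\<forall>s\<in>{m..<t}. rel_rank x t \<le> rel_rank x s)"
proof
  assume rec: "\<forall>s\<in>{m..<t}. x s < x t"
  show "\<forall>s\<in>{m..<t}. rel_rank x t \<le> rel_rank x s"
  proof
    fix s assume s: "s \<in> {m..<t}"
    have "u < s \<and> x s < x u" if "u < t \<and> x t < x u" for u
    proof -
      have "u < m" using rec that by (metis atLeastLessThan_iff not_less order_less_asym)
      then show ?thesis using s rec that by (metis atLeastLessThan_iff less_le_trans order_less_trans)
    qed
    then show "rel_rank x t \<le> rel_rank x s"
      unfolding rel_rank_def by (auto intro!: card_mono)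
  qed
next
  assume le: "\<forall>s\<in>{m..<t}. rel_rank x t \<le> rel_rank x s"
  show "\<forall>s\<in>{m..<t}. x s < x t"
  proof (rule ccontr)
    assume "\<not> ?thesis"
    then obtain a where a: "a \<in> {m..<t}" "\<not> x a < x t" by blast
    obtain s where s: "s \<in> {m..<t}" "\<And>u. u \<in> {m..<t} \<Longrightarrow> x u \<le> x s"
    proof -
      have "Max (x ` {m..<t}) \<in> x ` {m..<t}" using a by (intro Max_in) auto
      then obtain s where "s \<in> {m..<t}" "x s = Max (x ` {m..<t})" by force
      then show ?thesis using that[of s] by simp
    qed
    have "x t \<noteq> x s" using s t inj by (auto dest: inj_onD)
    then have "x t < x s" using s(2)[OF a(1)] a(2) by linarith
    have "{u. u < s \<and> x s < x u} \<subset> {u. u < t \<and> x t < x u}"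
      using s(1) \<open>x t < x s\<close> by fastforce
    then have "rel_rank x s < rel_rank x t" unfolding rel_rank_def by (auto intro: psubset_card_mono)
    then show False using le s(1) by fastforce
  qed
qed

text \<open>The inequality is strict towards the future because a later value with the same relative
  rank is a new record. Backwards, the first later value to exceed \<open>x t\<close> would be a
  record since \<open>m\<close>, so its relative rank would be at most that of
  \<open>t\<close>.\<close>

lemma max_iff_rel_rank:
  assumes inj: "inj_on x {..<N}" and t: "m \<le> t" "t < N"
  shows "(\<forall>s\<in>{m..<N}. s \<noteq> t \<longrightarrow> x s < x t) \<longleftrightarrow>
    (\<forall>s\<in>{m..<t}. rel_rank x t \<le> rel_rank x s) \<and> (\<forall>s\<in>{t<..<N}. rel_rank x t < rel_rank x s)"
proof
  assume max: "\<forall>s\<in>{m..<N}. s \<noteq> t \<longrightarrow> x s < x t"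
  have "\<forall>s\<in>{m..<t}. x s < x t" using max t by auto
  moreover have "rel_rank x t < rel_rank x s" if s: "s \<in> {t<..<N}" for s
  proof -
    have "x s < x t" using max s t by auto
    then have "{u. u < t \<and> x t < x u} \<subset> {u. u < s \<and> x s < x u}"
      using s by fastforce
    then show ?thesis unfolding rel_rank_def by (auto intro: psubset_card_mono)
  qed
  ultimately show "(\<forall>s\<in>{m..<t}. rel_rank x t \<le> rel_rank x s) \<and> (\<forall>s\<in>{t<..<N}. rel_rank x t < rel_rank x s)"
    using record_iff_rel_rank[OF assms] by blast
next
  assume R: "(\<forall>s\<in>{m..<t}. rel_rank x t \<le> rel_rank x s) \<and> (\<forall>s\<in>{t<..<N}. rel_rank x t < rel_rank x s)"
  then have rec: "\<forall>s\<in>{m..<t}. x s < x t" using record_iff_rel_rank[OF assms] by blast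
  have "x s < x t" if "s \<in> {t<..<N}" for s
    using that
  proof (induction s rule: less_induct)
    case (less s)
    show ?case
    proof (rule ccontr)
      assume "\<not> x s < x t"
      moreover have "x s \<noteq> x t" using less.prems t inj by (auto dest: inj_onD)
      ultimately have st: "x t < x s" by linarith
      have "x u < x s" if "u \<in> {m..<s}" for u
      proof (cases u t rule: linorder_cases)
        case less
        then have "x u < x t" using rec that by auto
        then show ?thesis using st by simp
      next
        case equal then show ?thesis using st by simp
      next
        case greater
        then have "x u < x t" using less.IH[of u] that less.prems by auto
        then show ?thesis using st by simp
      qed
      then have "rel_rank x s \<le> rel_rank x t"
        using record_iff_rel_rank[OF inj, of m s] less.prems t by auto
      then show False using R less.prems by fastforce
    qed
  qed
  then show "\<forall>s\<in>{m..<N}. s \<noteq> t \<longrightarrow> x s < x t"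
    using rec by (metis atLeastLessThan_iff greaterThanLessThan_iff linorder_neqE_nat)
qed

section \<open>Backward induction by counting sequences of relative ranks\<close>

text \<open>The possible relative ranks of \<open>d\<close> values that arrive after
  \<open>s\<close> others. Independence of the ranks is expressed by the product form of this set,
  and probabilities become ratios of cardinalities.\<close>

definition rank_lists :: "nat \<Rightarrow> nat \<Rightarrow> nat list set" where
  "rank_lists s d = {l. length l = d \<and> (\<forall>i<d. l ! i \<in> {1..Suc (s + i)})}"

lemma rank_lists_0: "rank_lists s 0 = {[]}"
  by (auto simp: rank_lists_def)

lemma rank_lists_Suc: "rank_lists s (Suc d) = (\<lambda>(j, l). j # l) ` ({1..Suc s} \<times> rank_lists (Suc s) d)"
proof (intro equalityI subsetI)
  fix l assume l: "l \<in> rank_lists s (Suc d)"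
  then obtain j l' where jl: "l = j # l'" by (cases l) (auto simp: rank_lists_def)
  have "j \<in> {1..Suc s}" using l jl by (force simp: rank_lists_def)
  moreover have "l' ! i \<in> {1..Suc (Suc s + i)}" if "i < d" for i
    using l jl that unfolding rank_lists_def by (auto dest!: spec[of _ "Suc i"])
  ultimately show "l \<in> (\<lambda>(j, l). j # l) ` ({1..Suc s} \<times> rank_lists (Suc s) d)"
    using l jl by (auto simp: rank_lists_def)
next
  fix l assume "l \<in> (\<lambda>(j, l). j # l) ` ({1..Suc s} \<times> rank_lists (Suc s) d)"
  then show "l \<in> rank_lists s (Suc d)"
    by (auto simp: rank_lists_def less_Suc_eq_0_disj)
qed

lemma finite_rank_lists: "finite (rank_lists s d)"
  by (induction d arbitrary: s) (auto simp: rank_lists_0 rank_lists_Suc)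

lemma card_rank_lists_filter:
  "card {l \<in> rank_lists s (Suc d). P l} = (\<Sum>j=1..Suc s. card {l \<in> rank_lists (Suc s) d. P (j # l)})"
proof -
  have "{l \<in> rank_lists s (Suc d). P l} =
      (\<lambda>(j, l). j # l) ` (SIGMA j:{1..Suc s}. {l \<in> rank_lists (Suc s) d. P (j # l)})"
    unfolding rank_lists_Suc by auto
  also have "card \<dots> = card (SIGMA j:{1..Suc s}. {l \<in> rank_lists (Suc s) d. P (j # l)})"
    by (intro card_image) (auto simp: inj_on_def)
  finally show ?thesis by (simp add: finite_rank_lists)
qed

lemma card_rank_lists_Suc: "card (rank_lists s (Suc d)) = Suc s * card (rank_lists (Suc s) d)"
  using card_rank_lists_filter[of s d "\<lambda>_. True"] by simp

lemma card_rank_lists: "card (rank_lists s d) * fact s = fact (s + d)"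
proof (induction d arbitrary: s)
  case (Suc d)
  have "card (rank_lists s (Suc d)) * fact s = card (rank_lists (Suc s) d) * fact (Suc s)"
    by (simp add: card_rank_lists_Suc algebra_simps)
  then show ?case using Suc[of "Suc s"] by simp
qed (simp add: rank_lists_0)

lemma card_rank_lists_append:
  "card {l \<in> rank_lists s (a + b). P l} =
     (\<Sum>c\<in>rank_lists s a. card {l \<in> rank_lists (s + a) b. P (c @ l)})"
proof (induction a arbitrary: s P)
  case 0
  then show ?case by (simp add: rank_lists_0)
next
  case (Suc a)
  have "card {l \<in> rank_lists s (Suc a + b). P l} =
      (\<Sum>j=1..Suc s. \<Sum>c\<in>rank_lists (Suc s) a. card {l \<in> rank_lists (Suc s + a) b. P (j # c @ l)})"
    unfolding add_Suc card_rank_lists_filter Suc by simp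
  also have "\<dots> = (\<Sum>c\<in>rank_lists s (Suc a). card {l \<in> rank_lists (s + Suc a) b. P (c @ l)})"
    unfolding rank_lists_Suc
    by (subst sum.reindex) (auto simp: inj_on_def sum.cartesian_product case_prod_beta)
  finally show ?case .
qed

lemma card_rank_lists_miss:
  assumes "j \<le> Suc s"
  shows "real (card {l \<in> rank_lists s d. \<forall>i<d. j < l ! i}) = real (card (rank_lists s d)) * miss_prob (s + d) d j"
  using assms
proof (induction d arbitrary: s)
  case (Suc d)
  have eq: "card {l \<in> rank_lists (Suc s) d. \<forall>i<Suc d. j < (k # l) ! i} =
      (if j < k then card {l \<in> rank_lists (Suc s) d. \<forall>i<d. j < l ! i} else 0)" for k
    by (simp add: All_less_Suc2)
  have "card {l \<in> rank_lists s (Suc d). \<forall>i<Suc d. j < l ! i} =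
      (\<Sum>k=1..Suc s. if j < k then card {l \<in> rank_lists (Suc s) d. \<forall>i<d. j < l ! i} else 0)"
    unfolding card_rank_lists_filter eq ..
  also have "\<dots> = (\<Sum>k\<in>{k \<in> {1..Suc s}. j < k}. card {l \<in> rank_lists (Suc s) d. \<forall>i<d. j < l ! i})"
    by (rule sum.inter_filter[symmetric]) simp
  also have "{k \<in> {1..Suc s}. j < k} = {j<..Suc s}" by auto
  finally have "real (card {l \<in> rank_lists s (Suc d). \<forall>i<Suc d. j < l ! i}) =
      (real (Suc s) - real j) * (real (card (rank_lists (Suc s) d)) * miss_prob (s + Suc d) d j)"
    using Suc by (simp add: of_nat_diff)
  moreover have "(S - i) * (C * Q) = S * C * ((1 - i / S) * Q)" if "S \<noteq> 0" for S i C Q :: real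
    using that by (simp add: field_simps)
  moreover have "s + Suc d - d = Suc s" by simp
  ultimately show ?case unfolding card_rank_lists_Suc miss_prob.simps of_nat_mult by simp
qed (simp add: rank_lists_0)

text \<open>\<open>accepts_max\<close> read off from relative ranks. By
  \<open>max_iff_rel_rank\<close> the last two conjuncts express that the accepted value is the
  maximum from time \<open>m\<close> on.\<close>

definition win_ranks :: "nat \<Rightarrow> (nat list \<Rightarrow> bool) \<Rightarrow> nat list \<Rightarrow> bool" where
  "win_ranks m dec c \<longleftrightarrow> (\<exists>t. m \<le> t \<and> t < length c \<and> dec (take (Suc t) c) \<and>
     (\<forall>s. m \<le> s \<and> s < t \<longrightarrow> \<not> dec (take (Suc s) c)) \<and>
     (\<forall>s\<in>{m..<t}. c ! t \<le> c ! s) \<and> (\<forall>s\<in>{t<..<length c}. c ! t < c ! s))"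

text \<open>After the candidate \<open>j\<close> there are \<open>N - Suc (length c)\<close> values
  to come. A record is accepted when stopping is at least as good as continuing, so ties are
  resolved towards stopping.\<close>

definition optimal_dec :: "nat \<Rightarrow> nat \<Rightarrow> (nat list \<Rightarrow> bool) \<Rightarrow> bool" where
  "optimal_dec N m dec \<longleftrightarrow> (\<forall>c j. m \<le> length c \<longrightarrow> dec (c @ [j]) \<longleftrightarrow>
     (\<forall>i\<in>{m..<length c}. j \<le> c ! i) \<and>
     cont_value N (N - Suc (length c)) j \<le> miss_prob N (N - Suc (length c)) j)"

lemma win_ranks_accepted:
  assumes len: "length c = s" "m \<le> s"
    and rej: "\<And>i. m \<le> i \<Longrightarrow> i < s \<Longrightarrow> \<not> dec (take (Suc i) c)"
    and acc: "dec (c @ [j])"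
  shows "win_ranks m dec (c @ j # l) \<longleftrightarrow> (\<forall>i\<in>{m..<s}. j \<le> c ! i) \<and> (\<forall>i<length l. j < l ! i)"
proof -
  let ?c = "c @ j # l"
  have take: "take (Suc s) ?c = c @ [j]" "\<And>i. i < s \<Longrightarrow> take (Suc i) ?c = take (Suc i) c"
    using len by auto
  have nth: "?c ! s = j" "\<And>i. i < s \<Longrightarrow> ?c ! i = c ! i" "\<And>i. ?c ! (Suc s + i) = l ! i"
    using len by (auto simp: nth_append)
  have only: "t = s" if "m \<le> t" "dec (take (Suc t) ?c)" "\<forall>i. m \<le> i \<and> i < t \<longrightarrow> \<not> dec (take (Suc i) ?c)" for t
  proof (cases t s rule: linorder_cases)
    case less then show ?thesis using rej[of t] that take by auto
  next
    case greater then show ?thesis using that acc take len by auto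
  qed auto
  have "win_ranks m dec ?c \<longleftrightarrow> (\<forall>i\<in>{m..<s}. ?c ! s \<le> ?c ! i) \<and> (\<forall>i\<in>{s<..<length ?c}. ?c ! s < ?c ! i)"
  proof
    assume "win_ranks m dec ?c"
    then obtain t where t: "m \<le> t" "dec (take (Suc t) ?c)" "\<forall>i. m \<le> i \<and> i < t \<longrightarrow> \<not> dec (take (Suc i) ?c)"
      "(\<forall>i\<in>{m..<t}. ?c ! t \<le> ?c ! i) \<and> (\<forall>i\<in>{t<..<length ?c}. ?c ! t < ?c ! i)"
      unfolding win_ranks_def by blast
    show "(\<forall>i\<in>{m..<s}. ?c ! s \<le> ?c ! i) \<and> (\<forall>i\<in>{s<..<length ?c}. ?c ! s < ?c ! i)"
      using t(4) unfolding only[OF t(1-3)] .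
  next
    assume *: "(\<forall>i\<in>{m..<s}. ?c ! s \<le> ?c ! i) \<and> (\<forall>i\<in>{s<..<length ?c}. ?c ! s < ?c ! i)"
    have "m \<le> s \<and> s < length ?c \<and> dec (take (Suc s) ?c) \<and> (\<forall>i. m \<le> i \<and> i < s \<longrightarrow> \<not> dec (take (Suc i) ?c))"
      using take acc rej len by simp
    with * show "win_ranks m dec ?c" unfolding win_ranks_def by blast
  qed
  also have "(\<forall>i\<in>{m..<s}. ?c ! s \<le> ?c ! i) \<longleftrightarrow> (\<forall>i\<in>{m..<s}. j \<le> c ! i)" using nth by auto
  also have "(\<forall>i\<in>{s<..<length ?c}. ?c ! s < ?c ! i) \<longleftrightarrow> (\<forall>i<length l. j < l ! i)"
  proof (intro iffI ballI allI impI)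
    fix i assume "\<forall>i\<in>{s<..<length ?c}. ?c ! s < ?c ! i" "i < length l"
    then have "?c ! s < ?c ! (Suc s + i)" using len by (auto simp del: nth_append_length)
    then show "j < l ! i" using nth by simp
  next
    fix i assume a: "\<forall>i<length l. j < l ! i" "i \<in> {s<..<length ?c}"
    then have "i = Suc s + (i - Suc s)" "i - Suc s < length l" using len by auto
    then show "?c ! s < ?c ! i" using nth(1) nth(3)[of "i - Suc s"] a by metis
  qed
  finally show ?thesis .
qed

lemma card_win_ranks:
  assumes "length c = s" "m \<le> s" "r \<le> Suc s"
    and "\<And>j. j \<le> Suc s \<Longrightarrow> (\<forall>i\<in>{m..<s}. j \<le> c ! i) \<longleftrightarrow> j \<le> r"
    and "\<And>i. m \<le> i \<Longrightarrow> i < s \<Longrightarrow> \<not> dec (take (Suc i) c)"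
  shows "real (card {l \<in> rank_lists s d. win_ranks m dec (c @ l)}) \<le>
           real (card (rank_lists s d)) * cont_value (s + d) d r \<and>
         (optimal_dec (s + d) m dec \<longrightarrow>
           real (card {l \<in> rank_lists s d. win_ranks m dec (c @ l)}) =
           real (card (rank_lists s d)) * cont_value (s + d) d r)"
  using assms
proof (induction d arbitrary: s r c)
  case 0
  have "\<not> win_ranks m dec c" using 0 by (auto simp: win_ranks_def)
  then show ?case by (simp add: rank_lists_0)
next
  case (Suc d)
  define N where "N = s + Suc d"
  define M where "M = real (card (rank_lists (Suc s) d))"
  define a where "a j = real (card {l \<in> rank_lists (Suc s) d. win_ranks m dec (c @ j # l)})" for j
  \<comment> \<open>\<open>b j\<close> is the best value attainable once rank \<open>j\<close> has
    appeared: a candidate \<open>j \<le> r\<close> offers the choice between stopping and continuing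
    with minimum \<open>j\<close>, any other rank leaves the minimum at \<open>r\<close>.\<close>
  define b where "b j = (if j \<le> r then max (miss_prob N d j) (cont_value N d j) else cont_value N d r)" for j
  have N: "Suc s + d = N" "N - Suc s = d" "N - d = Suc s" by (auto simp: N_def)
  have V0: "0 \<le> cont_value N d r" using cont_value_bounds[of r d N] Suc.prems(3) by (auto simp: N_def)
  have M0: "0 \<le> M" by (simp add: M_def)
  have acc: "a j = (if j \<le> r then M * miss_prob N d j else 0)" if j: "j \<in> {1..Suc s}" and dec: "dec (c @ [j])" for j
  proof -
    have "{l \<in> rank_lists (Suc s) d. win_ranks m dec (c @ j # l)} =
        {l \<in> rank_lists (Suc s) d. j \<le> r \<and> (\<forall>i<d. j < l ! i)}"
      using win_ranks_accepted[of c s m dec j, OF Suc.prems(1,2,5) dec] Suc.prems(4)[of j] j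
      by (auto simp: rank_lists_def)
    then show ?thesis using card_rank_lists_miss[of j "Suc s" d] j by (auto simp: a_def M_def N_def)
  qed
  have rej: "a j \<le> M * cont_value N d (min r j) \<and> (optimal_dec N m dec \<longrightarrow> a j = M * cont_value N d (min r j))"
    if j: "j \<in> {1..Suc s}" and dec: "\<not> dec (c @ [j])" for j
  proof -
    have nth: "(c @ [j]) ! i = (if i = s then j else c ! i)" if "i \<le> s" for i
      using that Suc.prems(1) by (auto simp: nth_append)
    have "(\<forall>i\<in>{m..<Suc s}. k \<le> (c @ [j]) ! i) \<longleftrightarrow> k \<le> min r j" for k
    proof -
      have "{m..<Suc s} = insert s {m..<s}" using Suc.prems(2) by auto
      then have "(\<forall>i\<in>{m..<Suc s}. k \<le> (c @ [j]) ! i) \<longleftrightarrow> k \<le> j \<and> (\<forall>i\<in>{m..<s}. k \<le> c ! i)"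
        using nth by auto
      then show ?thesis using Suc.prems(4)[of k] j by auto
    qed
    moreover have "\<not> dec (take (Suc i) (c @ [j]))" if "m \<le> i" "i < Suc s" for i
      using that Suc.prems(1,5) dec by (cases "i = s") auto
    ultimately show ?thesis
      using Suc.IH[of "c @ [j]" "Suc s" "min r j"] Suc.prems(1-3) j by (simp add: a_def M_def N_def del: cont_value.simps)
  qed
  have le: "a j \<le> M * b j" if j: "j \<in> {1..Suc s}" for j
  proof (cases "dec (c @ [j])")
    case True
    then show ?thesis using acc[OF j] V0 M0 by (auto simp: b_def intro!: mult_left_mono)
  next
    case False
    have "M * cont_value N d (min r j) \<le> M * b j" using M0 by (intro mult_left_mono) (auto simp: b_def min_def)
    then show ?thesis using rej[OF j False] by linarith
  qed
  have eq: "a j = M * b j" if j: "j \<in> {1..Suc s}" and opt: "optimal_dec N m dec" for j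
  proof -
    have "dec (c @ [j]) \<longleftrightarrow> j \<le> r \<and> cont_value N d j \<le> miss_prob N d j"
      using opt[unfolded optimal_dec_def, rule_format, of c j] Suc.prems(1,2) Suc.prems(4)[of j] j
      by (simp add: N)
    moreover have "min r j = (if j \<le> r then j else r)" by auto
    ultimately show ?thesis using acc[OF j] rej[OF j] opt by (cases "j \<le> r"; cases "dec (c @ [j])") (auto simp: b_def max_def)
  qed
  \<comment> \<open>Averaging \<open>b\<close> over the \<open>Suc s\<close> equally likely ranks
    reproduces the recursion of \<open>cont_value\<close>.\<close>
  have sumb: "(\<Sum>j=1..Suc s. b j) = real (Suc s) * cont_value N (Suc d) r"
  proof -
    have "(\<Sum>j=1..Suc s. b j) = (\<Sum>j=1..r. b j) + (\<Sum>j=Suc r..Suc s. b j)"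
      using sum.ub_add_nat[of 1 r b "Suc s - r"] Suc.prems(3) by simp
    also have "(\<Sum>j=Suc r..Suc s. b j) = (\<Sum>j=Suc r..Suc s. cont_value N d r)"
      by (intro sum.cong) (auto simp: b_def)
    also have "\<dots> = (real (Suc s) - real r) * cont_value N d r" using Suc.prems(3) by (simp add: of_nat_diff)
    also have "(\<Sum>j=1..r. b j) = (\<Sum>j=1..r. max (miss_prob N d j) (cont_value N d j))"
      by (intro sum.cong) (auto simp: b_def)
    finally have "(\<Sum>j=1..Suc s. b j) =
        (\<Sum>j=1..r. max (miss_prob N d j) (cont_value N d j)) + (real (Suc s) - real r) * cont_value N d r" .
    moreover have "A + (S - i) * v = S * ((1 - i / S) * v + A / S)" if "S \<noteq> 0" for S i v A :: real
      using that by (simp add: field_simps)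
    ultimately show ?thesis unfolding cont_value.simps N(3) by simp
  qed
  have tot: "real (card {l \<in> rank_lists s (Suc d). win_ranks m dec (c @ l)}) = (\<Sum>j=1..Suc s. a j)"
    unfolding card_rank_lists_filter a_def by simp
  have rhs: "real (card (rank_lists s (Suc d))) * cont_value (s + Suc d) (Suc d) r = (\<Sum>j=1..Suc s. M * b j)"
    unfolding sum_distrib_left[symmetric] sumb card_rank_lists_Suc N_def[symmetric] by (simp add: M_def algebra_simps del: cont_value.simps)
  show ?case unfolding tot rhs unfolding N_def[symmetric]
    using le eq by (auto intro!: sum_mono sum.cong simp del: sum.cl_ivl_Suc)
qed

lemma card_win_ranks_half:
  shows "real (card {c \<in> rank_lists 0 (2 * m). win_ranks m dec c}) \<le> fact (2 * m) * half_value m"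
    and "optimal_dec (2 * m) m dec \<Longrightarrow>
      real (card {c \<in> rank_lists 0 (2 * m). win_ranks m dec c}) = fact (2 * m) * half_value m"
proof -
  let ?a = "\<lambda>c. real (card {l \<in> rank_lists m m. win_ranks m dec (c @ l)})"
  have sp: "real (card {c \<in> rank_lists 0 (2 * m). win_ranks m dec c}) = (\<Sum>c\<in>rank_lists 0 m. ?a c)"
    using card_rank_lists_append[of 0 m m "win_ranks m dec"] by (simp add: mult_2)
  have "real (card (rank_lists 0 m)) * real (card (rank_lists m m)) = real (card (rank_lists m m) * fact m)"
    using card_rank_lists[of 0 m] by simp
  then have cards: "real (card (rank_lists 0 m)) * real (card (rank_lists m m)) = fact (2 * m)"
    unfolding card_rank_lists by (simp add: mult_2)
  have *: "?a c \<le> real (card (rank_lists m m)) * half_value m \<and>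
      (optimal_dec (2 * m) m dec \<longrightarrow> ?a c = real (card (rank_lists m m)) * half_value m)" if "c \<in> rank_lists 0 m" for c
    using card_win_ranks[of c m m "Suc m" dec m] that by (simp add: half_value_def mult_2 rank_lists_def)
  have r: "fact (2 * m) * half_value m = (\<Sum>c\<in>rank_lists 0 m. real (card (rank_lists m m)) * half_value m)"
    by (simp flip: cards)
  show "real (card {c \<in> rank_lists 0 (2 * m). win_ranks m dec c}) \<le> fact (2 * m) * half_value m"
    unfolding sp r by (intro sum_mono) (use * in auto)
  show "real (card {c \<in> rank_lists 0 (2 * m). win_ranks m dec c}) = fact (2 * m) * half_value m"
    if "optimal_dec (2 * m) m dec"
    unfolding sp r by (intro sum.cong) (use * that in auto)
qed

section \<open>From rank sequences to permutations, and the optimal rule\<close>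

lemma eq_if_card_below_eq:
  fixes a b :: "'a::linorder"
  assumes "finite S" "a \<in> S" "b \<in> S" "card {w \<in> S. w < a} = card {w \<in> S. w < b}"
  shows "a = b"
proof (rule ccontr)
  have less: "card {w \<in> S. w < a} < card {w \<in> S. w < b}" if "a < b" "a \<in> S" for a b
    using assms(1) that by (intro psubset_card_mono) auto
  assume "a \<noteq> b"
  then show False using less[of a b] less[of b a] assms by (cases a b rule: linorder_cases) auto
qed

text \<open>This is the independence and uniformity of relative ranks. The ranks determine the order
  pattern, and the pattern determines the permutation since the set of values is fixed; surjectivity
  follows because both sides have \<open>fact N\<close> elements.\<close>

lemma bij_betw_rank_lists:
  fixes v :: "nat \<Rightarrow> real"
  assumes v: "inj_on v {..<N}"
  shows "bij_betw (\<lambda>p. map (rel_rank (v \<circ> p)) [0..<N]) {p. p permutes {..<N}} (rank_lists 0 N)"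
proof -
  let ?P = "{p. p permutes {..<N}}" and ?f = "\<lambda>p. map (rel_rank (v \<circ> p)) [0..<N]"
  have vp: "inj_on (v \<circ> p) {..<N}" if "p \<in> ?P" for p
    using that v by (intro comp_inj_on) (auto simp: permutes_image intro: permutes_inj_on)
  have "inj_on ?f ?P"
  proof (rule inj_onI)
    fix p p' assume p: "p \<in> ?P" "p' \<in> ?P" and eq: "?f p = ?f p'"
    have ord: "(v \<circ> p) i < (v \<circ> p) j \<longleftrightarrow> (v \<circ> p') i < (v \<circ> p') j" if "i < N" "j < N" for i j
      using order_determined_by_rel_rank[OF vp[OF p(1)] vp[OF p(2)], of i j] eq that by auto
    have below: "card {w \<in> v ` {..<N}. w < (v \<circ> q) i} = card {j. j < N \<and> (v \<circ> q) j < (v \<circ> q) i}" if "q \<in> ?P" for q i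
    proof -
      have "v ` {..<N} = (v \<circ> q) ` {..<N}" using permutes_image[of q "{..<N}"] that by (metis image_comp mem_Collect_eq)
      then have "{w \<in> v ` {..<N}. w < (v \<circ> q) i} = (v \<circ> q) ` {j. j < N \<and> (v \<circ> q) j < (v \<circ> q) i}" by auto
      moreover have "inj_on (v \<circ> q) {j. j < N \<and> (v \<circ> q) j < (v \<circ> q) i}"
        by (rule inj_on_subset[OF vp[OF that]]) auto
      ultimately show ?thesis by (simp only: card_image)
    qed
    show "p = p'"
    proof
      fix i
      show "p i = p' i"
      proof (cases "i < N")
        case True
        have "card {w \<in> v ` {..<N}. w < (v \<circ> p) i} = card {w \<in> v ` {..<N}. w < (v \<circ> p') i}"
          unfolding below[OF p(1)] below[OF p(2)] using ord True by (intro arg_cong[where f = card]) auto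
        moreover have mem: "p i \<in> {..<N}" "p' i \<in> {..<N}" using p True permutes_in_image[of p "{..<N}" i] permutes_in_image[of p' "{..<N}" i] by auto
        ultimately have "v (p i) = v (p' i)" by (intro eq_if_card_below_eq[of "v ` {..<N}"]) auto
        then show ?thesis using v mem by (auto dest: inj_onD)
      next
        case False
        then show ?thesis using p by (auto simp: permutes_not_in)
      qed
    qed
  qed
  moreover have "?f ` ?P \<subseteq> rank_lists 0 N"
    using rel_rank_le by (auto simp: rank_lists_def rel_rank_def)
  moreover have "card (?f ` ?P) = card (rank_lists 0 N)"
    using card_image[OF \<open>inj_on ?f ?P\<close>] card_permutations[of "{..<N}" N] card_rank_lists[of 0 N] by simp
  ultimately show ?thesis
    using card_subset_eq[OF finite_rank_lists] by (auto simp: bij_betw_def)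
qed

lemma accepts_max_iff_win_ranks:
  assumes inj: "inj_on x {..<N}"
    and dec: "\<And>t. m \<le> t \<Longrightarrow> t < N \<Longrightarrow> B (map x [0..<Suc t]) \<longleftrightarrow> dec (map (rel_rank x) [0..<Suc t])"
  shows "accepts_max B m (map x [0..<N]) \<longleftrightarrow> win_ranks m dec (map (rel_rank x) [0..<N])"
proof -
  have take: "take (Suc t) (map f [0..<N]) = map f [0..<Suc t]" if "t < N" for t and f :: "nat \<Rightarrow> 'a"
    using that by (simp add: take_map take_upt)
  have max: "x t = Max (set (drop m (map x [0..<N]))) \<longleftrightarrow> (\<forall>s\<in>{m..<N}. s \<noteq> t \<longrightarrow> x s < x t)" if "m \<le> t" "t < N" for t
  proof -
    have S: "set (drop m (map x [0..<N])) = x ` {m..<N}" by (simp add: drop_map)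
    have "x t = Max (x ` {m..<N}) \<longleftrightarrow> (\<forall>s\<in>{m..<N}. x s \<le> x t)"
    proof
      assume "x t = Max (x ` {m..<N})" then show "\<forall>s\<in>{m..<N}. x s \<le> x t" by auto
    next
      assume "\<forall>s\<in>{m..<N}. x s \<le> x t" then show "x t = Max (x ` {m..<N})"
        using that by (intro Max_eqI[symmetric]) auto
    qed
    also have "\<dots> \<longleftrightarrow> (\<forall>s\<in>{m..<N}. s \<noteq> t \<longrightarrow> x s < x t)"
      using that inj_onD[OF inj] by (force simp: le_less)
    finally show ?thesis unfolding S .
  qed
  let ?xs = "map x [0..<N]" and ?c = "map (rel_rank x) [0..<N]"
  have Bd: "B (take (Suc t) ?xs) \<longleftrightarrow> dec (take (Suc t) ?c)" if "m \<le> t" "t < N" for t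
    using dec[OF that] take[OF that(2), of x] take[OF that(2), of "rel_rank x"] by simp
  have "accepts_at B m ?xs t \<and> ?xs ! t = Max (set (drop m ?xs)) \<longleftrightarrow>
      m \<le> t \<and> t < length ?c \<and> dec (take (Suc t) ?c) \<and> (\<forall>s. m \<le> s \<and> s < t \<longrightarrow> \<not> dec (take (Suc s) ?c)) \<and>
      (\<forall>s\<in>{m..<t}. ?c ! t \<le> ?c ! s) \<and> (\<forall>s\<in>{t<..<length ?c}. ?c ! t < ?c ! s)" for t
  proof (cases "m \<le> t \<and> t < N")
    case True
    have 1: "(\<forall>s. m \<le> s \<and> s < t \<longrightarrow> \<not> B (take (Suc s) ?xs)) \<longleftrightarrow> (\<forall>s. m \<le> s \<and> s < t \<longrightarrow> \<not> dec (take (Suc s) ?c))"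
      using Bd True by (meson less_trans)
    have 2: "?xs ! t = Max (set (drop m ?xs)) \<longleftrightarrow>
        (\<forall>s\<in>{m..<t}. ?c ! t \<le> ?c ! s) \<and> (\<forall>s\<in>{t<..<length ?c}. ?c ! t < ?c ! s)"
      using max[of t] max_iff_rel_rank[OF inj, of m t] True by simp
    show ?thesis unfolding accepts_at_def 1 2 using Bd[of t] True by simp
  next
    case False
    then show ?thesis by (auto simp: accepts_at_def)
  qed
  then show ?thesis unfolding accepts_max_def win_ranks_def by simp
qed

lemma permutes_comp_inj:
  assumes "p permutes S" "inj_on v S"
  shows "inj_on (\<lambda>t. v (p t)) S"
  using comp_inj_on[of p S v] permutes_inj_on[OF assms(1)] permutes_image[OF assms(1)] assms(2) by (simp add: o_def)

text \<open>A comparison-based rule sees nothing but relative ranks. \<open>dec\<close> evaluates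
  \<open>B\<close> on some realization of the rank list; the choice does not matter, as all
  realizations are ordered alike by \<open>order_determined_by_rel_rank\<close>.\<close>

lemma card_accepts_max_le:
  fixes B :: "real list \<Rightarrow> bool" and v :: "nat \<Rightarrow> real"
  assumes cmp: "\<And>xs ys. length xs = length ys \<Longrightarrow>
      (\<forall>i<length xs. \<forall>j<length xs. xs ! i < xs ! j \<longleftrightarrow> ys ! i < ys ! j) \<Longrightarrow> B xs = B ys"
    and v: "inj_on v {..<2 * m}"
  shows "real (card {p. p permutes {..<2 * m} \<and> accepts_max B m (map (\<lambda>t. v (p t)) [0..<2 * m])})
    \<le> fact (2 * m) * half_value m"
proof -
  define dec where "dec c \<longleftrightarrow> (\<exists>y. inj_on y {..<length c} \<and> map (rel_rank y) [0..<length c] = c \<and> B (map y [0..<length c]))" for c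
  have decI: "B (map x [0..<k]) \<longleftrightarrow> dec (map (rel_rank x) [0..<k])" if x: "inj_on x {..<k}" for x k
  proof -
    have "B (map x [0..<k]) = B (map y [0..<k])" if y: "inj_on y {..<k}" "map (rel_rank y) [0..<k] = map (rel_rank x) [0..<k]" for y
      using order_determined_by_rel_rank[OF x y(1)] y(2) by (intro cmp) auto
    then have "dec (map (rel_rank x) [0..<k]) \<Longrightarrow> B (map x [0..<k])"
      unfolding dec_def by (simp only: length_map length_upt minus_nat.diff_0) blast
    moreover have "B (map x [0..<k]) \<Longrightarrow> dec (map (rel_rank x) [0..<k])"
      unfolding dec_def using x by (intro exI[of _ x]) simp
    ultimately show ?thesis by blast
  qed
  let ?P = "{p. p permutes {..<2 * m}}" and ?f = "\<lambda>p. map (rel_rank (v \<circ> p)) [0..<2 * m]"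
  have "{p. p permutes {..<2 * m} \<and> accepts_max B m (map (\<lambda>t. v (p t)) [0..<2 * m])} = {p \<in> ?P. win_ranks m dec (?f p)}"
  proof -
    have "accepts_max B m (map (\<lambda>t. v (p t)) [0..<2 * m]) \<longleftrightarrow> win_ranks m dec (?f p)" if "p \<in> ?P" for p
    proof -
      have inj: "inj_on (\<lambda>t. v (p t)) {..<2 * m}" using that v by (auto intro: permutes_comp_inj)
      have "B (map (\<lambda>t. v (p t)) [0..<Suc t]) \<longleftrightarrow> dec (map (rel_rank (\<lambda>t. v (p t))) [0..<Suc t])" if "t < 2 * m" for t
        by (rule decI) (rule inj_on_subset[OF inj], use that in auto)
      then show ?thesis using accepts_max_iff_win_ranks[OF inj, of m B dec] by (simp add: o_def)
    qed
    then show ?thesis by auto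
  qed
  also have "card \<dots> = card {c \<in> rank_lists 0 (2 * m). win_ranks m dec c}"
    using bij_betw_rank_lists[OF v]
    by (intro bij_betw_same_card[where f = ?f]) (auto simp: bij_betw_def inj_on_def)
  finally show ?thesis using card_win_ranks_half(1) by simp
qed

text \<open>\<open>t\<close> counts the arrivals of the second half from 0, so
  \<open>m - Suc t\<close> values are still to come. Ties go to stopping, as in
  \<open>optimal_dec\<close>.\<close>

definition accept_rank :: "nat \<Rightarrow> nat \<Rightarrow> nat \<Rightarrow> bool" where
  "accept_rank m t r \<longleftrightarrow> cont_value (2 * m) (m - Suc t) r \<le> miss_prob (2 * m) (m - Suc t) r"

text \<open>The last entry is the candidate. A record of the second half is exceeded only by values
  of the first half, so counting those yields its relative rank. In this form the rule carries over
  to samples and arrivals.\<close>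

definition half_rule :: "nat \<Rightarrow> real list \<Rightarrow> bool" where
  "half_rule m xs \<longleftrightarrow> (\<forall>i\<in>{m..<length xs - 1}. xs ! i < xs ! (length xs - 1)) \<and>
     accept_rank m (length xs - 1 - m) (Suc (card {i. i < m \<and> i < length xs \<and> xs ! (length xs - 1) < xs ! i}))"

lemma card_half_rule:
  fixes v :: "nat \<Rightarrow> real"
  assumes v: "inj_on v {..<2 * m}"
  shows "real (card {p. p permutes {..<2 * m} \<and> accepts_max (half_rule m) m (map (\<lambda>t. v (p t)) [0..<2 * m])})
    = fact (2 * m) * half_value m"
proof -
  define dec where "dec c \<longleftrightarrow> (\<forall>i\<in>{m..<length c - 1}. c ! (length c - 1) \<le> c ! i) \<and>
     accept_rank m (length c - 1 - m) (c ! (length c - 1))" for c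
  have opt: "optimal_dec (2 * m) m dec"
    by (auto simp: optimal_dec_def dec_def accept_rank_def nth_append mult_2 Suc_diff_le)
  let ?P = "{p. p permutes {..<2 * m}}" and ?f = "\<lambda>p. map (rel_rank (v \<circ> p)) [0..<2 * m]"
  have "{p. p permutes {..<2 * m} \<and> accepts_max (half_rule m) m (map (\<lambda>t. v (p t)) [0..<2 * m])} = {p \<in> ?P. win_ranks m dec (?f p)}"
  proof -
    have "accepts_max (half_rule m) m (map (\<lambda>t. v (p t)) [0..<2 * m]) \<longleftrightarrow> win_ranks m dec (?f p)" if "p \<in> ?P" for p
    proof -
      let ?x = "\<lambda>t. v (p t)"
      have inj: "inj_on ?x {..<2 * m}" using that v by (auto intro: permutes_comp_inj)
      have "half_rule m (map ?x [0..<Suc t]) \<longleftrightarrow> dec (map (rel_rank ?x) [0..<Suc t])" if t: "m \<le> t" "t < 2 * m" for t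
      proof -
        have nth: "map f [0..<Suc t] ! i = f i" if "i \<le> t" for i and f :: "nat \<Rightarrow> 'b"
          using that by (simp del: upt_Suc)
        have "Suc (card {i. i < m \<and> i < Suc t \<and> ?x t < map ?x [0..<Suc t] ! i}) = rel_rank ?x t"
          if rec: "\<forall>s\<in>{m..<t}. ?x s < ?x t"
        proof -
          have "{i. i < m \<and> i < Suc t \<and> ?x t < map ?x [0..<Suc t] ! i} = {u. u < t \<and> ?x t < ?x u}"
            using rec t nth by (auto simp del: upt_Suc) (metis atLeastLessThan_iff not_less order_less_asym)
          then show ?thesis by (simp add: rel_rank_def)
        qed
        then show ?thesis
          using record_iff_rel_rank[OF inj t] nth t unfolding half_rule_def dec_def
          by (auto simp del: upt_Suc)
      qed
      then show ?thesis using accepts_max_iff_win_ranks[OF inj, of m "half_rule m" dec] by (simp add: o_def)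
    qed
    then show ?thesis by auto
  qed
  also have "card \<dots> = card {c \<in> rank_lists 0 (2 * m). win_ranks m dec c}"
    using bij_betw_rank_lists[OF v]
    by (intro bij_betw_same_card[where f = ?f]) (auto simp: bij_betw_def inj_on_def)
  finally show ?thesis using card_win_ranks_half(2)[OF opt] by simp
qed

section \<open>The optimal success probability and its limit\<close>

lemma prob_space_seed: "prob_space seed"
  unfolding seed_def by (intro prob_space_PiM prob_space_uniform_measure) auto

lemma measure_pair_uniform_count:
  assumes M: "prob_space M" and S: "finite S" "S \<noteq> {}"
    and E[measurable]: "\<And>p. p \<in> S \<Longrightarrow> Measurable.pred M (\<lambda>w. E w p)"
  shows "{x \<in> space (M \<Otimes>\<^sub>M uniform_count_measure S). case x of (w, p) \<Rightarrow> E w p} \<in> sets (M \<Otimes>\<^sub>M uniform_count_measure S)"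
    and "\<P>(x in M \<Otimes>\<^sub>M uniform_count_measure S. case x of (w, p) \<Rightarrow> E w p) =
      (\<Sum>p\<in>S. \<P>(w in M. E w p)) / real (card S)"
proof -
  let ?U = "uniform_count_measure S"
  interpret M: prob_space M by fact
  interpret U: prob_space ?U using S by (rule prob_space_uniform_count_measure)
  interpret P: pair_prob_space M ?U ..
  let ?A = "\<lambda>p. {w \<in> space M. E w p} \<times> {p}"
  have eq: "{x \<in> space (M \<Otimes>\<^sub>M ?U). case x of (w, p) \<Rightarrow> E w p} = (\<Union>p\<in>S. ?A p)"
    by (auto simp: space_pair_measure space_uniform_count_measure)
  have A: "?A p \<in> sets (M \<Otimes>\<^sub>M ?U)" if "p \<in> S" for p
    using that E[OF that] by (intro pair_measureI) (auto simp: sets_uniform_count_measure pred_def)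
  show "{x \<in> space (M \<Otimes>\<^sub>M ?U). case x of (w, p) \<Rightarrow> E w p} \<in> sets (M \<Otimes>\<^sub>M ?U)"
    unfolding eq using A S by auto
  have "measure (M \<Otimes>\<^sub>M ?U) (\<Union>p\<in>S. ?A p) = (\<Sum>p\<in>S. measure (M \<Otimes>\<^sub>M ?U) (?A p))"
    using A S by (intro P.finite_measure_finite_Union) (auto simp: disjoint_family_on_def)
  also have "\<dots> = (\<Sum>p\<in>S. \<P>(w in M. E w p) / real (card S))"
  proof (intro sum.cong refl)
    fix p assume p: "p \<in> S"
    have "measure (M \<Otimes>\<^sub>M ?U) (?A p) = measure M {w \<in> space M. E w p} * measure ?U {p}"
      using p E[OF p] U.emeasure_pair_measure_Times[of "{w \<in> space M. E w p}" M "{p}"]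
      by (simp add: measure_def enn2real_mult sets_uniform_count_measure pred_def)
    then show "measure (M \<Otimes>\<^sub>M ?U) (?A p) = \<P>(w in M. E w p) / real (card S)"
      using p S by (simp add: measure_uniform_count_measure)
  qed
  finally show "\<P>(x in M \<Otimes>\<^sub>M ?U. case x of (w, p) \<Rightarrow> E w p) = (\<Sum>p\<in>S. \<P>(w in M. E w p)) / real (card S)"
    unfolding eq by (simp add: sum_divide_distrib)
qed

lemma pred_accepts_max:
  assumes [measurable]: "\<And>k. Measurable.pred M (\<lambda>w. A w (take k xs))"
  shows "Measurable.pred M (\<lambda>w. accepts_max (A w) m xs)"
  unfolding accepts_max_def accepts_at_def by measurable

text \<open>Internal randomness does not help: for each fixed seed the rule is deterministic and the
  counting bound applies, and this survives integration over the seed after exchanging sum and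
  integral.\<close>

lemma half_secretary_success_le:
  assumes A: "comparison_based A" and v: "inj_on v {..<2 * m}"
  shows "half_secretary_success A m v \<le> half_value m"
proof -
  let ?P = "{p. p permutes {..<2 * m}}"
  let ?E = "\<lambda>w p. accepts_max (A w) m (map (\<lambda>t. v (p t)) [0..<2 * m])"
  interpret seed: prob_space seed by (rule prob_space_seed)
  have cP: "card ?P = fact (2 * m)" "finite ?P"
    using card_permutations[of "{..<2 * m}"] finite_permutations by auto
  have ne: "?P \<noteq> {}" using permutes_id by blast
  have [measurable]: "Measurable.pred seed (\<lambda>w. ?E w p)" for p
    using A by (intro pred_accepts_max) (auto simp: comparison_based_def)
  have int: "integrable seed (indicat_real {w \<in> space seed. ?E w p})" for p
    by (rule seed.integrable_const_bound[where B = 1]) auto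
  have "half_secretary_success A m v = (\<Sum>p\<in>?P. \<P>(w in seed. ?E w p)) / fact (2 * m)"
    unfolding measure_pair_uniform_count(2)[OF prob_space_seed cP(2) ne, of ?E, unfolded cP(1), simplified, symmetric]
      half_secretary_success_def arrival_order_def by (intro arg_cong[where f = "measure _"]) auto
  also have "(\<Sum>p\<in>?P. \<P>(w in seed. ?E w p)) = (\<Sum>p\<in>?P. integral\<^sup>L seed (indicator {w \<in> space seed. ?E w p}))"
    by simp
  also have "\<dots> = integral\<^sup>L seed (\<lambda>w. \<Sum>p\<in>?P. indicator {w \<in> space seed. ?E w p} w)"
    by (rule Bochner_Integration.integral_sum[symmetric]) (rule int)
  also have "\<dots> \<le> fact (2 * m) * half_value m"
  proof (rule seed.integral_le_const)
    show "AE w in seed. (\<Sum>p\<in>?P. indicator {w \<in> space seed. ?E w p} w) \<le> fact (2 * m) * half_value m"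
    proof (rule AE_I2)
      fix w assume w: "w \<in> space seed"
      have "(\<Sum>p\<in>?P. indicator {w \<in> space seed. ?E w p} w) = (\<Sum>p\<in>?P. if ?E w p then 1 else 0 :: real)"
        using w by (intro sum.cong) auto
      also have "\<dots> = real (card {p. p permutes {..<2 * m} \<and> ?E w p})"
        using cP(2) by (simp add: sum.If_cases Int_def)
      also have "\<dots> \<le> fact (2 * m) * half_value m"
        using A v by (intro card_accepts_max_le) (auto simp: comparison_based_def)
      finally show "(\<Sum>p\<in>?P. indicator {w \<in> space seed. ?E w p} w) \<le> fact (2 * m) * half_value m" .
    qed
  qed (intro Bochner_Integration.integrable_sum int)
  finally show ?thesis by (simp add: field_simps)
qed

lemma comparison_based_half_rule: "comparison_based (\<lambda>_. half_rule m)"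
proof -
  have *: "half_rule m xs = half_rule m ys"
    if "length xs = length ys" "\<forall>i<length xs. \<forall>j<length xs. xs ! i < xs ! j \<longleftrightarrow> ys ! i < ys ! j" for xs ys
  proof -
    have "{i. i < m \<and> i < length xs \<and> xs ! (length xs - 1) < xs ! i} = {i. i < m \<and> i < length ys \<and> ys ! (length ys - 1) < ys ! i}"
      using that by force
    moreover have "(\<forall>i\<in>{m..<length xs - 1}. xs ! i < xs ! (length xs - 1)) \<longleftrightarrow> (\<forall>i\<in>{m..<length ys - 1}. ys ! i < ys ! (length ys - 1))"
      using that by force
    ultimately show ?thesis unfolding half_rule_def using that(1) by simp
  qed
  show ?thesis unfolding comparison_based_def
    by (intro conjI allI impI, simp) (rule *, blast+)
qed

lemma half_secretary_success_half_rule: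
  assumes v: "inj_on v {..<2 * m}"
  shows "half_secretary_success (\<lambda>_. half_rule m) m v = half_value m"
proof -
  let ?P = "{p. p permutes {..<2 * m}}"
  let ?E = "\<lambda>p. accepts_max (half_rule m) m (map (\<lambda>t. v (p t)) [0..<2 * m])"
  interpret seed: prob_space seed by (rule prob_space_seed)
  have cP: "card ?P = fact (2 * m)" "finite ?P"
    using card_permutations[of "{..<2 * m}"] finite_permutations by auto
  have ne: "?P \<noteq> {}" using permutes_id by blast
  have "half_secretary_success (\<lambda>_. half_rule m) m v = (\<Sum>p\<in>?P. \<P>(w in seed. ?E p)) / fact (2 * m)"
    unfolding measure_pair_uniform_count(2)[OF prob_space_seed cP(2) ne, of "\<lambda>_. ?E", unfolded cP(1), simplified, symmetric]
      half_secretary_success_def arrival_order_def by (intro arg_cong[where f = "measure _"]) auto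
  also have "(\<Sum>p\<in>?P. \<P>(w in seed. ?E p)) = (\<Sum>p\<in>?P. if ?E p then 1 else 0)"
    by (intro sum.cong) (auto simp: seed.prob_space)
  also have "\<dots> = real (card {p. p permutes {..<2 * m} \<and> ?E p})"
    using cP(2) by (simp add: sum.If_cases Int_def)
  finally show ?thesis using card_half_rule[OF v] by simp
qed

text \<open>For the upper bound a single injection, here \<open>real\<close>, suffices in the
  infimum. For the lower bound \<open>half_rule\<close> succeeds with the same probability on all
  injections, so its infimum is this probability.\<close>

lemma half_secretary_opt_eq: "half_secretary_opt m = half_value m"
proof -
  let ?V = "{v :: nat \<Rightarrow> real. inj_on v {..<2 * m}}" and ?A = "{A. comparison_based A}"
  have ne: "real \<in> ?V" by (auto simp: inj_on_def)
  have bdd: "bdd_below (half_secretary_success A m ` ?V)" for A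
    by (intro bdd_belowI2[where m = 0]) (simp add: half_secretary_success_def)
  have up: "(INF v\<in>?V. half_secretary_success A m v) \<le> half_value m" if "A \<in> ?A" for A
    using order_trans[OF cINF_lower[OF bdd ne] half_secretary_success_le[of A real m]] that ne by simp
  have B: "(\<lambda>_. half_rule m) \<in> ?A" using comparison_based_half_rule by simp
  have "half_value m \<le> (INF v\<in>?V. half_secretary_success (\<lambda>_. half_rule m) m v)"
    by (intro cINF_greatest) (use ne in blast, simp add: half_secretary_success_half_rule)
  also have "\<dots> \<le> half_secretary_opt m"
    unfolding half_secretary_opt_def using up B
    by (intro cSUP_upper bdd_aboveI2[where M = "half_value m"]) auto
  finally show ?thesis
    using up B unfolding half_secretary_opt_def by (intro antisym cSUP_least) auto
qed

lemma gamma_opt_le: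
  assumes "0 < K" "K ^ 3 \<le> m"
  shows "gamma_opt - 5 / real K \<le> half_value m" "gamma_opt \<le> 1"
proof -
  have "half_secretary_opt = half_value" by (rule ext) (rule half_secretary_opt_eq)
  then have L: "half_value \<longlonglongrightarrow> gamma_opt"
    using convergent_half_value unfolding gamma_opt_def by (simp add: convergent_LIMSEQ_iff)
  show "gamma_opt - 5 / real K \<le> half_value m" using L assms by (rule half_value_ge_limit)
  show "gamma_opt \<le> 1" using L half_value_bounds by (auto intro: LIMSEQ_le_const2)
qed

section \<open>Comparing the positions of the largest values\<close>

text \<open>If one permutation \<open>q\<close> has the prescribed values, all others arise by
  composing \<open>q\<close> with a permutation of \<open>S - I\<close>.\<close>

lemma card_permutes_extending_le:
  assumes "finite S" "I \<subseteq> S"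
  shows "card {p. p permutes S \<and> (\<forall>i\<in>I. p i = g i)} \<le> fact (card S - card I)"
proof (cases "{p. p permutes S \<and> (\<forall>i\<in>I. p i = g i)} = {}")
  case False
  then obtain q where q: "q permutes S" "\<forall>i\<in>I. q i = g i" by auto
  have "{p. p permutes S \<and> (\<forall>i\<in>I. p i = g i)} \<subseteq> (\<lambda>u. q \<circ> u) ` {u. u permutes (S - I)}"
  proof
    fix p assume "p \<in> {p. p permutes S \<and> (\<forall>i\<in>I. p i = g i)}"
    then have p: "p permutes S" "\<forall>i\<in>I. p i = g i" by auto
    have "inv q \<circ> p permutes S" using p q by (intro permutes_compose permutes_inv)
    moreover have "(inv q \<circ> p) x = x" if "x \<in> S - (S - I)" for x
      using that p(2) q permutes_inverses(2)[OF q(1), of x] by auto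
    ultimately have "inv q \<circ> p permutes (S - I)" by (rule permutes_superset)
    moreover have "p = q \<circ> (inv q \<circ> p)" using q(1) by (simp add: fun_eq_iff permutes_inverses)
    ultimately show "p \<in> (\<lambda>u. q \<circ> u) ` {u. u permutes (S - I)}" by blast
  qed
  then have "card {p. p permutes S \<and> (\<forall>i\<in>I. p i = g i)} \<le> card ((\<lambda>u. q \<circ> u) ` {u. u permutes (S - I)})"
    using assms by (intro card_mono finite_imageI finite_permutations) auto
  also have "\<dots> \<le> card {u. u permutes (S - I)}"
    using assms by (intro card_image_le finite_permutations) auto
  also have "\<dots> = fact (card S - card I)"
    using assms by (intro card_permutations) (auto simp: card_Diff_subset finite_subset)
  finally show ?thesis .
next
  case True
  show ?thesis unfolding True by simp
qed

lemma card_permutes_extending: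
  assumes "finite S" "I \<subseteq> S" "inj_on g I" "g ` I \<subseteq> S"
  shows "card {p. p permutes S \<and> (\<forall>i\<in>I. p i = g i)} = fact (card S - card I)"
proof -
  have fin: "finite I" using assms finite_subset by auto
  have "card (S - I) = card (S - g ` I)"
    using assms fin by (simp add: card_Diff_subset card_image)
  then obtain h where h: "bij_betw h (S - I) (S - g ` I)"
    using assms(1) finite_same_card_bij[of "S - I" "S - g ` I"] by auto
  define q where "q i = (if i \<in> I then g i else if i \<in> S then h i else i)" for i
  have "bij_betw q I (g ` I)" using assms(3) by (auto simp: bij_betw_def q_def inj_on_def)
  moreover have "bij_betw q (S - I) (S - g ` I)"
    using h by (subst bij_betw_cong[of _ _ h]) (auto simp: q_def)
  ultimately have "bij_betw q (I \<union> (S - I)) (g ` I \<union> (S - g ` I))"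
    by (intro bij_betw_combine) auto
  moreover have "I \<union> (S - I) = S" "g ` I \<union> (S - g ` I) = S" using assms by auto
  ultimately have "bij_betw q S S" by simp
  then have q: "q permutes S" by (rule bij_imp_permutes) (use assms in \<open>auto simp: q_def\<close>)
  have qg: "\<forall>i\<in>I. q i = g i" by (simp add: q_def)
  have "(\<lambda>u. q \<circ> u) ` {u. u permutes (S - I)} \<subseteq> {p. p permutes S \<and> (\<forall>i\<in>I. p i = g i)}"
  proof clarify
    fix u assume u: "u permutes (S - I)"
    then have "u permutes S" by (rule permutes_subset) auto
    then have "q \<circ> u permutes S" using q by (intro permutes_compose)
    moreover have "(q \<circ> u) i = g i" if "i \<in> I" for i
      using permutes_not_in[OF u, of i] qg that by auto
    ultimately show "q \<circ> u permutes S \<and> (\<forall>i\<in>I. (q \<circ> u) i = g i)" by blast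
  qed
  then have "card ((\<lambda>u. q \<circ> u) ` {u. u permutes (S - I)}) \<le> card {p. p permutes S \<and> (\<forall>i\<in>I. p i = g i)}"
    using assms(1) by (intro card_mono finite_subset[OF _ finite_permutations]) auto
  moreover have "inj_on (\<lambda>u. q \<circ> u) {u. u permutes (S - I)}"
    using permutes_inj[OF q] by (auto intro!: inj_onI simp: fun_eq_iff inj_def)
  ultimately have "card {u. u permutes (S - I)} \<le> card {p. p permutes S \<and> (\<forall>i\<in>I. p i = g i)}"
    by (simp add: card_image)
  moreover have "card {u. u permutes (S - I)} = fact (card S - card I)"
    using assms fin by (intro card_permutations) (auto simp: card_Diff_subset)
  ultimately show ?thesis using card_permutes_extending_le[of S I g] assms by linarith
qed

text \<open>A uniformly random permutation and its inverse have the same law. This is used to pass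
  from the rank at each position to the position of each rank.\<close>

lemma card_permutes_inv:
  assumes "finite S"
  shows "card {p. p permutes S \<and> P (inv p)} = card {p. p permutes S \<and> P p}"
proof (rule bij_betw_same_card[where f = inv])
  show "bij_betw inv {p. p permutes S \<and> P (inv p)} {p. p permutes S \<and> P p}"
    by (rule bij_betw_byWitness[where f' = inv]) (auto simp: permutes_inv permutes_inv_inv)
qed

text \<open>The number of hits is hypergeometric with mean \<open>mu\<close>. Hits at different
  positions are negatively correlated, so the variance is at most the mean.\<close>

lemma permutes_hit_count_second_moment:
  fixes N K :: nat and A :: "nat set"
  assumes A: "A \<subseteq> {..<N}" and K: "K \<le> N" and N: "2 \<le> N"
  defines "mu \<equiv> real (card A) * real K / real N"
  shows "(\<Sum>p | p permutes {..<N}. (real (card {j. j < K \<and> p j \<in> A}) - mu)\<^sup>2) \<le> fact N * mu"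
proof -
  let ?P = "{p. p permutes {..<N}}"
  let ?I = "\<lambda>p j. if p j \<in> A then 1 else 0 :: real"
  define a where "a = real (card A)"
  have fin: "finite A" "finite ?P" using A finite_subset finite_permutations by auto
  have aN: "a \<le> real N" "0 \<le> a" using card_mono[OF _ A] by (auto simp: a_def)
  have Z: "real (card {j. j < K \<and> p j \<in> A}) = (\<Sum>j<K. ?I p j)" for p
  proof -
    have "{j. j < K \<and> p j \<in> A} = {j \<in> {..<K}. p j \<in> A}" by auto
    then show ?thesis by (simp add: sum.If_cases Int_def)
  qed
  have c1: "real (card {p. p permutes {..<N} \<and> p j = b}) = fact (N - 1)" if "j < N" "b \<in> A" for j b
    using card_permutes_extending[of "{..<N}" "{j}" "\<lambda>_. b"] that A by auto
  have c2: "real (card {p. p permutes {..<N} \<and> p j = b \<and> p k = c}) = fact (N - 2)"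
    if "j < N" "k < N" "j \<noteq> k" "b \<in> A" "c \<in> A" "b \<noteq> c" for j k b c
    using card_permutes_extending[of "{..<N}" "{j, k}" "\<lambda>i. if i = j then b else c"] that subsetD[OF A that(4)] subsetD[OF A that(5)]
    by (auto simp: numeral_2_eq_2 inj_on_def conj_commute)
  have e1: "(\<Sum>p\<in>?P. ?I p j) = a * fact (N - 1)" if "j < N" for j
  proof -
    have "(\<Sum>p\<in>?P. ?I p j) = (\<Sum>p\<in>?P. \<Sum>b\<in>A. if p j = b then 1 else 0)"
      using fin by (intro sum.cong) auto
    also have "\<dots> = (\<Sum>b\<in>A. \<Sum>p\<in>?P. if p j = b then 1 else 0)" by (rule sum.swap)
    also have "\<dots> = (\<Sum>b\<in>A. real (card {p. p permutes {..<N} \<and> p j = b}))"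
      using fin by (intro sum.cong) (auto simp: sum.If_cases Int_def)
    also have "\<dots> = a * fact (N - 1)" using c1[OF that] by (simp add: a_def)
    finally show ?thesis .
  qed
  have e2: "(\<Sum>p\<in>?P. ?I p j * ?I p k) = a * (a - 1) * fact (N - 2)" if jk: "j < N" "k < N" "j \<noteq> k" for j k
  proof -
    have "(\<Sum>p\<in>?P. ?I p j * ?I p k) = (\<Sum>p\<in>?P. \<Sum>b\<in>A. \<Sum>c\<in>A - {b}. if p j = b \<and> p k = c then 1 else 0)"
    proof (intro sum.cong refl)
      fix p assume "p \<in> ?P"
      then have ne: "p j \<noteq> p k" using jk permutes_inj[of p] by (auto dest: injD)
      have inner: "(\<Sum>c\<in>A - {b}. if p j = b \<and> p k = c then 1 else 0 :: real) = (if p j = b then ?I p k else 0)" for b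
        using fin ne by (cases "p j = b") auto
      show "?I p j * ?I p k = (\<Sum>b\<in>A. \<Sum>c\<in>A - {b}. if p j = b \<and> p k = c then 1 else 0)"
        unfolding inner using fin by simp
    qed
    also have "\<dots> = (\<Sum>b\<in>A. \<Sum>p\<in>?P. \<Sum>c\<in>A - {b}. if p j = b \<and> p k = c then 1 else 0)" by (rule sum.swap)
    also have "\<dots> = (\<Sum>b\<in>A. \<Sum>c\<in>A - {b}. \<Sum>p\<in>?P. if p j = b \<and> p k = c then 1 else 0)"
      by (intro sum.cong refl sum.swap)
    also have "\<dots> = (\<Sum>b\<in>A. \<Sum>c\<in>A - {b}. real (card {p. p permutes {..<N} \<and> p j = b \<and> p k = c}))"
      using fin by (intro sum.cong) (auto simp: sum.If_cases Int_def)
    also have "\<dots> = (\<Sum>b\<in>A. \<Sum>c\<in>A - {b}. fact (N - 2))"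
      using c2[OF jk] by (intro sum.cong) auto
    also have "\<dots> = (\<Sum>b\<in>A. (a - 1) * fact (N - 2))"
    proof (intro sum.cong refl)
      fix b assume b: "b \<in> A"
      then have "1 \<le> card A" using fin by (metis One_nat_def Suc_leI card_gt_0_iff empty_iff)
      then show "(\<Sum>c\<in>A - {b}. fact (N - 2)) = (a - 1) * fact (N - 2)"
        using b fin by (simp add: a_def of_nat_diff)
    qed
    also have "\<dots> = a * (a - 1) * fact (N - 2)" by (simp add: a_def)
    finally show ?thesis .
  qed
  have f1: "(fact N :: real) = real N * fact (N - 1)" using N by (simp add: fact_reduce)
  have f2: "(fact (N - 1) :: real) = (real N - 1) * fact (N - 2)"
    using N by (subst fact_reduce) (auto simp: numeral_2_eq_2 of_nat_diff)
  define k where "k = real K"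
  have mu: "mu = a * k / real N" by (simp add: mu_def a_def k_def)
  have S1: "(\<Sum>p\<in>?P. \<Sum>j<K. ?I p j) = fact N * mu"
  proof -
    have "(\<Sum>p\<in>?P. \<Sum>j<K. ?I p j) = (\<Sum>j<K. \<Sum>p\<in>?P. ?I p j)" by (rule sum.swap)
    also have "\<dots> = (\<Sum>j<K. a * fact (N - 1))" using K by (intro sum.cong refl e1) auto
    finally show ?thesis using N by (simp add: mu f1 k_def)
  qed
  have S2: "(\<Sum>p\<in>?P. (\<Sum>j<K. ?I p j)\<^sup>2) \<le> fact N * (mu + mu\<^sup>2)"
  proof -
    have "(\<Sum>p\<in>?P. (\<Sum>j<K. ?I p j)\<^sup>2) = (\<Sum>p\<in>?P. \<Sum>j<K. \<Sum>l<K. ?I p j * ?I p l)"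
      by (simp add: power2_eq_square sum_product)
    also have "\<dots> = (\<Sum>j<K. \<Sum>p\<in>?P. \<Sum>l<K. ?I p j * ?I p l)" by (rule sum.swap)
    also have "\<dots> = (\<Sum>j<K. \<Sum>l<K. \<Sum>p\<in>?P. ?I p j * ?I p l)" by (intro sum.cong refl sum.swap)
    also have "\<dots> = (\<Sum>j<K. \<Sum>l<K. if l = j then a * fact (N - 1) else a * (a - 1) * fact (N - 2))"
    proof (intro sum.cong refl)
      fix j l assume "j \<in> {..<K}" "l \<in> {..<K}"
      then have "j < N" "l < N" using K by auto
      then show "(\<Sum>p\<in>?P. ?I p j * ?I p l) = (if l = j then a * fact (N - 1) else a * (a - 1) * fact (N - 2))"
        using e1[of j] e2[of j l] by (cases "l = j") (auto simp: if_distrib[of "\<lambda>x. x * _"] cong: if_cong)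
    qed
    also have "\<dots> = (\<Sum>j<K. a * fact (N - 1) + (k - 1) * (a * (a - 1) * fact (N - 2)))"
    proof (intro sum.cong refl)
      fix j assume j: "j \<in> {..<K}"
      then have "(\<Sum>l<K. if l = j then a * fact (N - 1) else a * (a - 1) * fact (N - 2)) =
         a * fact (N - 1) + (\<Sum>l\<in>{..<K} - {j}. a * (a - 1) * fact (N - 2))"
        by (subst sum.remove[of _ j]) auto
      then show "(\<Sum>l<K. if l = j then a * fact (N - 1) else a * (a - 1) * fact (N - 2)) =
         a * fact (N - 1) + (k - 1) * (a * (a - 1) * fact (N - 2))"
        using j by (simp add: k_def of_nat_diff)
    qed
    also have "\<dots> = k * (a * fact (N - 1)) + (k * (k - 1)) * (a * (a - 1)) * fact (N - 2)"
      by (simp add: k_def algebra_simps)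
    also have "k * (a * fact (N - 1)) = fact N * mu" using N by (simp add: mu f1)
    \<comment> \<open>Negative correlation: \<open>k * (k - 1) / (N * (N - 1))\<close> is at most
      the square of \<open>k / N\<close>, as \<open>k\<close> is at most \<open>N\<close>.\<close>
    also have "(k * (k - 1)) * (a * (a - 1)) * fact (N - 2) \<le> fact N * mu\<^sup>2"
    proof -
      have kN: "0 \<le> k" "k \<le> real N" using K by (auto simp: k_def)
      have k1: "real N * (k * (k - 1)) \<le> (real N - 1) * k\<^sup>2"
        using mult_right_mono[OF kN(2) kN(1)] by (simp add: power2_eq_square algebra_simps)
      have a1: "a * (a - 1) \<le> a\<^sup>2" using aN by (simp add: power2_eq_square algebra_simps)
      have a0: "0 \<le> a * (a - 1)"
        by (cases "card A = 0") (auto simp: a_def intro!: mult_nonneg_nonneg)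
      have "real N * ((k * (k - 1)) * (a * (a - 1))) = (real N * (k * (k - 1))) * (a * (a - 1))" by simp
      also have "\<dots> \<le> ((real N - 1) * k\<^sup>2) * (a * (a - 1))" by (rule mult_right_mono[OF k1 a0])
      also have "\<dots> \<le> ((real N - 1) * k\<^sup>2) * a\<^sup>2" using N by (intro mult_left_mono[OF a1]) auto
      finally have "real N * ((k * (k - 1)) * (a * (a - 1))) * fact (N - 2) \<le> ((real N - 1) * k\<^sup>2) * a\<^sup>2 * fact (N - 2)"
        by (intro mult_right_mono) auto
      also have "\<dots> = real N * (fact N * mu\<^sup>2)"
        unfolding mu f1 f2 using N by (simp add: power2_eq_square)
      finally show ?thesis using N by (simp add: mult.assoc)
    qed
    finally show ?thesis by (simp add: distrib_left)
  qed
  have "(\<Sum>p\<in>?P. (real (card {j. j < K \<and> p j \<in> A}) - mu)\<^sup>2) =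
      (\<Sum>p\<in>?P. (\<Sum>j<K. ?I p j)\<^sup>2 - 2 * mu * (\<Sum>j<K. ?I p j) + mu\<^sup>2)"
    unfolding Z by (intro sum.cong refl) (simp add: power2_eq_square algebra_simps)
  also have "\<dots> = (\<Sum>p\<in>?P. (\<Sum>j<K. ?I p j)\<^sup>2) - 2 * mu * (fact N * mu) + fact N * mu\<^sup>2"
    unfolding sum.distrib sum_subtractf sum_distrib_left[symmetric] S1
    using card_permutations[of "{..<N}" N] by simp
  also have "\<dots> \<le> fact N * (mu + mu\<^sup>2) - 2 * mu * (fact N * mu) + fact N * mu\<^sup>2" using S2 by simp
  also have "\<dots> = fact N * mu" by (simp add: power2_eq_square algebra_simps)
  finally show ?thesis .
qed

text \<open>Chebyshev's inequality. The mean \<open>nu\<close> is at least 8, so fewer than four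
  hits deviate from it by at least \<open>nu / 2\<close>, and variance at most \<open>nu\<close>
  gives \<open>4 / nu\<close>. The number four is the one required by
  \<open>not_accept_rank_early\<close>.\<close>

lemma card_permutes_few_hits:
  fixes N K :: nat and A :: "nat set"
  assumes A: "A \<subseteq> {..<N}" and K: "K \<le> N" and N: "2 \<le> N"
    and mu: "mu \<le> real (card A) * real K / real N" "8 \<le> mu"
  shows "real (card {p. p permutes {..<N} \<and> card {j. j < K \<and> p j \<in> A} < 4}) \<le> 4 / mu * fact N"
proof -
  define nu where "nu = real (card A) * real K / real N"
  have nu: "8 \<le> nu" "mu \<le> nu" using mu by (auto simp: nu_def)
  let ?B = "{p. p permutes {..<N} \<and> card {j. j < K \<and> p j \<in> A} < 4}"
  have "real (card ?B) * (nu / 2)\<^sup>2 = (\<Sum>p\<in>?B. (nu / 2)\<^sup>2)" by simp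
  also have "\<dots> \<le> (\<Sum>p\<in>?B. (real (card {j. j < K \<and> p j \<in> A}) - nu)\<^sup>2)"
  proof (intro sum_mono)
    fix p assume "p \<in> ?B"
    then have "nu / 2 \<le> nu - real (card {j. j < K \<and> p j \<in> A})" using nu by auto
    then have "(nu / 2)\<^sup>2 \<le> (nu - real (card {j. j < K \<and> p j \<in> A}))\<^sup>2" using nu by (intro power_mono) auto
    then show "(nu / 2)\<^sup>2 \<le> (real (card {j. j < K \<and> p j \<in> A}) - nu)\<^sup>2" by (simp add: power2_commute)
  qed
  also have "\<dots> \<le> (\<Sum>p | p permutes {..<N}. (real (card {j. j < K \<and> p j \<in> A}) - nu)\<^sup>2)"
    by (intro sum_mono2 finite_permutations) auto
  also have "\<dots> \<le> fact N * nu"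
    unfolding nu_def by (rule permutes_hit_count_second_moment[OF A K N])
  finally have "real (card ?B) * nu \<le> 4 * fact N" using nu by (simp add: power2_eq_square)
  then have "real (card ?B) \<le> 4 / nu * fact N" using nu by (simp add: field_simps)
  also have "\<dots> \<le> 4 / mu * fact N" using nu mu by (intro mult_right_mono divide_left_mono) auto
  finally show ?thesis .
qed

text \<open>
  A permutation \<open>q\<close> of \<open>{..<2 * n}\<close> lists global ranks (0 is the largest value): positions
  below \<open>n\<close> hold the samples, position \<open>n + t\<close> holds the value arriving at time \<open>t\<close>.
\<close>

definition best_samples :: "nat \<Rightarrow> (nat \<Rightarrow> nat) \<Rightarrow> nat \<Rightarrow> nat" where
  "best_samples n q j = card {i. i < n \<and> q i < j}"

definition rank_win :: "nat \<Rightarrow> (nat \<Rightarrow> nat) \<Rightarrow> bool" where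
  "rank_win n q \<longleftrightarrow> (\<exists>t<n. (\<forall>s<n. s \<noteq> t \<longrightarrow> q (n + t) < q (n + s)) \<and>
     accept_rank n t (Suc (best_samples n q (q (n + t)))) \<and>
     (\<forall>s<t. (\<forall>u<s. q (n + s) < q (n + u)) \<longrightarrow> \<not> accept_rank n s (Suc (best_samples n q (q (n + s))))))"

text \<open>Negation turns global ranks, with 0 for the largest, into values of the same
  order.\<close>

lemma accepts_max_half_rule_iff:
  assumes q: "q permutes {..<2 * n}"
  shows "accepts_max (half_rule n) n (map (\<lambda>t. - real (q t)) [0..<2 * n]) \<longleftrightarrow> rank_win n q"
proof -
  let ?x = "\<lambda>t. - real (q t)"
  have rule: "half_rule n (map ?x [0..<Suc (n + t)]) \<longleftrightarrow>
      (\<forall>u<t. q (n + t) < q (n + u)) \<and> accept_rank n t (Suc (best_samples n q (q (n + t))))" for t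
  proof -
    have nth: "map ?x [0..<Suc (n + t)] ! i = ?x i" if "i \<le> n + t" for i
      using that by (simp del: upt_Suc)
    have "{i. i < n \<and> i < Suc (n + t) \<and> ?x (n + t) < map ?x [0..<Suc (n + t)] ! i} = {i. i < n \<and> q i < q (n + t)}"
      using nth by (auto simp del: upt_Suc)
    moreover have "(\<forall>i\<in>{n..<n + t}. map ?x [0..<Suc (n + t)] ! i < ?x (n + t)) \<longleftrightarrow> (\<forall>u<t. q (n + t) < q (n + u))"
    proof (intro iffI ballI allI impI)
      fix u assume "\<forall>i\<in>{n..<n + t}. map ?x [0..<Suc (n + t)] ! i < ?x (n + t)" "u < t"
      then show "q (n + t) < q (n + u)" using nth[of "n + u"] by (auto dest!: bspec[of _ _ "n + u"] simp del: upt_Suc)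
    next
      fix i assume a: "\<forall>u<t. q (n + t) < q (n + u)" "i \<in> {n..<n + t}"
      then have "q (n + t) < q (n + (i - n))" by (intro a(1)[rule_format]) auto
      then show "map ?x [0..<Suc (n + t)] ! i < ?x (n + t)" using nth[of i] a(2) by (simp del: upt_Suc)
    qed
    ultimately show ?thesis using nth unfolding half_rule_def best_samples_def by (simp del: upt_Suc)
  qed
  have take: "take (Suc k) (map ?x [0..<2 * n]) = map ?x [0..<Suc k]" if "k < 2 * n" for k
    using that by (simp add: take_map take_upt)
  have max: "?x (n + t) = Max (set (drop n (map ?x [0..<2 * n]))) \<longleftrightarrow> (\<forall>s<n. s \<noteq> t \<longrightarrow> q (n + t) < q (n + s))" if "t < n" for t
  proof -
    have "set (drop n (map ?x [0..<2 * n])) = ?x ` {n..<2 * n}" by (simp add: drop_map)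
    also have "\<dots> = (\<lambda>s. ?x (n + s)) ` {..<n}"
    proof (intro equalityI subsetI)
      fix y assume "y \<in> ?x ` {n..<2 * n}"
      then obtain i where "i \<in> {n..<2 * n}" "y = ?x i" by blast
      then show "y \<in> (\<lambda>s. ?x (n + s)) ` {..<n}" by (intro image_eqI[of _ _ "i - n"]) auto
    qed auto
    finally have S: "set (drop n (map ?x [0..<2 * n])) = (\<lambda>s. ?x (n + s)) ` {..<n}" .
    have "?x (n + t) = Max ((\<lambda>s. ?x (n + s)) ` {..<n}) \<longleftrightarrow> (\<forall>s<n. q (n + t) \<le> q (n + s))"
    proof
      assume eq: "?x (n + t) = Max ((\<lambda>s. ?x (n + s)) ` {..<n})"
      show "\<forall>s<n. q (n + t) \<le> q (n + s)"
      proof clarify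
        fix s assume "s < n"
        then have "?x (n + s) \<le> Max ((\<lambda>s. ?x (n + s)) ` {..<n})" by (intro Max_ge) auto
        then show "q (n + t) \<le> q (n + s)" unfolding eq[symmetric] by simp
      qed
    next
      assume "\<forall>s<n. q (n + t) \<le> q (n + s)" then show "?x (n + t) = Max ((\<lambda>s. ?x (n + s)) ` {..<n})"
        using that by (intro Max_eqI[symmetric]) auto
    qed
    also have "\<dots> \<longleftrightarrow> (\<forall>s<n. s \<noteq> t \<longrightarrow> q (n + t) < q (n + s))"
      using permutes_inj[OF q] by (metis add_left_cancel injD le_neq_implies_less less_imp_le order_refl)
    finally show ?thesis unfolding S .
  qed
  show ?thesis
  proof
    assume "accepts_max (half_rule n) n (map ?x [0..<2 * n])"
    then obtain k where k: "n \<le> k" "k < 2 * n" "half_rule n (take (Suc k) (map ?x [0..<2 * n]))"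
      "\<forall>s. n \<le> s \<and> s < k \<longrightarrow> \<not> half_rule n (take (Suc s) (map ?x [0..<2 * n]))"
      "?x k = Max (set (drop n (map ?x [0..<2 * n])))"
      unfolding accepts_max_def accepts_at_def by auto
    define t where "t = k - n"
    have t: "k = n + t" "t < n" using k by (auto simp: t_def)
    have "\<not> half_rule n (map ?x [0..<Suc (n + s)])" if "s < t" for s
      using k(4)[rule_format, of "n + s"] take[of "n + s"] that t by simp
    moreover have "half_rule n (map ?x [0..<Suc (n + t)])" using k(3) take[of k] k(2) t by simp
    ultimately show "rank_win n q" using max[OF t(2)] k(5) rule t unfolding rank_win_def by metis
  next
    assume "rank_win n q"
    then obtain t where t: "t < n" "\<forall>s<n. s \<noteq> t \<longrightarrow> q (n + t) < q (n + s)"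
     "accept_rank n t (Suc (best_samples n q (q (n + t))))"
     "\<forall>s<t. (\<forall>u<s. q (n + s) < q (n + u)) \<longrightarrow> \<not> accept_rank n s (Suc (best_samples n q (q (n + s))))"
      unfolding rank_win_def by blast
    have "half_rule n (map ?x [0..<Suc (n + t)])" unfolding rule using t by auto
    moreover have "\<not> half_rule n (map ?x [0..<Suc k])" if "n \<le> k" "k < n + t" for k
      proof -
      have k: "k - n < t" "n + (k - n) = k" using that by auto
      show ?thesis using rule[of "k - n"] t(4)[rule_format, OF k(1)] unfolding k(2) by blast
    qed
    ultimately have "accepts_at (half_rule n) n (map ?x [0..<2 * n]) (n + t)"
      unfolding accepts_at_def using take t(1) by auto
    moreover have "map ?x [0..<2 * n] ! (n + t) = Max (set (drop n (map ?x [0..<2 * n])))"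
      using max[OF t(1)] t by simp
    ultimately show "accepts_max (half_rule n) n (map ?x [0..<2 * n])" unfolding accepts_max_def by blast
  qed
qed

lemma card_rank_win:
  "real (card {q. q permutes {..<2 * n} \<and> rank_win n q}) = fact (2 * n) * half_value n"
proof -
  have "{q. q permutes {..<2 * n} \<and> rank_win n q} =
     {p. p permutes {..<2 * n} \<and> accepts_max (half_rule n) n (map (\<lambda>t. - real (p t)) [0..<2 * n])}"
    using accepts_max_half_rule_iff by blast
  then show ?thesis using card_half_rule[of "\<lambda>i. - real i" n] by (simp add: inj_on_def)
qed

section \<open>The positions of the top values decide whether the rule wins\<close>

text \<open>Meant for the inverse of \<open>q\<close>, which sends a global rank to its position.
  Samples are only counted by the rule, so where they stand is forgotten and they all get 0;
  arrivals keep their time, shifted by one. The restriction to \<open>{..<K}\<close> turns equality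
  of profiles into equality of functions.\<close>

definition top_profile :: "nat \<Rightarrow> nat \<Rightarrow> (nat \<Rightarrow> nat) \<Rightarrow> nat \<Rightarrow> nat" where
  "top_profile n K p = (\<lambda>j\<in>{..<K}. if p j < n then 0 else Suc (p j - n))"

text \<open>The early top arrival forces the best arrival into the top \<open>K\<close> and ends the
  period in which a lower value can be a record; the four samples give such records a relative rank
  of at least 5.\<close>

definition top_good :: "nat \<Rightarrow> nat \<Rightarrow> (nat \<Rightarrow> nat) \<Rightarrow> bool" where
  "top_good n K f \<longleftrightarrow> (\<exists>j<K. 0 < f j \<and> 2 * (f j - 1) < n) \<and> 4 \<le> card {j. j < K \<and> f j = 0}"

lemma best_samples_eq:
  assumes q: "q permutes {..<2 * n}"
  shows "best_samples n q j = card {k. k < j \<and> inv q k < n}"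
  unfolding best_samples_def
proof (rule bij_betw_same_card[where f = q])
  show "bij_betw q {i. i < n \<and> q i < j} {k. k < j \<and> inv q k < n}"
    by (rule bij_betw_byWitness[where f' = "inv q"]) (auto simp: permutes_inverses[OF q])
qed

text \<open>The relative rank is at least 5 and more than \<open>n / 2\<close> values are to come,
  so their product exceeds the total \<open>2 * n\<close> and \<open>cont_value_gt_miss_prob\<close>
  applies.\<close>

lemma not_accept_rank_early:
  assumes "4 \<le> b" "b \<le> n" "2 * Suc s < n"
  shows "\<not> accept_rank n s (Suc b)"
proof -
  have "5 * (n - Suc s) \<le> Suc b * (n - Suc s)" using assms by (intro mult_le_mono) auto
  moreover have "2 * n < 5 * (n - Suc s)" using assms by auto
  ultimately have "miss_prob (2 * n) (n - Suc s) (Suc b) < cont_value (2 * n) (n - Suc s) (Suc b)"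
    using assms by (intro cont_value_gt_miss_prob) auto
  then show ?thesis by (simp add: accept_rank_def)
qed

text \<open>
  While no value among the top \<open>K\<close> has arrived, at least four samples beat every arrival, and
  early arrivals of such a rank are rejected.
\<close>

lemma rank_win_determined:
  assumes q: "q permutes {..<2 * n}" and q': "q' permutes {..<2 * n}"
    and eq: "top_profile n K (inv q) = top_profile n K (inv q')"
    and good: "top_good n K (top_profile n K (inv q))"
    and win: "rank_win n q"
  shows "rank_win n q'"
proof -
  note i = permutes_inverses[OF q] and i' = permutes_inverses[OF q']
  have prof: "(if inv q j < n then 0 else Suc (inv q j - n)) = (if inv q' j < n then 0 else Suc (inv q' j - n))" if "j < K" for j
    using fun_cong[OF eq, of j] that by (simp add: top_profile_def)
  have low: "inv q j < n \<longleftrightarrow> inv q' j < n" if "j < K" for j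
    using prof[OF that] by (auto split: if_splits)
  have pos: "inv q' j = inv q j" if "j < K" "\<not> inv q j < n" for j
    using prof[OF that(1)] low[OF that(1)] that(2) by (auto split: if_splits)
  have tr: "q' (n + s) = q (n + s)" if "q (n + s) < K" for s
    using pos[OF that] i i' by (metis not_add_less1)
  have tr': "q' (n + s) = q (n + s)" if "q' (n + s) < K" for s
    using pos[OF that] low[OF that] i i' by (metis not_add_less1)
  have samp: "best_samples n q' j = best_samples n q j" if "j \<le> K" for j
    unfolding best_samples_eq[OF q] best_samples_eq[OF q'] using low that by (metis (no_types, lifting) Collect_cong less_le_trans)
  obtain t where t: "t < n" "\<forall>s<n. s \<noteq> t \<longrightarrow> q (n + t) < q (n + s)"
     "accept_rank n t (Suc (best_samples n q (q (n + t))))"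
     "\<forall>s<t. (\<forall>u<s. q (n + s) < q (n + u)) \<longrightarrow> \<not> accept_rank n s (Suc (best_samples n q (q (n + s))))"
    using win unfolding rank_win_def by blast
  obtain j1 where j1: "j1 < K" "\<not> inv q j1 < n" "2 * (inv q j1 - n) < n"
    using good by (auto simp: top_good_def top_profile_def split: if_splits)
  define t1 where "t1 = inv q j1 - n"
  have t1: "q (n + t1) = j1" "2 * t1 < n" "t1 < n" using j1 i by (auto simp: t1_def)
  \<comment> \<open>The arrival at time \<open>t1\<close> has rank below \<open>K\<close>, hence so
    has the best arrival, and its time is visible in the profile.\<close>
  have "q (n + t) \<le> q (n + t1)" using t(2) t1(3) by (cases "t1 = t") (auto intro: less_imp_le)
  then have tK: "q (n + t) < K" using t1 j1 by simp
  have "q' (n + t) < q' (n + s)" if "s < n" "s \<noteq> t" for s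
  proof (rule ccontr)
    assume "\<not> q' (n + t) < q' (n + s)"
    then have le: "q' (n + s) \<le> q (n + t)" using tr[OF tK] by simp
    then have "q (n + s) \<le> q (n + t)" using tr'[of s] tK by simp
    then show False using t(2) that by (metis not_less)
  qed
  moreover have "accept_rank n t (Suc (best_samples n q' (q' (n + t))))"
    using t(3) tr[OF tK] samp tK by simp
  moreover have "\<not> accept_rank n s (Suc (best_samples n q' (q' (n + s))))"
    if s: "s < t" and rec: "\<forall>u<s. q' (n + s) < q' (n + u)" for s
  proof (cases "q' (n + s) < K")
    case True
    have "q (n + s) < q (n + u)" if "u < s" for u
    proof (rule ccontr)
      assume "\<not> q (n + s) < q (n + u)"
      then have "q (n + u) \<le> q' (n + s)" using tr'[OF True] by simp
      then have "q' (n + u) \<le> q' (n + s)" using tr[of u] True by simp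
      then show False using rec that by (metis not_less)
    qed
    then show ?thesis using t(4) s tr'[OF True] samp True by simp
  next
    case False
    have "q' (n + t1) < K" using tr[of t1] t1 j1 by simp
    then have "s < t1" using rec False by (metis less_trans linorder_neqE_nat)
    then have "2 * Suc s < n" using t1 by auto
    moreover have "4 \<le> best_samples n q' (q' (n + s))"
    proof -
      have "4 \<le> card {j. j < K \<and> top_profile n K (inv q) j = 0}" using good by (simp add: top_good_def)
      also have "{j. j < K \<and> top_profile n K (inv q) j = 0} = {j. j < K \<and> inv q' j < n}"
        using low by (auto simp: top_profile_def split: if_splits)
      also have "card \<dots> \<le> card {k. k < q' (n + s) \<and> inv q' k < n}"
        using False by (intro card_mono) auto
      finally show ?thesis unfolding best_samples_eq[OF q'] .
    qed
    moreover have "best_samples n q' (q' (n + s)) \<le> n"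
    proof -
      have "best_samples n q' (q' (n + s)) \<le> card {..<n}" unfolding best_samples_def by (intro card_mono) auto
      then show ?thesis by simp
    qed
    ultimately show ?thesis by (intro not_accept_rank_early)
  qed
  ultimately show ?thesis using t(1) unfolding rank_win_def by blast
qed

text \<open>Among the top \<open>K\<close> values the expected number of samples is
  \<open>K / 2\<close> and that of early arrivals at least \<open>K / 4\<close>. The two Chebyshev
  bounds \<open>8 / K\<close> and \<open>16 / K\<close> add up to \<open>24 / K\<close>, and
  \<open>32 \<le> K\<close> makes both means at least 8.\<close>

lemma card_top_bad:
  assumes K: "32 \<le> K" "K \<le> 2 * n"
  shows "real (card {q. q permutes {..<2 * n} \<and> \<not> top_good n K (top_profile n K (inv q))}) \<le> 24 / real K * fact (2 * n)"
proof -
  let ?A = "{s. n \<le> s \<and> 2 * (s - n) < n}"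
  let ?few = "\<lambda>A. {p. p permutes {..<2 * n} \<and> card {j. j < K \<and> p j \<in> A} < 4}"
  have n: "0 < n" "2 \<le> 2 * n" using K by auto
  have "card {q. q permutes {..<2 * n} \<and> \<not> top_good n K (top_profile n K (inv q))} =
     card {p. p permutes {..<2 * n} \<and> \<not> top_good n K (top_profile n K p)}"
    by (rule card_permutes_inv[where P = "\<lambda>p. \<not> top_good n K (top_profile n K p)"]) simp
  also have "\<dots> \<le> card (?few {..<n} \<union> ?few ?A)"
  proof (intro card_mono)
    show "finite (?few {..<n} \<union> ?few ?A)"
      using finite_permutations[of "{..<2 * n}"] by (auto intro: finite_subset[rotated])
    show "{p. p permutes {..<2 * n} \<and> \<not> top_good n K (top_profile n K p)} \<subseteq> ?few {..<n} \<union> ?few ?A"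
    proof (rule subsetI, rule ccontr)
      fix p assume p: "p \<in> {p. p permutes {..<2 * n} \<and> \<not> top_good n K (top_profile n K p)}" "p \<notin> ?few {..<n} \<union> ?few ?A"
      then have "4 \<le> card {j. j < K \<and> p j \<in> {..<n}}" "4 \<le> card {j. j < K \<and> p j \<in> ?A}" by auto
      moreover have "{j. j < K \<and> top_profile n K p j = 0} = {j. j < K \<and> p j \<in> {..<n}}"
        by (auto simp: top_profile_def)
      moreover have "{j. j < K \<and> p j \<in> ?A} \<noteq> {}" using calculation(2) by (metis card.empty not_numeral_le_zero)
      moreover have "\<exists>j<K. 0 < top_profile n K p j \<and> 2 * (top_profile n K p j - 1) < n"
      proof -
        obtain j where "j < K" "p j \<in> ?A" using calculation(4) by blast
        then show ?thesis by (intro exI[of _ j]) (auto simp: top_profile_def)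
      qed
      ultimately have "top_good n K (top_profile n K p)" by (simp add: top_good_def)
      then show False using p by simp
    qed
  qed
  also have "\<dots> \<le> card (?few {..<n}) + card (?few ?A)" by (rule card_Un_le)
  finally have "real (card {q. q permutes {..<2 * n} \<and> \<not> top_good n K (top_profile n K (inv q))}) \<le>
     real (card (?few {..<n})) + real (card (?few ?A))" by linarith
  also have "real (card (?few {..<n})) \<le> 4 / (real K / 2) * fact (2 * n)"
    using K n by (intro card_permutes_few_hits) auto
  also have "real (card (?few ?A)) \<le> 4 / (real K / 4) * fact (2 * n)"
  proof (rule card_permutes_few_hits)
    \<comment> \<open>The times \<open>t\<close> with \<open>2 * t < n\<close> are those below
      \<open>Suc n div 2\<close>, so at least half of the arrivals are early.\<close>
    have "(\<lambda>s. n + s) ` {..<Suc n div 2} \<subseteq> ?A" by auto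
    moreover have fin: "?A \<subseteq> {..<2 * n}" by auto
    ultimately have "card ((\<lambda>s. n + s) ` {..<Suc n div 2}) \<le> card ?A"
      using finite_subset[OF fin] by (intro card_mono) auto
    then have "Suc n div 2 \<le> card ?A" by (simp add: card_image)
    then have "real n / 2 \<le> real (card ?A)" by linarith
    then have "real n / 2 * real K / real (2 * n) \<le> real (card ?A) * real K / real (2 * n)"
      by (intro divide_right_mono mult_right_mono) auto
    then show "real K / 4 \<le> real (card ?A) * real K / real (2 * n)" using n by simp
  qed (use K n in auto)
  finally show ?thesis by (simp add: field_simps)
qed

section \<open>Profiles under a uniform order and under paired draws\<close>

lemma fact_le_fact_mult_power: "x \<le> n \<Longrightarrow> fact n \<le> (fact (n - x) * n ^ x :: nat)"
proof (induction x)
  case (Suc x)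
  have "fact (n - x) = (n - x) * fact (n - Suc x)" using Suc.prems by (subst fact_reduce) auto
  then have "fact (n - x) \<le> n * (fact (n - Suc x) :: nat)" by simp
  then have "fact (n - x) * n ^ x \<le> n * fact (n - Suc x) * n ^ x" by (rule mult_le_mono1)
  with Suc have "fact n \<le> n * fact (n - Suc x) * n ^ x" by (meson Suc_leD le_trans)
  then show ?case by (simp add: mult_ac)
qed simp

lemma fact_mult_power_le_fact: "K \<le> N \<Longrightarrow> (fact (N - K) * (N - K) ^ K :: nat) \<le> fact N"
proof (induction K)
  case (Suc K)
  have "fact (N - K) = (N - K) * fact (N - Suc K)" using Suc.prems by (subst fact_reduce) auto
  moreover have "(N - Suc K) * (N - Suc K) ^ K \<le> (N - K) * (N - K) ^ K" by (intro mult_le_mono power_mono) auto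
  ultimately have "fact (N - Suc K) * (N - Suc K) ^ Suc K \<le> fact (N - K) * (N - K) ^ K"
    by (simp add: mult.assoc mult.left_commute)
  then show ?case using Suc by simp
qed simp

text \<open>A profile with \<open>x\<close> arrivals has probability at least
  \<open>2^(n-K) * (n-x)! / (2^n * n!)\<close> for paired draws and at most
  \<open>n^(K-x) * (2n-K)! / (2n)!\<close> for a uniform order. The quotient of these is at least
  the \<open>K\<close>-th power of \<open>1 - K / (2 * n)\<close>, which Bernoulli's inequality
  bounds below.\<close>

lemma profile_ratio:
  assumes "x \<le> K" "K \<le> n" "0 < n" "0 \<le> 1 - (real K)\<^sup>2 / real n"
  shows "(1 - (real K)\<^sup>2 / real n) * (2 ^ n * fact n) * (real n ^ (K - x) * fact (2 * n - K)) \<le>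
     2 ^ (n - K) * fact (n - x) * fact (2 * n)"
proof -
  define c where "c = 1 - (real K)\<^sup>2 / real n"
  have F1: "(fact n :: real) \<le> fact (n - x) * real n ^ x"
    using fact_le_fact_mult_power[of x n] assms by (metis (mono_tags) le_trans of_nat_fact of_nat_le_iff of_nat_mult of_nat_power)
  have "real (fact (2 * n - K) * (2 * n - K) ^ K) \<le> real (fact (2 * n))"
    using fact_mult_power_le_fact[of K "2 * n"] assms by (intro of_nat_mono) auto
  then have F2: "(fact (2 * n - K) :: real) * (2 * real n - real K) ^ K \<le> fact (2 * n)"
    using assms by (simp add: of_nat_diff)
  have B: "c * (2 * real n) ^ K \<le> (2 * real n - real K) ^ K"
  proof -
    have "1 + real K * (- (real K / (2 * real n))) \<le> (1 + (- (real K / (2 * real n)))) ^ K"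
      using assms by (intro Bernoulli_inequality) (auto simp: field_simps)
    moreover have "c \<le> 1 + real K * (- (real K / (2 * real n)))"
      using assms by (simp add: c_def power2_eq_square field_simps)
    ultimately have "c * (2 * real n) ^ K \<le> (1 - real K / (2 * real n)) ^ K * (2 * real n) ^ K"
      by (intro mult_right_mono) auto
    also have "\<dots> = ((1 - real K / (2 * real n)) * (2 * real n)) ^ K" by (simp add: power_mult_distrib)
    also have "(1 - real K / (2 * real n)) * (2 * real n) = 2 * real n - real K" using assms by (simp add: field_simps)
    finally show ?thesis .
  qed
  have p2: "(2::real) ^ n = 2 ^ (n - K) * 2 ^ K" using assms by (simp flip: power_add)
  have pn: "real n ^ K = real n ^ x * real n ^ (K - x)" using assms by (simp flip: power_add)
  have "c * (2 ^ n * fact n) * (real n ^ (K - x) * fact (2 * n - K)) \<le>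
     c * (2 ^ n * (fact (n - x) * real n ^ x)) * (real n ^ (K - x) * fact (2 * n - K))"
    using F1 assms(4) by (intro mult_right_mono mult_left_mono) (auto simp: c_def)
  also have "\<dots> = 2 ^ (n - K) * fact (n - x) * (fact (2 * n - K) * (c * (2 * real n) ^ K))"
    unfolding p2 power_mult_distrib pn by (simp add: mult_ac)
  also have "\<dots> \<le> 2 ^ (n - K) * fact (n - x) * (fact (2 * n - K) * (2 * real n - real K) ^ K)"
    using B by (intro mult_left_mono) auto
  also have "\<dots> \<le> 2 ^ (n - K) * fact (n - x) * fact (2 * n)"
    using F2 by (intro mult_left_mono) auto
  finally show ?thesis by (simp add: c_def)
qed

lemma card_ideal_profile:
  assumes K: "K \<le> 2 * n"
  shows "card {q. q permutes {..<2 * n} \<and> top_profile n K (inv q) = f} \<le>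
    n ^ card {j. j < K \<and> f j = 0} * fact (2 * n - K)"
proof -
  let ?Y = "{j. j < K \<and> f j = 0}"
  let ?g = "\<lambda>h j. if f j = 0 then h j else n + f j - 1"
  let ?H = "?Y \<rightarrow>\<^sub>E {..<n}"
  let ?T = "\<lambda>h. {p. p permutes {..<2 * n} \<and> (\<forall>j\<in>{..<K}. p j = ?g h j)}"
  have fin: "finite ?H" by (intro finite_PiE) auto
  have finP: "finite {p. p permutes {..<2 * n}}" by (rule finite_permutations) simp
  have "card {q. q permutes {..<2 * n} \<and> top_profile n K (inv q) = f} =
     card {p. p permutes {..<2 * n} \<and> top_profile n K p = f}"
    by (rule card_permutes_inv[where P = "\<lambda>p. top_profile n K p = f"]) simp
  also have "\<dots> \<le> card (\<Union>h\<in>?H. ?T h)"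
  proof (intro card_mono)
    show "finite (\<Union>h\<in>?H. ?T h)" using fin finP by (auto intro: finite_subset[rotated])
    show "{p. p permutes {..<2 * n} \<and> top_profile n K p = f} \<subseteq> (\<Union>h\<in>?H. ?T h)"
    proof
      fix p assume "p \<in> {p. p permutes {..<2 * n} \<and> top_profile n K p = f}"
      then have p: "p permutes {..<2 * n}" and f: "f = top_profile n K p" by auto
      have "restrict p ?Y \<in> ?H" by (auto simp: f top_profile_def split: if_splits)
      moreover have "p j = ?g (restrict p ?Y) j" if "j < K" for j
        using that by (auto simp: f top_profile_def)
      ultimately show "p \<in> (\<Union>h\<in>?H. ?T h)" using p by blast
    qed
  qed
  also have "\<dots> \<le> (\<Sum>h\<in>?H. card (?T h))" by (rule card_UN_le[OF fin])
  also have "\<dots> \<le> (\<Sum>h\<in>?H. fact (2 * n - K))"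
  proof (rule sum_mono)
    fix h
    show "card (?T h) \<le> fact (2 * n - K)"
      using card_permutes_extending_le[of "{..<2 * n}" "{..<K}" "?g h"] K by simp
  qed
  also have "\<dots> = n ^ card ?Y * fact (2 * n - K)" by (simp add: card_PiE)
  finally show ?thesis .
qed

text \<open>
  Items \<open>i\<close> and \<open>n + i\<close> are the two draws of pair \<open>i\<close>, \<open>\<rho>\<close> is their global rank. A pair in \<open>\<sigma>\<close> has
  its draws exchanged: item \<open>i\<close> then arrives and item \<open>n + i\<close> is the sample.
\<close>

definition pair_order :: "nat \<Rightarrow> (nat \<Rightarrow> nat) \<Rightarrow> nat set \<Rightarrow> (nat \<Rightarrow> nat) \<Rightarrow> nat \<Rightarrow> nat" where
  "pair_order n \<rho> \<sigma> p t =
     (if t < n then \<rho> (if t \<in> \<sigma> then n + t else t)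
      else if t < 2 * n then \<rho> (if p (t - n) \<in> \<sigma> then p (t - n) else n + p (t - n))
      else t)"

lemma permutes_pair_order:
  assumes \<rho>: "\<rho> permutes {..<2 * n}" and p: "p permutes {..<n}"
  shows "pair_order n \<rho> \<sigma> p permutes {..<2 * n}"
proof (rule bij_imp_permutes)
  have pn: "p (u - n) < n" if "u < 2 * n" for u using permutes_in_image[OF p, of "u - n"] that by simp
  have \<rho>m: "\<rho> u < 2 * n" if "u < 2 * n" for u using permutes_in_image[OF \<rho>, of u] that by simp
  have \<rho>in: "\<rho> u = \<rho> w \<longleftrightarrow> u = w" for u w using permutes_inj[OF \<rho>] by (auto dest: injD)
  have pin: "p u = p w \<longleftrightarrow> u = w" for u w using permutes_inj[OF p] by (auto dest: injD)
  have inj: "inj_on (pair_order n \<rho> \<sigma> p) {..<2 * n}"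
  proof (rule inj_onI)
    fix u w assume uw: "u \<in> {..<2 * n}" "w \<in> {..<2 * n}" "pair_order n \<rho> \<sigma> p u = pair_order n \<rho> \<sigma> p w"
    show "u = w"
      using uw pn[of u] pn[of w]
      by (auto simp: pair_order_def \<rho>in pin split: if_splits)
  qed
  moreover have "pair_order n \<rho> \<sigma> p ` {..<2 * n} \<subseteq> {..<2 * n}"
  proof (rule image_subsetI)
    fix t assume "t \<in> {..<2 * n}"
    then show "pair_order n \<rho> \<sigma> p t \<in> {..<2 * n}"
      using pn[of t] by (auto simp: pair_order_def intro!: \<rho>m)
  qed
  ultimately show "bij_betw (pair_order n \<rho> \<sigma> p) {..<2 * n} {..<2 * n}"
    by (simp add: bij_betw_def endo_inj_surj)
qed (auto simp: pair_order_def)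

text \<open>The top \<open>K\<close> items lie in \<open>K\<close> different pairs. To realize
  \<open>f\<close>, the orientation of these pairs is forced and that of the other
  \<open>n - K\<close> is free; for each of the \<open>x\<close> arrivals in the profile the order
  \<open>p\<close> must put its pair at the prescribed time, leaving \<open>(n - x)!\<close> orders.
  The permutation \<open>q\<close> certifies that \<open>f\<close> is consistent.\<close>

lemma card_pair_profile:
  assumes \<rho>: "\<rho> permutes {..<2 * n}" and q: "q permutes {..<2 * n}" and n: "0 < n" and K: "K \<le> n"
    and distinct: "\<And>i. i < n \<Longrightarrow> \<not> (\<rho> i < K \<and> \<rho> (n + i) < K)"
  defines "f \<equiv> top_profile n K (inv q)"
  defines "x \<equiv> card {j. j < K \<and> f j \<noteq> 0}"
  shows "2 ^ (n - K) * fact (n - x) \<le>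
    card {(\<sigma>, p). \<sigma> \<subseteq> {..<n} \<and> p permutes {..<n} \<and> top_profile n K (inv (pair_order n \<rho> \<sigma> p)) = f}"
proof -
  note ri = permutes_inverses[OF \<rho>] and qi = permutes_inverses[OF q]
  define prt where "prt j = inv \<rho> j mod n" for j
  have item: "inv \<rho> j < 2 * n" if "j < K" for j
    using permutes_in_image[OF permutes_inv[OF \<rho>], of j] that K by auto
  have prt: "prt j < n" "inv \<rho> j = prt j \<or> inv \<rho> j = n + prt j" if "j < K" for j
    using item[OF that] n by (auto simp: prt_def mod_if)
  have prt_inj: "j = k" if "j < K" "k < K" "prt j = prt k" for j k
  proof -
    have "\<rho> (inv \<rho> j) = j" "\<rho> (inv \<rho> k) = k" using ri by auto
    then show ?thesis using prt[OF that(1)] prt[OF that(2)] that distinct[of "prt j"] by metis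
  qed
  define I where "I = prt ` {..<K}"
  have I: "I \<subseteq> {..<n}" "card I = K"
    using prt(1) prt_inj by (auto simp: I_def inj_on_def card_image)
  \<comment> \<open>An item below \<open>n\<close> is a sample unless its pair is exchanged, an item
    from \<open>n\<close> on arrives unless it is exchanged. So a pair is exchanged exactly when the
    role required by \<open>f\<close> is not the default role of its item.\<close>
  define \<sigma>0 where "\<sigma>0 = prt ` {j. j < K \<and> (f j \<noteq> 0 \<longleftrightarrow> inv \<rho> j < n)}"
  have \<sigma>0: "prt j \<in> \<sigma>0 \<longleftrightarrow> (f j \<noteq> 0 \<longleftrightarrow> inv \<rho> j < n)" if "j < K" for j
  proof
    assume "prt j \<in> \<sigma>0"
    then obtain k where k: "prt j = prt k" "k < K" "f k \<noteq> 0 \<longleftrightarrow> inv \<rho> k < n" unfolding \<sigma>0_def by blast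
    then have "k = j" using prt_inj that by metis
    then show "f j \<noteq> 0 \<longleftrightarrow> inv \<rho> j < n" using k(3) by simp
  next
    assume "f j \<noteq> 0 \<longleftrightarrow> inv \<rho> j < n"
    then show "prt j \<in> \<sigma>0" unfolding \<sigma>0_def using that by blast
  qed
  have \<sigma>0I: "\<sigma>0 \<subseteq> I" by (auto simp: \<sigma>0_def I_def)
  define Sg where "Sg = (\<lambda>\<tau>. \<sigma>0 \<union> \<tau>) ` Pow ({..<n} - I)"
  have "card Sg = card (Pow ({..<n} - I))"
    unfolding Sg_def using \<sigma>0I by (intro card_image inj_onI) blast
  also have "\<dots> = 2 ^ (n - K)" using I by (simp add: card_Pow card_Diff_subset finite_subset)
  finally have cS: "card Sg = 2 ^ (n - K)" .
  have finS: "finite Sg" by (simp add: Sg_def)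
  let ?X = "{j. j < K \<and> f j \<noteq> 0}"
  have fX: "inv q j = n + (f j - 1)" "f j - 1 < n" if "j \<in> ?X" for j
  proof -
    have j: "j < K" "f j = Suc (inv q j - n)" "\<not> inv q j < n"
      using that by (auto simp: f_def top_profile_def split: if_splits)
    then show "inv q j = n + (f j - 1)" by simp
    have "inv q j < 2 * n" using permutes_in_image[OF permutes_inv[OF q], of j] j(1) K by auto
    then show "f j - 1 < n" using j by simp
  qed
  define Ts where "Ts = (\<lambda>j. f j - 1) ` ?X"
  have injT: "inj_on (\<lambda>j. f j - 1) ?X"
    using fX(1) qi by (intro inj_onI) metis
  have cT: "card Ts = x" "Ts \<subseteq> {..<n}" using injT fX(2) by (auto simp: Ts_def card_image x_def)
  \<comment> \<open>The pair that has to arrive at time \<open>t\<close>, as read off from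
    \<open>q\<close>.\<close>
  define g where "g t = prt (q (n + t))" for t
  have qT: "q (n + (f j - 1)) = j" if "j \<in> ?X" for j using fX(1)[OF that] qi by metis
  have g: "g (f j - 1) = prt j" if "j \<in> ?X" for j using qT[OF that] by (simp add: g_def)
  have "inj_on g Ts"
  proof (rule inj_onI)
    fix a b assume "a \<in> Ts" "b \<in> Ts" and eq: "g a = g b"
    then obtain j k where jk: "j \<in> ?X" "k \<in> ?X" "a = f j - 1" "b = f k - 1" by (auto simp: Ts_def)
    then have "prt j = prt k" using eq g by metis
    then have "j = k" using jk prt_inj by blast
    then show "a = b" using jk by simp
  qed
  moreover have "g ` Ts \<subseteq> {..<n}" using g prt(1) by (auto simp: Ts_def)
  ultimately have cP: "card {p. p permutes {..<n} \<and> (\<forall>t\<in>Ts. p t = g t)} = fact (n - x)"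
    using card_permutes_extending[of "{..<n}" Ts g] cT by simp
  have "Sg \<times> {p. p permutes {..<n} \<and> (\<forall>t\<in>Ts. p t = g t)} \<subseteq>
     {(\<sigma>, p). \<sigma> \<subseteq> {..<n} \<and> p permutes {..<n} \<and> top_profile n K (inv (pair_order n \<rho> \<sigma> p)) = f}"
  proof clarify
    fix \<sigma> p assume s: "\<sigma> \<in> Sg" and p: "p permutes {..<n}" "\<forall>t\<in>Ts. p t = g t"
    obtain \<tau> where \<tau>: "\<sigma> = \<sigma>0 \<union> \<tau>" "\<tau> \<subseteq> {..<n} - I" using s by (auto simp: Sg_def)
    have sn: "\<sigma> \<subseteq> {..<n}" using \<tau> \<sigma>0I I by auto
    have mem: "prt j \<in> \<sigma> \<longleftrightarrow> (f j \<noteq> 0 \<longleftrightarrow> inv \<rho> j < n)" if "j < K" for j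
      using \<sigma>0[OF that] \<tau> that by (auto simp: I_def)
    let ?Q = "pair_order n \<rho> \<sigma> p"
    note Qi = permutes_inverses[OF permutes_pair_order[OF \<rho> p(1), of \<sigma>]]
    have "top_profile n K (inv ?Q) j = f j" for j
    proof (cases "j < K")
      case True
      note pj = prt[OF True]
      have \<rho>j: "\<rho> (inv \<rho> j) = j" using ri by simp
      show ?thesis
      proof (cases "f j = 0")
        case True0: True
        have "?Q (prt j) = j"
          using pj mem[OF True] \<rho>j True0 by (auto simp: pair_order_def)
        then have "inv ?Q j = prt j" using Qi by metis
        then show ?thesis using True pj True0 by (simp add: top_profile_def)
      next
        case False
        then have jX: "j \<in> ?X" using True by simp
        have "p (f j - 1) = prt j" using p(2) g[OF jX] jX by (auto simp: Ts_def)
        then have "?Q (n + (f j - 1)) = j"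
          using pj mem[OF True] \<rho>j False fX(2)[OF jX] by (auto simp: pair_order_def)
        then have "inv ?Q j = n + (f j - 1)" using Qi by metis
        then show ?thesis using True False by (simp add: top_profile_def)
      qed
    next
      case False
      then show ?thesis by (simp add: top_profile_def f_def)
    qed
    then show "\<sigma> \<subseteq> {..<n} \<and> p permutes {..<n} \<and> top_profile n K (inv ?Q) = f" using sn p by auto
  qed
  moreover have "finite {(\<sigma>, p). \<sigma> \<subseteq> {..<n} \<and> p permutes {..<n} \<and> top_profile n K (inv (pair_order n \<rho> \<sigma> p)) = f}"
    by (rule finite_subset[of _ "Pow {..<n} \<times> {p. p permutes {..<n}}"]) (auto intro: finite_permutations)
  ultimately have "card (Sg \<times> {p. p permutes {..<n} \<and> (\<forall>t\<in>Ts. p t = g t)}) \<le>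
     card {(\<sigma>, p). \<sigma> \<subseteq> {..<n} \<and> p permutes {..<n} \<and> top_profile n K (inv (pair_order n \<rho> \<sigma> p)) = f}"
    by (intro card_mono)
  then show ?thesis by (simp add: card_cartesian_product cS cP)
qed

text \<open>Each good winning profile forces a win for paired draws too, and by
  \<open>profile_ratio\<close> it keeps a fraction \<open>1 - K^2 / n\<close> of its probability
  under a uniform order. Under a uniform order these profiles have total probability at least
  \<open>half_value n - 24 / K\<close>. Profiles are disjoint events, so summing over them gives the
  bound.\<close>

lemma card_pair_order_win:
  assumes \<rho>: "\<rho> permutes {..<2 * n}" and K: "32 \<le> K" "K\<^sup>2 \<le> n"
    and distinct: "\<And>i. i < n \<Longrightarrow> \<not> (\<rho> i < K \<and> \<rho> (n + i) < K)"
  shows "(1 - (real K)\<^sup>2 / real n) * (half_value n - 24 / real K) * (2 ^ n * fact n) \<le>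
    real (card {(\<sigma>, p). \<sigma> \<subseteq> {..<n} \<and> p permutes {..<n} \<and> rank_win n (pair_order n \<rho> \<sigma> p)})"
proof -
  define c where "c = 1 - (real K)\<^sup>2 / real n"
  define W where "W = {(\<sigma>, p). \<sigma> \<subseteq> {..<n} \<and> p permutes {..<n} \<and> rank_win n (pair_order n \<rho> \<sigma> p)}"
  define G where "G = {q. q permutes {..<2 * n} \<and> rank_win n q \<and> top_good n K (top_profile n K (inv q))}"
  define F where "F = (\<lambda>q. top_profile n K (inv q)) ` G"
  let ?true = "\<lambda>f. {(\<sigma>, p). \<sigma> \<subseteq> {..<n} \<and> p permutes {..<n} \<and> top_profile n K (inv (pair_order n \<rho> \<sigma> p)) = f}"
  let ?ideal = "\<lambda>f. {q. q permutes {..<2 * n} \<and> top_profile n K (inv q) = f}"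
  have Kn: "K \<le> n" using K by (metis le_trans le_square power2_eq_square)
  have n: "0 < n" using K Kn by simp
  have "(real K)\<^sup>2 \<le> real n" using K(2) by (metis of_nat_le_iff of_nat_power)
  then have c: "0 \<le> c" using n by (simp add: c_def)
  have finP: "finite {p. p permutes {..<2 * n}}" "finite {p. p permutes {..<n}}" by (auto intro: finite_permutations)
  have finW: "finite W"
    unfolding W_def by (rule finite_subset[of _ "Pow {..<n} \<times> {p. p permutes {..<n}}"]) (use finP in auto)
  have finG: "finite G" by (rule finite_subset[OF _ finP(1)]) (auto simp: G_def)
  have finF: "finite F" using finG by (simp add: F_def)
  have sub: "?true f \<subseteq> W" if fF: "f \<in> F" for f
  proof clarify
    fix \<sigma> p assume sp: "\<sigma> \<subseteq> {..<n}" "p permutes {..<n}" "f = top_profile n K (inv (pair_order n \<rho> \<sigma> p))"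
    obtain q where q: "q \<in> G" "f = top_profile n K (inv q)" using fF unfolding F_def by blast
    have "rank_win n (pair_order n \<rho> \<sigma> p)"
      by (rule rank_win_determined[of q n _ K]) (use q sp permutes_pair_order[OF \<rho> sp(2)] in \<open>auto simp: G_def\<close>)
    then show "(\<sigma>, p) \<in> W" using sp by (auto simp: W_def)
  qed
  have ratio: "c * (2 ^ n * fact n) * real (card (?ideal f)) \<le> fact (2 * n) * real (card (?true f))" if fF: "f \<in> F" for f
  proof -
    obtain q where q: "q permutes {..<2 * n}" "f = top_profile n K (inv q)" using fF unfolding F_def G_def by blast
    define x where "x = card {j. j < K \<and> f j \<noteq> 0}"
    have "card {j. j < K \<and> f j \<noteq> 0} + card {j. j < K \<and> f j = 0} = card ({j. j < K \<and> f j \<noteq> 0} \<union> {j. j < K \<and> f j = 0})"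
      by (intro card_Un_disjoint[symmetric]) auto
    also have "{j. j < K \<and> f j \<noteq> 0} \<union> {j. j < K \<and> f j = 0} = {..<K}" by auto
    finally have xK: "card {j. j < K \<and> f j = 0} = K - x" "x \<le> K" by (auto simp: x_def)
    have 1: "real (card (?ideal f)) \<le> real n ^ (K - x) * fact (2 * n - K)"
    proof -
      have "real (card (?ideal f)) \<le> real (n ^ card {j. j < K \<and> f j = 0} * fact (2 * n - K))"
        using card_ideal_profile[of K n f] Kn by (intro of_nat_mono) auto
      then show ?thesis using xK by simp
    qed
    have 2: "2 ^ (n - K) * fact (n - x) \<le> real (card (?true f))"
    proof -
      have "real (2 ^ (n - K) * fact (n - x)) \<le> real (card (?true f))"
        using card_pair_profile[OF \<rho> q(1) n Kn distinct] unfolding q(2)[symmetric] x_def by (intro of_nat_mono) auto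
      then show ?thesis by simp
    qed
    have "c * (2 ^ n * fact n) * real (card (?ideal f)) \<le> c * (2 ^ n * fact n) * (real n ^ (K - x) * fact (2 * n - K))"
      using 1 c by (intro mult_left_mono) auto
    also have "\<dots> \<le> 2 ^ (n - K) * fact (n - x) * fact (2 * n)"
      unfolding c_def by (rule profile_ratio) (use xK Kn n c in \<open>auto simp: c_def\<close>)
    also have "\<dots> \<le> real (card (?true f)) * fact (2 * n)" using 2 by (intro mult_right_mono) auto
    finally show ?thesis by (simp add: mult.commute)
  qed
  have W: "(\<Sum>f\<in>F. card (?true f)) \<le> card W"
  proof -
    have "(\<Sum>f\<in>F. card (?true f)) = card (\<Union>f\<in>F. ?true f)"
      using finF sub finite_subset[OF _ finW] by (intro card_UN_disjoint[symmetric]) auto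
    also have "\<dots> \<le> card W" using sub finW by (intro card_mono) blast+
    finally show ?thesis .
  qed
  have Gc: "card G \<le> (\<Sum>f\<in>F. card (?ideal f))"
  proof -
    have "card G \<le> card (\<Union>f\<in>F. ?ideal f)"
      using finF finite_subset[OF _ finP(1)] by (intro card_mono) (auto simp: F_def G_def)
    also have "\<dots> \<le> (\<Sum>f\<in>F. card (?ideal f))" by (rule card_UN_le[OF finF])
    finally show ?thesis .
  qed
  have Gl: "(half_value n - 24 / real K) * fact (2 * n) \<le> real (card G)"
  proof -
    let ?B = "{q. q permutes {..<2 * n} \<and> \<not> top_good n K (top_profile n K (inv q))}"
    have "card {q. q permutes {..<2 * n} \<and> rank_win n q} \<le> card (G \<union> ?B)"
      using finG finite_subset[OF _ finP(1)] by (intro card_mono) (auto simp: G_def)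
    also have "\<dots> \<le> card G + card ?B" by (rule card_Un_le)
    finally have "fact (2 * n) * half_value n \<le> real (card G) + real (card ?B)"
      unfolding card_rank_win[symmetric] by linarith
    then show ?thesis using card_top_bad[of K n] K Kn by (simp add: algebra_simps)
  qed
  have "c * (half_value n - 24 / real K) * (2 ^ n * fact n) * fact (2 * n) \<le> fact (2 * n) * real (card W)"
  proof -
    have "c * (2 ^ n * fact n) * ((half_value n - 24 / real K) * fact (2 * n)) \<le> c * (2 ^ n * fact n) * real (card G)"
      using Gl c by (intro mult_left_mono) auto
    also have "\<dots> \<le> c * (2 ^ n * fact n) * real (\<Sum>f\<in>F. card (?ideal f))"
      using Gc c by (intro mult_left_mono of_nat_mono) auto
    also have "\<dots> = (\<Sum>f\<in>F. c * (2 ^ n * fact n) * real (card (?ideal f)))" by (simp add: sum_distrib_left)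
    also have "\<dots> \<le> (\<Sum>f\<in>F. fact (2 * n) * real (card (?true f)))" using ratio by (intro sum_mono) auto
    also have "\<dots> = fact (2 * n) * real (\<Sum>f\<in>F. card (?true f))" by (simp add: sum_distrib_left)
    also have "\<dots> \<le> fact (2 * n) * real (card W)" using W by (intro mult_left_mono of_nat_mono) auto
    finally show ?thesis by (simp add: mult_ac)
  qed
  then show ?thesis by (simp add: c_def W_def mult.commute)
qed

section \<open>Keys with random tie-breaking\<close>

definition lex_less :: "real \<times> real \<Rightarrow> real \<times> real \<Rightarrow> bool" where
  "lex_less a b \<longleftrightarrow> fst a < fst b \<or> (fst a = fst b \<and> snd a < snd b)"

lemma lex_less_irrefl: "\<not> lex_less a a"
  by (simp add: lex_less_def)

lemma lex_less_trans: "lex_less a b \<Longrightarrow> lex_less b c \<Longrightarrow> lex_less a c"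
  by (auto simp: lex_less_def)

lemma lex_less_total: "a \<noteq> b \<Longrightarrow> lex_less a b \<or> lex_less b a"
  by (auto simp: lex_less_def prod_eq_iff)

lemma lex_less_not_trans: "\<not> lex_less b a \<Longrightarrow> lex_less c a \<Longrightarrow> lex_less c b"
  by (auto simp: lex_less_def)

lemma pred_lex_less[measurable (raw)]:
  assumes [measurable]: "f \<in> M \<rightarrow>\<^sub>M borel \<Otimes>\<^sub>M borel" "g \<in> M \<rightarrow>\<^sub>M borel \<Otimes>\<^sub>M borel"
  shows "Measurable.pred M (\<lambda>x. lex_less (f x) (g x))"
  unfolding lex_less_def by measurable

text \<open>The number of larger keys, so 0 is the largest. Beyond \<open>2 * n\<close> it is the
  identity, as \<open>permutes\<close> demands.\<close>

definition key_rank :: "nat \<Rightarrow> (nat \<Rightarrow> real \<times> real) \<Rightarrow> nat \<Rightarrow> nat" where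
  "key_rank n \<kappa> i = (if i < 2 * n then card {j. j < 2 * n \<and> lex_less (\<kappa> i) (\<kappa> j)} else i)"

lemma key_rank_less_iff:
  assumes "inj_on \<kappa> {..<2 * n}" "i < 2 * n" "j < 2 * n"
  shows "key_rank n \<kappa> i < key_rank n \<kappa> j \<longleftrightarrow> lex_less (\<kappa> j) (\<kappa> i)"
proof -
  have less: "key_rank n \<kappa> i < key_rank n \<kappa> j" if "lex_less (\<kappa> j) (\<kappa> i)" "i < 2 * n" "j < 2 * n" for i j
  proof -
    have "{k. k < 2 * n \<and> lex_less (\<kappa> i) (\<kappa> k)} \<subset> {k. k < 2 * n \<and> lex_less (\<kappa> j) (\<kappa> k)}"
      using that lex_less_trans lex_less_irrefl by blast
    then show ?thesis using that by (simp add: key_rank_def psubset_card_mono)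
  qed
  show ?thesis
  proof (cases "i = j")
    case True
    then show ?thesis by (simp add: lex_less_irrefl)
  next
    case False
    then have "\<kappa> i \<noteq> \<kappa> j" using assms by (auto dest: inj_onD)
    then have "lex_less (\<kappa> j) (\<kappa> i) \<or> lex_less (\<kappa> i) (\<kappa> j)" using lex_less_total by blast
    then show ?thesis using less[of j i] less[of i j] assms by auto
  qed
qed

lemma permutes_key_rank:
  assumes inj: "inj_on \<kappa> {..<2 * n}"
  shows "key_rank n \<kappa> permutes {..<2 * n}"
proof (rule bij_imp_permutes)
  have "inj_on (key_rank n \<kappa>) {..<2 * n}"
  proof (rule inj_onI)
    fix i j assume ij: "i \<in> {..<2 * n}" "j \<in> {..<2 * n}" "key_rank n \<kappa> i = key_rank n \<kappa> j"
    then have "\<not> lex_less (\<kappa> j) (\<kappa> i)" "\<not> lex_less (\<kappa> i) (\<kappa> j)"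
      using key_rank_less_iff[OF inj, of i j] key_rank_less_iff[OF inj, of j i] by auto
    then have "\<kappa> i = \<kappa> j" using lex_less_total by blast
    then show "i = j" using inj ij by (auto dest: inj_onD)
  qed
  moreover have "key_rank n \<kappa> ` {..<2 * n} \<subseteq> {..<2 * n}"
  proof (rule image_subsetI)
    fix i assume i: "i \<in> {..<2 * n}"
    have "{j. j < 2 * n \<and> lex_less (\<kappa> i) (\<kappa> j)} \<subset> {..<2 * n}"
      using i lex_less_irrefl by blast
    then have "card {j. j < 2 * n \<and> lex_less (\<kappa> i) (\<kappa> j)} < card {..<2 * n}" by (intro psubset_card_mono) auto
    then show "key_rank n \<kappa> i \<in> {..<2 * n}" using i by (simp add: key_rank_def)
  qed
  ultimately show "bij_betw (key_rank n \<kappa>) {..<2 * n} {..<2 * n}"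
    by (simp add: bij_betw_def endo_inj_surj)
qed (simp add: key_rank_def)

definition pair_swap :: "nat \<Rightarrow> nat set \<Rightarrow> nat \<Rightarrow> nat" where
  "pair_swap n \<sigma> i = (if i < n \<and> i \<in> \<sigma> then n + i else if n \<le> i \<and> i < 2 * n \<and> i - n \<in> \<sigma> then i - n else i)"

lemma pair_swap_swap: "pair_swap n \<sigma> (pair_swap n \<sigma> i) = i"
  by (auto simp: pair_swap_def)

lemma pair_swap_less: "pair_swap n \<sigma> i < 2 * n \<longleftrightarrow> i < 2 * n"
  by (auto simp: pair_swap_def)

lemma key_rank_swap: "key_rank n (\<lambda>i\<in>{..<2 * n}. \<kappa> (pair_swap n \<sigma> i)) i = (if i < 2 * n then key_rank n \<kappa> (pair_swap n \<sigma> i) else i)"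
proof -
  have "card {j. j < 2 * n \<and> lex_less a (\<kappa> (pair_swap n \<sigma> j))} = card {j. j < 2 * n \<and> lex_less a (\<kappa> j)}" for a
  proof (rule bij_betw_same_card[where f = "pair_swap n \<sigma>"])
    show "bij_betw (pair_swap n \<sigma>) {j. j < 2 * n \<and> lex_less a (\<kappa> (pair_swap n \<sigma> j))} {j. j < 2 * n \<and> lex_less a (\<kappa> j)}"
      by (rule bij_betw_byWitness[where f' = "pair_swap n \<sigma>"]) (auto simp: pair_swap_swap pair_swap_less)
  qed
  moreover have "{j. j < 2 * n \<and> lex_less a ((\<lambda>i\<in>{..<2 * n}. \<kappa> (pair_swap n \<sigma> i)) j)} =
      {j. j < 2 * n \<and> lex_less a (\<kappa> (pair_swap n \<sigma> j))}" for a by auto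
  ultimately show ?thesis by (simp add: key_rank_def pair_swap_less)
qed

text \<open>Physically exchanging the draws of the pairs in \<sigma> is the same as leaving the keys
  in place and reversing the roles in those pairs. Invariance of the law thereby becomes an average
  over \<sigma>.\<close>

lemma pair_order_swap:
  assumes p: "p permutes {..<n}"
  shows "pair_order n (key_rank n (\<lambda>i\<in>{..<2 * n}. \<kappa> (pair_swap n \<sigma> i))) {} p = pair_order n (key_rank n \<kappa>) \<sigma> p"
proof
  fix t
  have "p (t - n) < n" if "t < 2 * n" using permutes_in_image[OF p, of "t - n"] that by simp
  then show "pair_order n (key_rank n (\<lambda>i\<in>{..<2 * n}. \<kappa> (pair_swap n \<sigma> i))) {} p t = pair_order n (key_rank n \<kappa>) \<sigma> p t"
    unfolding pair_order_def key_rank_swap by (auto simp: pair_swap_def)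
qed

text \<open>\<open>half_rule\<close> on the samples followed by the arrivals, with ties broken by
  coordinates of the seed. An arrival takes the coordinate of its time, since the algorithm does not
  learn which variable has been revealed.\<close>

definition sample_rule :: "(nat \<Rightarrow> real) \<Rightarrow> real list \<Rightarrow> real list \<Rightarrow> bool" where
  "sample_rule \<omega> ys h \<longleftrightarrow> h \<noteq> [] \<and>
     (\<forall>i<length h - 1. lex_less (h ! i, \<omega> (length ys + i)) (last h, \<omega> (length ys + (length h - 1)))) \<and>
     accept_rank (length ys) (length h - 1)
       (Suc (card {i. i < length ys \<and> lex_less (last h, \<omega> (length ys + (length h - 1))) (ys ! i, \<omega> i)}))"

definition key_win :: "nat \<Rightarrow> (nat \<Rightarrow> nat) \<Rightarrow> (nat \<Rightarrow> real \<times> real) \<Rightarrow> bool" where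
  "key_win n p \<kappa> \<longleftrightarrow> rank_win n (pair_order n (key_rank n \<kappa>) {} p)"

text \<open>The value arriving at time \<open>t\<close> carries the tie-breaker \<open>\<omega> (n + t)\<close>; re-indexed by pairs this
  is \<open>\<omega> (n + inv p i)\<close>.\<close>

definition keys :: "nat \<Rightarrow> (nat \<Rightarrow> nat) \<Rightarrow> (nat \<Rightarrow> real) \<Rightarrow> (nat \<Rightarrow> real) \<Rightarrow> (nat \<Rightarrow> real) \<Rightarrow> nat \<Rightarrow> real \<times> real" where
  "keys n p \<omega> y x = (\<lambda>i\<in>{..<2 * n}. (if i < n then y i else x (i - n), \<omega> (if i < n then i else n + inv p (i - n))))"

text \<open>Keys refine the order of the values, so the arrival with the largest key has the largest
  value. Only an implication is claimed: under ties the rule may accept a largest value whose key is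
  not the largest.\<close>

lemma accepts_max_if_key_win:
  assumes p: "p permutes {..<n}" and inj: "inj_on (keys n p \<omega> y x) {..<2 * n}"
    and win: "key_win n p (keys n p \<omega> y x)"
  shows "accepts_max (sample_rule \<omega> (map y [0..<n])) 0 (map (\<lambda>t. x (p t)) [0..<n])"
proof -
  define \<kappa> where "\<kappa> = keys n p \<omega> y x"
  define q where "q = pair_order n (key_rank n \<kappa>) {} p"
  have pn: "p t < n" if "t < n" for t using permutes_in_image[OF p, of t] that by simp
  have \<kappa>Y: "\<kappa> i = (y i, \<omega> i)" if "i < n" for i using that by (simp add: \<kappa>_def keys_def)
  have \<kappa>X: "\<kappa> (n + p t) = (x (p t), \<omega> (n + t))" if "t < n" for t
    using pn[OF that] permutes_inverses(2)[OF p] by (simp add: \<kappa>_def keys_def)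
  have qY: "q i = key_rank n \<kappa> i" if "i < n" for i using that by (simp add: q_def pair_order_def)
  have qX: "q (n + t) = key_rank n \<kappa> (n + p t)" if "t < n" for t using that by (simp add: q_def pair_order_def)
  have XX: "q (n + t) < q (n + s) \<longleftrightarrow> lex_less (x (p s), \<omega> (n + s)) (x (p t), \<omega> (n + t))" if "s < n" "t < n" for s t
    using key_rank_less_iff[of \<kappa> n "n + p t" "n + p s"] inj that pn[of s] pn[of t] by (simp add: qX \<kappa>X \<kappa>_def[symmetric])
  have YX: "q i < q (n + t) \<longleftrightarrow> lex_less (x (p t), \<omega> (n + t)) (y i, \<omega> i)" if "i < n" "t < n" for i t
    using key_rank_less_iff[of \<kappa> n i "n + p t"] inj that pn[of t] by (simp add: qX qY \<kappa>X \<kappa>Y \<kappa>_def[symmetric])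
  let ?xs = "map (\<lambda>t. x (p t)) [0..<n]" and ?A = "sample_rule \<omega> (map y [0..<n])"
  have rule: "?A (take (Suc t) ?xs) \<longleftrightarrow>
      (\<forall>u<t. q (n + t) < q (n + u)) \<and> accept_rank n t (Suc (best_samples n q (q (n + t))))" if t: "t < n" for t
  proof -
    have tk: "take (Suc t) ?xs = map (\<lambda>t. x (p t)) [0..<Suc t]" using t by (simp add: take_map take_upt)
    have lst: "last (map (\<lambda>t. x (p t)) [0..<Suc t]) = x (p t)" by simp
    have nth: "map (\<lambda>t. x (p t)) [0..<Suc t] ! i = x (p i)" if "i \<le> t" for i using that by (simp del: upt_Suc)
    have "{i. i < n \<and> lex_less (x (p t), \<omega> (n + t)) (map y [0..<n] ! i, \<omega> i)} = {i. i < n \<and> q i < q (n + t)}"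
      using YX t by auto
    moreover have "(\<forall>i<t. lex_less (map (\<lambda>t. x (p t)) [0..<Suc t] ! i, \<omega> (n + i)) (x (p t), \<omega> (n + t))) \<longleftrightarrow>
        (\<forall>u<t. q (n + t) < q (n + u))"
      using XX t nth by (simp del: upt_Suc)
    ultimately show ?thesis
      unfolding sample_rule_def tk lst best_samples_def by (simp del: upt_Suc)
  qed
  obtain t where t: "t < n" "\<forall>s<n. s \<noteq> t \<longrightarrow> q (n + t) < q (n + s)"
     "accept_rank n t (Suc (best_samples n q (q (n + t))))"
     "\<forall>s<t. (\<forall>u<s. q (n + s) < q (n + u)) \<longrightarrow> \<not> accept_rank n s (Suc (best_samples n q (q (n + s))))"
    using win unfolding key_win_def rank_win_def \<kappa>_def[symmetric] q_def[symmetric] by blast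
  have "?A (take (Suc t) ?xs)" unfolding rule[OF t(1)] using t by auto
  moreover have "\<not> ?A (take (Suc s) ?xs)" if "s < t" for s
    using rule[of s] t(1,4) that by auto
  ultimately have "accepts_at ?A 0 ?xs t" using t(1) by (simp add: accepts_at_def)
  moreover have "?xs ! t = Max (set (drop 0 ?xs))"
  proof -
    have le: "x (p s) \<le> x (p t)" if "s < n" for s
    proof (cases "s = t")
      case False
      then have "lex_less (x (p s), \<omega> (n + s)) (x (p t), \<omega> (n + t))" using t(1,2) that XX by blast
      then show ?thesis by (auto simp: lex_less_def)
    qed simp
    have "Max (set (drop 0 ?xs)) = x (p t)" using le t(1) by (intro Max_eqI) auto
    then show ?thesis using t(1) by simp
  qed
  ultimately show ?thesis unfolding accepts_max_def by blast
qed

subsection \<open>Measurability\<close>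

abbreviation unif01 :: "real measure" where
  "unif01 \<equiv> uniform_measure lborel {0..1}"

lemma prob_space_unif01: "prob_space unif01"
  by (rule prob_space_uniform_measure) auto

lemma sets_unif01[simp, measurable_cong]: "sets unif01 = sets borel"
  by simp

lemma measurable_seed_component[measurable]: "(\<lambda>\<omega>. \<omega> i) \<in> seed \<rightarrow>\<^sub>M borel"
proof -
  have "(\<lambda>\<omega>. \<omega> i) \<in> seed \<rightarrow>\<^sub>M unif01" unfolding seed_def by (rule measurable_component_singleton) simp
  then show ?thesis by (simp cong: measurable_cong_sets)
qed

lemma pred_accept_rank[measurable (raw)]:
  assumes "f \<in> M \<rightarrow>\<^sub>M count_space UNIV"
  shows "Measurable.pred M (\<lambda>x. accept_rank n t (f x))"
  using assms by (rule measurable_compose) simp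

text \<open>Stated for arbitrary coordinate maps, so as to serve both
  \<open>single_sample_algorithm\<close> and the success event with reordered arrivals.\<close>

lemma pred_sample_rule:
  assumes [measurable]: "\<And>i. (\<lambda>z. W z i) \<in> M \<rightarrow>\<^sub>M borel"
    "\<And>i. i < n \<Longrightarrow> (\<lambda>z. Y z i) \<in> M \<rightarrow>\<^sub>M borel" "\<And>i. i < t \<Longrightarrow> (\<lambda>z. H z i) \<in> M \<rightarrow>\<^sub>M borel"
  shows "Measurable.pred M (\<lambda>z. sample_rule (W z) (map (Y z) [0..<n]) (map (H z) [0..<t]))"
proof (cases t)
  case 0
  then show ?thesis by (simp add: sample_rule_def)
next
  case (Suc k)
  have [measurable]: "(\<lambda>z. H z k) \<in> M \<rightarrow>\<^sub>M borel" using assms(3)[of k] Suc by simp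
  have eq: "sample_rule (W z) (map (Y z) [0..<n]) (map (H z) [0..<t]) \<longleftrightarrow>
      (\<forall>i\<in>{..<k}. lex_less (H z i, W z (n + i)) (H z k, W z (n + k))) \<and>
      accept_rank n k (Suc (card {i \<in> {..<n}. lex_less (H z k, W z (n + k)) (Y z i, W z i)}))" for z
  proof -
    have "{i. i < n \<and> lex_less a (map (Y z) [0..<n] ! i, W z i)} = {i \<in> {..<n}. lex_less a (Y z i, W z i)}" for a by auto
    moreover have "map (H z) [0..<Suc k] ! i = H z i" if "i < k" for i using that by (simp del: upt_Suc)
    moreover have "last (map (H z) [0..<Suc k]) = H z k" by simp
    ultimately show ?thesis unfolding sample_rule_def Suc by (simp add: Ball_def del: upt_Suc)
  qed
  have [measurable]: "Measurable.pred M (\<lambda>z. lex_less (H z i, W z (n + i)) (H z k, W z (n + k)))" if "i \<in> {..<k}" for i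
  proof -
    have [measurable]: "(\<lambda>z. H z i) \<in> M \<rightarrow>\<^sub>M borel" using assms(3)[of i] Suc that by simp
    show ?thesis by measurable
  qed
  have [measurable]: "(\<lambda>z. card {i \<in> {..<n}. lex_less (H z k, W z (n + k)) (Y z i, W z i)}) \<in> M \<rightarrow>\<^sub>M count_space UNIV"
  proof (rule measurable_card)
    fix i
    show "{z \<in> space M. i \<in> {i \<in> {..<n}. lex_less (H z k, W z (n + k)) (Y z i, W z i)}} \<in> sets M"
    proof (cases "i < n")
      case True
      have [measurable]: "(\<lambda>z. Y z i) \<in> M \<rightarrow>\<^sub>M borel" using assms(2) True by simp
      show ?thesis using True by simp
    qed simp
  qed
  show ?thesis unfolding eq by measurable
qed

lemma single_sample_algorithm_sample_rule: "single_sample_algorithm sample_rule"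
  unfolding single_sample_algorithm_def
proof (intro allI)
  fix n t :: nat
  let ?M = "seed \<Otimes>\<^sub>M (\<Pi>\<^sub>M i\<in>{..<n}. borel) \<Otimes>\<^sub>M (\<Pi>\<^sub>M i\<in>{..<t}. borel)"
  have "Measurable.pred ?M (\<lambda>z. sample_rule (fst z) (map (fst (snd z)) [0..<n]) (map (snd (snd z)) [0..<t]))"
    by (rule pred_sample_rule) measurable
  then show "Measurable.pred ?M (\<lambda>(\<omega>, y, h). sample_rule \<omega> (map y [0..<n]) (map h [0..<t]))"
    by (simp add: case_prod_beta)
qed

lemma measurable_key_rank[measurable (raw)]:
  assumes "\<And>i. i < 2 * n \<Longrightarrow> (\<lambda>z. F z i) \<in> M \<rightarrow>\<^sub>M borel \<Otimes>\<^sub>M borel"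
  shows "(\<lambda>z. key_rank n (F z) i) \<in> M \<rightarrow>\<^sub>M count_space UNIV"
proof (cases "i < 2 * n")
  case True
  have "(\<lambda>z. card {j. j < 2 * n \<and> lex_less (F z i) (F z j)}) \<in> M \<rightarrow>\<^sub>M count_space UNIV"
  proof (rule measurable_card)
    fix j
    show "{z \<in> space M. j \<in> {j. j < 2 * n \<and> lex_less (F z i) (F z j)}} \<in> sets M"
    proof (cases "j < 2 * n")
      case j: True
      have [measurable]: "(\<lambda>z. F z i) \<in> M \<rightarrow>\<^sub>M borel \<Otimes>\<^sub>M borel" "(\<lambda>z. F z j) \<in> M \<rightarrow>\<^sub>M borel \<Otimes>\<^sub>M borel"
        using assms True j by auto
      show ?thesis using j by simp
    qed simp
  qed
  then show ?thesis by (simp only: key_rank_def True if_True)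
qed (simp add: key_rank_def)

lemma pred_nat_less[measurable (raw)]:
  fixes f g :: "'a \<Rightarrow> nat"
  assumes [measurable]: "f \<in> M \<rightarrow>\<^sub>M count_space UNIV" "g \<in> M \<rightarrow>\<^sub>M count_space UNIV"
  shows "Measurable.pred M (\<lambda>x. f x < g x)"
proof -
  have *: "(\<lambda>x. f x < g x) = (\<lambda>x. \<exists>a. f x = a \<and> (\<exists>b. g x = b \<and> a < b))" by auto
  show ?thesis unfolding * by measurable
qed

lemma pred_rank_win:
  assumes [measurable]: "\<And>i. (\<lambda>z. Q z i) \<in> M \<rightarrow>\<^sub>M count_space (UNIV :: nat set)"
  shows "Measurable.pred M (\<lambda>z. rank_win n (Q z))"
proof -
  have [measurable]: "(\<lambda>z. best_samples n (Q z) (Q z j)) \<in> M \<rightarrow>\<^sub>M count_space UNIV" for j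
    unfolding best_samples_def
  proof (rule measurable_card)
    fix i
    show "{z \<in> space M. i \<in> {i. i < n \<and> Q z i < Q z j}} \<in> sets M" by simp
  qed
  show ?thesis unfolding rank_win_def by measurable
qed

lemma pred_pair_order_win:
  assumes F: "\<And>i. i < 2 * n \<Longrightarrow> (\<lambda>z. F z i) \<in> M \<rightarrow>\<^sub>M borel \<Otimes>\<^sub>M borel"
  shows "Measurable.pred M (\<lambda>z. rank_win n (pair_order n (key_rank n (F z)) \<sigma> p))"
proof (rule pred_rank_win)
  have [measurable]: "(\<lambda>z. key_rank n (F z) i) \<in> M \<rightarrow>\<^sub>M count_space UNIV" for i
    by (rule measurable_key_rank[OF F])
  show "(\<lambda>z. pair_order n (key_rank n (F z)) \<sigma> p i) \<in> M \<rightarrow>\<^sub>M count_space UNIV" for i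
    unfolding pair_order_def by (cases "i < n"; cases "i < 2 * n") auto
qed

section \<open>The law of the keys\<close>

text \<open>A product law is determined on boxes, but the sides \<open>E i\<close> are arbitrary
  measurable sets of pairs. The indicator of a box is a product over the coordinates, so integrating
  out all first components and then all second ones reduces the claim to Fubini in each coordinate.
  The pair is reversed because the seed comes first in \<open>base\<close>.\<close>

lemma distr_PiM_pair:
  assumes fin: "finite I" and A: "\<And>i. prob_space (A i)" and B: "\<And>i. prob_space (B i)"
  shows "distr (PiM I B \<Otimes>\<^sub>M PiM I A) (PiM I (\<lambda>i. A i \<Otimes>\<^sub>M B i)) (\<lambda>(g, f). \<lambda>i\<in>I. (f i, g i)) =
    PiM I (\<lambda>i. A i \<Otimes>\<^sub>M B i)"
proof -
  interpret A: product_sigma_finite A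
    by (intro product_sigma_finite.intro prob_space_imp_sigma_finite A)
  interpret B: product_sigma_finite B
    by (intro product_sigma_finite.intro prob_space_imp_sigma_finite B)
  have AB: "prob_space (A i \<Otimes>\<^sub>M B i)" for i using A B by (intro prob_space_pair)
  interpret AB: product_sigma_finite "\<lambda>i. A i \<Otimes>\<^sub>M B i"
    by (intro product_sigma_finite.intro prob_space_imp_sigma_finite AB)
  interpret PA: prob_space "PiM I A" using A by (intro prob_space_PiM) auto
  let ?T = "\<lambda>(g, f). \<lambda>i\<in>I. (f i, g i)"
  have T: "?T \<in> PiM I B \<Otimes>\<^sub>M PiM I A \<rightarrow>\<^sub>M PiM I (\<lambda>i. A i \<Otimes>\<^sub>M B i)"
    unfolding case_prod_beta by (intro measurable_restrict) measurable
  show ?thesis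
  proof (rule AB.PiM_eqI[OF fin])
    fix E assume E[measurable]: "\<And>i. i \<in> I \<Longrightarrow> E i \<in> sets (A i \<Otimes>\<^sub>M B i)"
    have EP: "Pi\<^sub>E I E \<in> sets (PiM I (\<lambda>i. A i \<Otimes>\<^sub>M B i))" using E fin by (intro sets_PiM_I_finite) auto
    let ?f = "\<lambda>i a b. indicator (E i) (a, b) :: ennreal"
    have "emeasure (distr (PiM I B \<Otimes>\<^sub>M PiM I A) (PiM I (\<lambda>i. A i \<Otimes>\<^sub>M B i)) ?T) (Pi\<^sub>E I E) =
        (\<integral>\<^sup>+ z. indicator (Pi\<^sub>E I E) z \<partial>distr (PiM I B \<Otimes>\<^sub>M PiM I A) (PiM I (\<lambda>i. A i \<Otimes>\<^sub>M B i)) ?T)"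
      using EP by simp
    also have "\<dots> = (\<integral>\<^sup>+ z. indicator (Pi\<^sub>E I E) (?T z) \<partial>(PiM I B \<Otimes>\<^sub>M PiM I A))"
      using T EP by (intro nn_integral_distr) auto
    also have "\<dots> = (\<integral>\<^sup>+ z. (\<Prod>i\<in>I. ?f i (snd z i) (fst z i)) \<partial>(PiM I B \<Otimes>\<^sub>M PiM I A))"
    proof (intro nn_integral_cong)
      fix z
      have "?T z \<in> Pi\<^sub>E I E \<longleftrightarrow> (\<forall>i\<in>I. (snd z i, fst z i) \<in> E i)" by (auto simp: case_prod_beta PiE_iff)
      moreover have "(\<Prod>i\<in>I. ?f i (snd z i) (fst z i)) = (if \<forall>i\<in>I. (snd z i, fst z i) \<in> E i then 1 else 0)"
        using fin by (auto simp: indicator_def)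
      ultimately show "indicator (Pi\<^sub>E I E) (?T z) = (\<Prod>i\<in>I. ?f i (snd z i) (fst z i))"
        by (simp add: indicator_def)
    qed
    also have "\<dots> = (\<integral>\<^sup>+ g. \<integral>\<^sup>+ f. (\<Prod>i\<in>I. ?f i (f i) (g i)) \<partial>PiM I A \<partial>PiM I B)"
    proof (subst PA.nn_integral_fst[symmetric])
      have "(\<lambda>z. ?f i (snd z i) (fst z i)) \<in> borel_measurable (PiM I B \<Otimes>\<^sub>M PiM I A)" if i: "i \<in> I" for i
      proof -
        have [measurable]: "(\<lambda>z. (snd z i, fst z i)) \<in> PiM I B \<Otimes>\<^sub>M PiM I A \<rightarrow>\<^sub>M A i \<Otimes>\<^sub>M B i"
          using i by measurable
        show ?thesis using E[OF i] by measurable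
      qed
      then show "(\<lambda>z. \<Prod>i\<in>I. ?f i (snd z i) (fst z i)) \<in> borel_measurable (PiM I B \<Otimes>\<^sub>M PiM I A)"
        by (rule borel_measurable_prod_ennreal)
    qed simp
    also have "\<dots> = (\<integral>\<^sup>+ g. (\<Prod>i\<in>I. \<integral>\<^sup>+ a. ?f i a (g i) \<partial>A i) \<partial>PiM I B)"
    proof (intro nn_integral_cong A.product_nn_integral_prod[OF fin])
      fix g i assume g: "g \<in> space (PiM I B)" and i: "i \<in> I"
      have gi: "g i \<in> space (B i)" using g i by (auto simp: space_PiM)
      have "(\<lambda>a. (a, g i)) \<in> A i \<rightarrow>\<^sub>M A i \<Otimes>\<^sub>M B i" using gi by measurable
      then show "(\<lambda>a. ?f i a (g i)) \<in> borel_measurable (A i)"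
        using E[OF i] by measurable
    qed
    also have "\<dots> = (\<Prod>i\<in>I. \<integral>\<^sup>+ b. \<integral>\<^sup>+ a. ?f i a b \<partial>A i \<partial>B i)"
    proof (rule B.product_nn_integral_prod[OF fin])
      fix i assume i: "i \<in> I"
      have "(\<lambda>z. ?f i (snd z) (fst z)) \<in> borel_measurable (B i \<Otimes>\<^sub>M A i)"
        using E[OF i] by measurable
      then show "(\<lambda>b. \<integral>\<^sup>+ a. ?f i a b \<partial>A i) \<in> borel_measurable (B i)"
        using sigma_finite_measure.borel_measurable_nn_integral_fst[OF prob_space_imp_sigma_finite[OF A], of "\<lambda>z. ?f i (snd z) (fst z)" "B i"] by simp
    qed
    also have "\<dots> = (\<Prod>i\<in>I. emeasure (A i \<Otimes>\<^sub>M B i) (E i))"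
    proof (intro prod.cong refl)
      fix i assume i: "i \<in> I"
      interpret P: pair_sigma_finite "A i" "B i"
        by (intro pair_sigma_finite.intro prob_space_imp_sigma_finite A B)
      show "(\<integral>\<^sup>+ b. \<integral>\<^sup>+ a. ?f i a b \<partial>A i \<partial>B i) = emeasure (A i \<Otimes>\<^sub>M B i) (E i)"
        using P.nn_integral_snd[of "indicator (E i)"] E[OF i] by simp
    qed
    finally show "emeasure (distr (PiM I B \<Otimes>\<^sub>M PiM I A) (PiM I (\<lambda>i. A i \<Otimes>\<^sub>M B i)) ?T) (Pi\<^sub>E I E) =
        (\<Prod>i\<in>I. emeasure (A i \<Otimes>\<^sub>M B i) (E i))" .
  qed simp
qed

lemma prod_lessThan_double:
  fixes f :: "nat \<Rightarrow> 'a::comm_monoid_mult"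
  shows "(\<Prod>i<2 * n. f i) = (\<Prod>i<n. f i) * (\<Prod>i<n. f (n + i))"
proof -
  have "{..<2 * n} = {..<n} \<union> (\<lambda>i. n + i) ` {..<n}"
  proof (intro equalityI subsetI)
    fix i assume "i \<in> {..<2 * n}"
    then have "i < n \<or> (i = n + (i - n) \<and> i - n < n)" by auto
    then show "i \<in> {..<n} \<union> (\<lambda>i. n + i) ` {..<n}" by blast
  qed auto
  moreover have "(\<Prod>i\<in>{..<n} \<union> (\<lambda>i. n + i) ` {..<n}. f i) = (\<Prod>i<n. f i) * (\<Prod>i\<in>(\<lambda>i. n + i) ` {..<n}. f i)"
    by (intro prod.union_disjoint) auto
  ultimately show ?thesis by (simp add: prod.reindex)
qed

text \<open>\<open>single_sample_success\<close> nests its pairs to the right;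
  \<open>measure_pair_uniform_count\<close> needs the arrival order split off as the last
  factor.\<close>

lemma measure_reassoc:
  assumes A: "prob_space A" and B: "prob_space B" and C: "prob_space C" and U: "prob_space U"
    and E: "Measurable.pred ((A \<Otimes>\<^sub>M (B \<Otimes>\<^sub>M C)) \<Otimes>\<^sub>M U) (\<lambda>((a, b, c), u). E a b c u)"
  shows "\<P>((a, b, c, u) in A \<Otimes>\<^sub>M (B \<Otimes>\<^sub>M (C \<Otimes>\<^sub>M U)). E a b c u) =
    \<P>(z in (A \<Otimes>\<^sub>M (B \<Otimes>\<^sub>M C)) \<Otimes>\<^sub>M U. case z of (v, u) \<Rightarrow> (case v of (a, b, c) \<Rightarrow> E a b c u))"
proof -
  interpret A: prob_space A by fact
  interpret B: prob_space B by fact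
  interpret C: prob_space C by fact
  interpret U: prob_space U by fact
  interpret BC: prob_space "B \<Otimes>\<^sub>M C" using B C by (rule prob_space_pair)
  interpret CU: prob_space "C \<Otimes>\<^sub>M U" using C U by (rule prob_space_pair)
  interpret BCU: prob_space "B \<Otimes>\<^sub>M (C \<Otimes>\<^sub>M U)" using B CU.prob_space_axioms by (rule prob_space_pair)
  let ?L = "A \<Otimes>\<^sub>M (B \<Otimes>\<^sub>M (C \<Otimes>\<^sub>M U))" and ?R = "(A \<Otimes>\<^sub>M (B \<Otimes>\<^sub>M C)) \<Otimes>\<^sub>M U"
  define f where "f a b c u = (if E a b c u then 1 else 0 :: ennreal)" for a b c u
  have R[measurable]: "(\<lambda>((a, b, c), u). f a b c u) \<in> borel_measurable ?R"
    unfolding f_def case_prod_beta using E unfolding case_prod_beta by measurable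
  have L[measurable]: "(\<lambda>(a, b, c, u). f a b c u) \<in> borel_measurable ?L"
  proof -
    have "(\<lambda>(a, b, c, u). ((a, b, c), u)) \<in> ?L \<rightarrow>\<^sub>M ?R" unfolding case_prod_beta by measurable
    from measurable_compose[OF this R] show ?thesis by (simp add: case_prod_beta)
  qed
  have Lp: "Measurable.pred ?L (\<lambda>(a, b, c, u). E a b c u)"
  proof -
    have "(\<lambda>(a, b, c, u). ((a, b, c), u)) \<in> ?L \<rightarrow>\<^sub>M ?R" unfolding case_prod_beta by measurable
    from measurable_compose[OF this E] show ?thesis by (simp add: case_prod_beta)
  qed
  have ind: "emeasure M {z \<in> space M. P z} = (\<integral>\<^sup>+ z. (if P z then 1 else 0) \<partial>M)" if "Measurable.pred M P" for M :: "'z measure" and P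
  proof -
    have "(\<integral>\<^sup>+ z. (if P z then 1 else 0) \<partial>M) = (\<integral>\<^sup>+ z. indicator {z \<in> space M. P z} z \<partial>M)"
      by (intro nn_integral_cong) auto
    also have "\<dots> = emeasure M {z \<in> space M. P z}" using that by (intro nn_integral_indicator) (simp add: pred_def)
    finally show ?thesis by simp
  qed
  have eL: "emeasure ?L {z \<in> space ?L. case z of (a, b, c, u) \<Rightarrow> E a b c u} = (\<integral>\<^sup>+ z. (case z of (a, b, c, u) \<Rightarrow> f a b c u) \<partial>?L)"
    unfolding ind[OF Lp] by (intro nn_integral_cong) (simp add: f_def split: prod.splits)
  have E': "Measurable.pred ?R (\<lambda>z. case z of ((a, b, c), u) \<Rightarrow> E a b c u)"
    using E by (simp add: case_prod_beta')
  have eR: "emeasure ?R {z \<in> space ?R. case z of ((a, b, c), u) \<Rightarrow> E a b c u} = (\<integral>\<^sup>+ z. (case z of ((a, b, c), u) \<Rightarrow> f a b c u) \<partial>?R)"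
    unfolding ind[OF E'] by (intro nn_integral_cong) (simp add: f_def split: prod.splits)
  have "(\<integral>\<^sup>+ z. (case z of (a, b, c, u) \<Rightarrow> f a b c u) \<partial>?L) = (\<integral>\<^sup>+ a. \<integral>\<^sup>+ v. (case v of (b, c, u) \<Rightarrow> f a b c u) \<partial>(B \<Otimes>\<^sub>M (C \<Otimes>\<^sub>M U)) \<partial>A)"
    by (subst BCU.nn_integral_fst[symmetric]) auto
  also have "\<dots> = (\<integral>\<^sup>+ a. \<integral>\<^sup>+ b. \<integral>\<^sup>+ v. (case v of (c, u) \<Rightarrow> f a b c u) \<partial>(C \<Otimes>\<^sub>M U) \<partial>B \<partial>A)"
    by (intro nn_integral_cong, subst CU.nn_integral_fst[symmetric]) (use measurable_compose[OF measurable_Pair1' L] in auto)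
  also have "\<dots> = (\<integral>\<^sup>+ a. \<integral>\<^sup>+ b. \<integral>\<^sup>+ c. \<integral>\<^sup>+ u. f a b c u \<partial>U \<partial>C \<partial>B \<partial>A)"
  proof (intro nn_integral_cong, subst U.nn_integral_fst[symmetric])
    fix a b assume ab: "a \<in> space A" "b \<in> space B"
    have "(\<lambda>v. (a, b, v)) \<in> C \<Otimes>\<^sub>M U \<rightarrow>\<^sub>M ?L" using ab by measurable
    from measurable_compose[OF this L] show "(\<lambda>v. case v of (c, u) \<Rightarrow> f a b c u) \<in> borel_measurable (C \<Otimes>\<^sub>M U)"
      by (simp add: case_prod_beta)
  qed simp
  also have "\<dots> = (\<integral>\<^sup>+ a. \<integral>\<^sup>+ v. \<integral>\<^sup>+ u. f a (fst v) (snd v) u \<partial>U \<partial>(B \<Otimes>\<^sub>M C) \<partial>A)"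
  proof (intro nn_integral_cong, subst C.nn_integral_fst[symmetric])
    fix a assume a: "a \<in> space A"
    have "(\<lambda>z. ((a, fst z), snd z)) \<in> (B \<Otimes>\<^sub>M C) \<Otimes>\<^sub>M U \<rightarrow>\<^sub>M ?R" using a by measurable
    from measurable_compose[OF this R] have "(\<lambda>z. f a (fst (fst z)) (snd (fst z)) (snd z)) \<in> borel_measurable ((B \<Otimes>\<^sub>M C) \<Otimes>\<^sub>M U)"
      by (simp add: case_prod_beta)
    from U.borel_measurable_nn_integral_fst[OF this]
    show "(\<lambda>v. \<integral>\<^sup>+ u. f a (fst v) (snd v) u \<partial>U) \<in> borel_measurable (B \<Otimes>\<^sub>M C)" by simp
  qed simp
  also have "\<dots> = (\<integral>\<^sup>+ v. \<integral>\<^sup>+ u. (case (v, u) of ((a, b, c), u) \<Rightarrow> f a b c u) \<partial>U \<partial>(A \<Otimes>\<^sub>M (B \<Otimes>\<^sub>M C)))"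
    by (subst BC.nn_integral_fst[symmetric]) (use U.borel_measurable_nn_integral_fst[OF R] in \<open>auto simp: case_prod_beta\<close>)
  also have "\<dots> = (\<integral>\<^sup>+ z. (case z of ((a, b, c), u) \<Rightarrow> f a b c u) \<partial>?R)"
    using U.nn_integral_fst[OF R] by (simp add: case_prod_beta')
  finally have "emeasure ?L {z \<in> space ?L. case z of (a, b, c, u) \<Rightarrow> E a b c u} = emeasure ?R {z \<in> space ?R. case z of ((a, b, c), u) \<Rightarrow> E a b c u}"
    unfolding eL eR .
  then have "measure ?L {z \<in> space ?L. case z of (a, b, c, u) \<Rightarrow> E a b c u} = measure ?R {z \<in> space ?R. case z of ((a, b, c), u) \<Rightarrow> E a b c u}"
    by (simp add: measure_def)
  moreover have "{(a, b, c, u). (a, b, c, u) \<in> space ?L \<and> E a b c u} = {z \<in> space ?L. case z of (a, b, c, u) \<Rightarrow> E a b c u}" by auto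
  ultimately show ?thesis by simp
qed

lemma unif01_singleton: "emeasure unif01 {b} = 0"
proof -
  have "emeasure lborel ({0..1} \<inter> {b}) \<le> emeasure lborel {b :: real}" by (intro emeasure_mono) auto
  then show ?thesis by (simp add: emeasure_uniform_measure)
qed

text \<open>Taking logarithms, \<open>ln (1 - q)\<close> lies between \<open>- 2 * q\<close> and
  \<open>- q\<close> for \<open>q\<close> in [0, 1/2].\<close>

lemma sum_bounds_of_prod:
  fixes q :: "nat \<Rightarrow> real"
  assumes q: "\<And>i. i < n \<Longrightarrow> 0 \<le> q i \<and> q i \<le> 1 / 2" and prod: "(\<Prod>i<n. 1 - q i) = exp (- L)"
  shows "L / 2 \<le> (\<Sum>i<n. q i)" "(\<Sum>i<n. q i) \<le> L"
proof -
  have pos: "0 < 1 - q i" if "i < n" for i using q[OF that] by auto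
  have L: "- L = (\<Sum>i<n. ln (1 - q i))"
  proof -
    have "ln (\<Prod>i<n. 1 - q i) = (\<Sum>i<n. ln (1 - q i))" by (rule ln_prod) (use pos in force)+
    then show ?thesis unfolding prod by simp
  qed
  have "(\<Sum>i<n. ln (1 - q i)) \<le> (\<Sum>i<n. - q i)"
  proof (rule sum_mono)
    fix i assume "i \<in> {..<n}"
    then show "ln (1 - q i) \<le> - q i" using ln_le_minus_one[of "1 - q i"] pos by auto
  qed
  then show "(\<Sum>i<n. q i) \<le> L" using L by (simp add: sum_negf)
  have "(\<Sum>i<n. - 2 * q i) \<le> (\<Sum>i<n. ln (1 - q i))"
  proof (rule sum_mono)
    fix i assume "i \<in> {..<n}"
    then have i: "0 \<le> q i" "q i \<le> 1 / 2" using q by auto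
    have "q i * q i \<le> q i * (1 / 2)" using i by (intro mult_left_mono) auto
    then have "- 2 * q i \<le> - q i - 2 * (q i)\<^sup>2" by (simp add: power2_eq_square)
    also have "\<dots> \<le> ln (1 - q i)" by (rule ln_one_minus_pos_lower_bound[OF i])
    finally show "- 2 * q i \<le> ln (1 - q i)" .
  qed
  also have "(\<Sum>i<n. - 2 * q i) = - 2 * (\<Sum>i<n. q i)" by (simp add: sum_distrib_left)
  finally show "L / 2 \<le> (\<Sum>i<n. q i)" using L by simp
qed

locale sample_instance =
  fixes n :: nat and D :: "nat \<Rightarrow> real measure"
  assumes n: "0 < n"
    and D: "\<And>i. prob_space (D i)"
    and sets_D[simp, measurable_cong]: "\<And>i. sets (D i) = sets borel"
begin

abbreviation "DM \<equiv> PiM {..<n} D"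
abbreviation "base \<equiv> seed \<Otimes>\<^sub>M (DM \<Otimes>\<^sub>M DM)"
text \<open>\<open>i mod n\<close> is the pair of item \<open>i\<close>, so the two draws of a pair
  have the same law.\<close>

abbreviation "KD \<equiv> \<lambda>i. D (i mod n) \<Otimes>\<^sub>M unif01"
abbreviation "KM \<equiv> PiM {..<2 * n} KD"

lemma space_D[simp]: "space (D i) = UNIV"
  using sets_eq_imp_space_eq[OF sets_D] by simp

lemma prob_DM: "prob_space DM"
  using D by (intro prob_space_PiM) auto

lemma prob_KD: "prob_space (KD i)"
  using D prob_space_unif01 by (intro prob_space_pair)

lemma prob_KM: "prob_space KM"
  using prob_KD by (intro prob_space_PiM) auto

lemma prob_base: "prob_space base"
  using prob_DM prob_space_seed by (intro prob_space_pair)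

lemma sets_KD: "sets (KD i) = sets (borel \<Otimes>\<^sub>M borel)"
  by (intro sets_pair_measure_cong) auto

lemma measurable_key_component: "i < 2 * n \<Longrightarrow> (\<lambda>\<kappa>. \<kappa> i) \<in> KM \<rightarrow>\<^sub>M borel \<Otimes>\<^sub>M borel"
  using measurable_component_singleton[of i "{..<2 * n}" KD] sets_KD[of i] by (simp cong: measurable_cong_sets)

lemma concat_law:
  shows "(\<lambda>(y, x). \<lambda>i\<in>{..<2 * n}. if i < n then y i else x (i - n)) \<in> DM \<Otimes>\<^sub>M DM \<rightarrow>\<^sub>M PiM {..<2 * n} (\<lambda>i. D (i mod n))"
    and "distr (DM \<Otimes>\<^sub>M DM) (PiM {..<2 * n} (\<lambda>i. D (i mod n))) (\<lambda>(y, x). \<lambda>i\<in>{..<2 * n}. if i < n then y i else x (i - n)) =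
    PiM {..<2 * n} (\<lambda>i. D (i mod n))"
proof -
  let ?M = "\<lambda>i. D (i mod n)" and ?T = "\<lambda>(y, x). \<lambda>i\<in>{..<2 * n}. if i < n then y i else x (i - n) :: real"
  interpret M: product_sigma_finite ?M
    by (intro product_sigma_finite.intro prob_space_imp_sigma_finite D)
  interpret DD: product_sigma_finite D
    by (intro product_sigma_finite.intro prob_space_imp_sigma_finite D)
  interpret DM: prob_space DM by (rule prob_DM)
  show T: "?T \<in> DM \<Otimes>\<^sub>M DM \<rightarrow>\<^sub>M PiM {..<2 * n} ?M"
    unfolding case_prod_beta
  proof (intro measurable_restrict)
    fix i assume i: "i \<in> {..<2 * n}"
    have m: "(\<lambda>z. z j) \<in> DM \<rightarrow>\<^sub>M borel" if "j < n" for j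
      using measurable_component_singleton[of j "{..<n}" D] that by (simp cong: measurable_cong_sets)
    have "(\<lambda>z. if i < n then fst z i else snd z (i - n)) \<in> DM \<Otimes>\<^sub>M DM \<rightarrow>\<^sub>M borel"
    proof (cases "i < n")
      case True
      show ?thesis using measurable_compose[OF measurable_fst m[OF True]] True by simp
    next
      case False
      have "i - n < n" using i False by auto
      then show ?thesis using measurable_compose[OF measurable_snd m[of "i - n"]] False by simp
    qed
    then show "(\<lambda>z. if i < n then fst z i else snd z (i - n)) \<in> DM \<Otimes>\<^sub>M DM \<rightarrow>\<^sub>M ?M i"
      by (simp cong: measurable_cong_sets)
  qed
  show "distr (DM \<Otimes>\<^sub>M DM) (PiM {..<2 * n} ?M) ?T = PiM {..<2 * n} ?M"
  proof (rule M.PiM_eqI)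
    fix E assume E: "\<And>i. i \<in> {..<2 * n} \<Longrightarrow> E i \<in> sets (?M i)"
    have EP: "Pi\<^sub>E {..<2 * n} E \<in> sets (PiM {..<2 * n} ?M)" using E by (intro sets_PiM_I_finite) auto
    have "?T -` Pi\<^sub>E {..<2 * n} E \<inter> space (DM \<Otimes>\<^sub>M DM) = Pi\<^sub>E {..<n} E \<times> Pi\<^sub>E {..<n} (\<lambda>i. E (n + i))"
    proof (intro equalityI subsetI)
      fix z assume z: "z \<in> ?T -` Pi\<^sub>E {..<2 * n} E \<inter> space (DM \<Otimes>\<^sub>M DM)"
      obtain y x where yx: "z = (y, x)" by (cases z)
      have sp: "y \<in> space DM" "x \<in> space DM" using z yx by (auto simp: space_pair_measure)
      have *: "(if i < n then y i else x (i - n)) \<in> E i" if "i < 2 * n" for i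
        using z that unfolding yx by (auto simp: PiE_iff)
      have "y i \<in> E i" "x i \<in> E (n + i)" if "i < n" for i
        using *[of i] *[of "n + i"] that by auto
      then show "z \<in> Pi\<^sub>E {..<n} E \<times> Pi\<^sub>E {..<n} (\<lambda>i. E (n + i))"
        using sp by (auto simp: yx space_PiM PiE_iff)
    next
      fix z assume z: "z \<in> Pi\<^sub>E {..<n} E \<times> Pi\<^sub>E {..<n} (\<lambda>i. E (n + i))"
      obtain y x where yx: "z = (y, x)" by (cases z)
      have yE: "y \<in> Pi\<^sub>E {..<n} E" and xE: "x \<in> Pi\<^sub>E {..<n} (\<lambda>i. E (n + i))" using z yx by auto
      have "(if i < n then y i else x (i - n)) \<in> E i" if "i < 2 * n" for i
      proof (cases "i < n")
        case True
        then show ?thesis using yE by (auto simp: PiE_iff)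
      next
        case False
        then have "i - n \<in> {..<n}" "n + (i - n) = i" using that by auto
        then show ?thesis using xE False by (auto simp: PiE_iff dest!: bspec[of _ _ "i - n"])
      qed
      then show "z \<in> ?T -` Pi\<^sub>E {..<2 * n} E \<inter> space (DM \<Otimes>\<^sub>M DM)"
        using yE xE by (auto simp: yx space_pair_measure space_PiM PiE_iff)
    qed
    then have "emeasure (distr (DM \<Otimes>\<^sub>M DM) (PiM {..<2 * n} ?M) ?T) (Pi\<^sub>E {..<2 * n} E) =
        emeasure (DM \<Otimes>\<^sub>M DM) (Pi\<^sub>E {..<n} E \<times> Pi\<^sub>E {..<n} (\<lambda>i. E (n + i)))"
      using T EP by (simp add: emeasure_distr)
    also have "\<dots> = emeasure DM (Pi\<^sub>E {..<n} E) * emeasure DM (Pi\<^sub>E {..<n} (\<lambda>i. E (n + i)))"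
      using E by (intro DM.emeasure_pair_measure_Times sets_PiM_I_finite) auto
    also have "\<dots> = (\<Prod>i<n. emeasure (D i) (E i)) * (\<Prod>i<n. emeasure (D i) (E (n + i)))"
      using E by (subst (1 2) DD.emeasure_PiM) auto
    also have "\<dots> = (\<Prod>i<2 * n. emeasure (?M i) (E i))"
      unfolding prod_lessThan_double by (intro arg_cong2[where f = "(*)"] prod.cong) auto
    finally show "emeasure (distr (DM \<Otimes>\<^sub>M DM) (PiM {..<2 * n} ?M) ?T) (Pi\<^sub>E {..<2 * n} E) =
        (\<Prod>i<2 * n. emeasure (?M i) (E i))" .
  qed auto
qed

text \<open>For fixed \<open>p\<close> the tie-breakers are distinct coordinates of an i.i.d. seed,
  so reading them in permuted order does not change their law. Hence the law of the keys does not
  depend on \<open>p\<close>.\<close>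

lemma keys_law:
  assumes p: "p permutes {..<n}"
  shows "(\<lambda>(\<omega>, y, x). keys n p \<omega> y x) \<in> base \<rightarrow>\<^sub>M KM"
    and "distr base KM (\<lambda>(\<omega>, y, x). keys n p \<omega> y x) = KM"
proof -
  define e where "e i = (if i < n then i else n + inv p (i - n))" for i
  let ?G = "\<lambda>\<omega>. \<lambda>i\<in>{..<2 * n}. \<omega> (e i) :: real"
  let ?F = "\<lambda>(y, x). \<lambda>i\<in>{..<2 * n}. if i < n then y i else x (i - n) :: real"
  let ?T = "\<lambda>(g, f). \<lambda>i\<in>{..<2 * n}. (f i :: real, g i :: real)"
  let ?U = "PiM {..<2 * n} (\<lambda>_. unif01)" and ?M = "PiM {..<2 * n} (\<lambda>i. D (i mod n))"
  have inj: "inj_on e {..<2 * n}"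
  proof (rule inj_onI)
    fix i j assume ij: "i \<in> {..<2 * n}" "j \<in> {..<2 * n}" "e i = e j"
    have "inv p a = inv p b \<longleftrightarrow> a = b" for a b using permutes_inj[OF permutes_inv[OF p]] by (auto dest: injD)
    then show "i = j" using ij by (auto simp: e_def split: if_splits)
  qed
  have G: "distr seed ?U ?G = ?U"
    unfolding seed_def by (rule distr_PiM_reindex) (use prob_space_unif01 inj in auto)
  have Gm: "?G \<in> seed \<rightarrow>\<^sub>M ?U"
    by (intro measurable_restrict) (simp cong: measurable_cong_sets)
  note Fm = concat_law(1)
  have sf: "sigma_finite_measure (distr (DM \<Otimes>\<^sub>M DM) ?M ?F)"
    unfolding concat_law(2) using D by (intro prob_space_imp_sigma_finite prob_space_PiM) auto
  have Tm: "?T \<in> ?U \<Otimes>\<^sub>M ?M \<rightarrow>\<^sub>M KM"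
    unfolding case_prod_beta by (intro measurable_restrict) measurable
  have pr: "distr base (?U \<Otimes>\<^sub>M ?M) (\<lambda>(\<omega>, z). (?G \<omega>, ?F z)) = ?U \<Otimes>\<^sub>M ?M"
    using pair_measure_distr[OF Gm Fm sf] G concat_law(2) by simp
  have prm: "(\<lambda>(\<omega>, z). (?G \<omega>, ?F z)) \<in> base \<rightarrow>\<^sub>M ?U \<Otimes>\<^sub>M ?M"
    using Gm Fm by measurable
  have comp: "(\<lambda>(\<omega>, y, x). keys n p \<omega> y x) = ?T \<circ> (\<lambda>(\<omega>, z). (?G \<omega>, ?F z))"
    by (auto simp: fun_eq_iff keys_def e_def)
  show "(\<lambda>(\<omega>, y, x). keys n p \<omega> y x) \<in> base \<rightarrow>\<^sub>M KM"
    unfolding comp by (rule measurable_comp[OF prm Tm])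
  have "distr base KM (?T \<circ> (\<lambda>(\<omega>, z). (?G \<omega>, ?F z))) = distr (distr base (?U \<Otimes>\<^sub>M ?M) (\<lambda>(\<omega>, z). (?G \<omega>, ?F z))) KM ?T"
    by (rule distr_distr[OF Tm prm, symmetric])
  also have "\<dots> = KM" unfolding pr using D prob_space_unif01 by (intro distr_PiM_pair) auto
  finally show "distr base KM (\<lambda>(\<omega>, y, x). keys n p \<omega> y x) = KM" unfolding comp .
qed

text \<open>\<open>pair_swap\<close> keeps every item within its pair, so it permutes coordinates
  with equal laws.\<close>

lemma swap_law:
  shows "(\<lambda>\<kappa>. \<lambda>i\<in>{..<2 * n}. \<kappa> (pair_swap n \<sigma> i)) \<in> KM \<rightarrow>\<^sub>M KM"
    and "distr KM KM (\<lambda>\<kappa>. \<lambda>i\<in>{..<2 * n}. \<kappa> (pair_swap n \<sigma> i)) = KM"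
proof -
  have mod: "pair_swap n \<sigma> i mod n = i mod n" for i
    by (auto simp: pair_swap_def le_mod_geq)
  have "inj_on (pair_swap n \<sigma>) {..<2 * n}" by (metis inj_onI pair_swap_swap)
  then show "distr KM KM (\<lambda>\<kappa>. \<lambda>i\<in>{..<2 * n}. \<kappa> (pair_swap n \<sigma> i)) = KM"
    using distr_PiM_reindex[of "{..<2 * n}" KD "pair_swap n \<sigma>" "{..<2 * n}"] prob_KD
    by (simp add: mod pair_swap_less Pi_iff)
  show "(\<lambda>\<kappa>. \<lambda>i\<in>{..<2 * n}. \<kappa> (pair_swap n \<sigma> i)) \<in> KM \<rightarrow>\<^sub>M KM"
  proof (intro measurable_restrict)
    fix i assume "i \<in> {..<2 * n}"
    then show "(\<lambda>\<kappa>. \<kappa> (pair_swap n \<sigma> i)) \<in> KM \<rightarrow>\<^sub>M KD i"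
      using measurable_component_singleton[of "pair_swap n \<sigma> i" "{..<2 * n}" KD] by (simp add: mod pair_swap_less)
  qed
qed

text \<open>The distributions \<open>D i\<close> may have atoms, but the uniform tie-breaker has
  none. Key \<open>i\<close> is split off from the product; for fixed other coordinates it hits the
  point \<open>X j\<close> with probability 0.\<close>

lemma AE_key_neq:
  assumes ij: "i < 2 * n" "j < 2 * n" "i \<noteq> j"
  shows "AE \<kappa> in KM. \<kappa> i \<noteq> \<kappa> j"
proof -
  let ?J = "{..<2 * n} - {i}"
  have ins: "insert i ?J = {..<2 * n}" using ij by auto
  interpret I: prob_space "KD i" by (rule prob_KD)
  interpret J: prob_space "PiM ?J KD" using prob_KD by (intro prob_space_PiM) auto
  interpret P: pair_sigma_finite "KD i" "PiM ?J KD" ..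
  have law: "distr (KD i \<Otimes>\<^sub>M PiM ?J KD) KM (\<lambda>(x, X). X(i := x)) = KM"
    using distr_pair_PiM_eq_PiM[of ?J KD i] prob_KD unfolding ins by auto
  let ?S = "{z \<in> space (KD i \<Otimes>\<^sub>M PiM ?J KD). fst z = snd z j}"
  have jm: "(\<lambda>z. snd z j) \<in> KD i \<Otimes>\<^sub>M PiM ?J KD \<rightarrow>\<^sub>M borel \<Otimes>\<^sub>M borel"
    using measurable_compose[OF measurable_snd measurable_component_singleton[of j ?J KD]] ij sets_KD[of j]
    by (simp cong: measurable_cong_sets)
  have im: "fst \<in> KD i \<Otimes>\<^sub>M PiM ?J KD \<rightarrow>\<^sub>M borel \<Otimes>\<^sub>M borel"
    using measurable_fst[of "KD i" "PiM ?J KD"] sets_KD[of i] by (simp cong: measurable_cong_sets)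
  have S: "?S \<in> sets (KD i \<Otimes>\<^sub>M PiM ?J KD)"
  proof -
    have [measurable]: "fst \<in> KD i \<Otimes>\<^sub>M PiM ?J KD \<rightarrow>\<^sub>M borel" "(\<lambda>z. snd z j) \<in> KD i \<Otimes>\<^sub>M PiM ?J KD \<rightarrow>\<^sub>M borel"
      using im jm unfolding borel_prod by auto
    show ?thesis by measurable
  qed
  have "emeasure (KD i \<Otimes>\<^sub>M PiM ?J KD) ?S = (\<integral>\<^sup>+ X. emeasure (KD i) ((\<lambda>x. (x, X)) -` ?S) \<partial>PiM ?J KD)"
    by (rule P.emeasure_pair_measure_alt2[OF S])
  also have "\<dots> = (\<integral>\<^sup>+ X. 0 \<partial>PiM ?J KD)"
  proof (intro nn_integral_cong)
    fix X assume X: "X \<in> space (PiM ?J KD)"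
    interpret Di: prob_space "D (i mod n)" by (rule D)
    interpret Ui: prob_space unif01 by (rule prob_space_unif01)
    have "emeasure (KD i) {X j} = emeasure (KD i) ({fst (X j)} \<times> {snd (X j)})" by simp
    also have "\<dots> = emeasure (D (i mod n)) {fst (X j)} * emeasure unif01 {snd (X j)}"
      by (rule Ui.emeasure_pair_measure_Times) auto
    finally have z: "emeasure (KD i) {X j} = 0" by (simp add: unif01_singleton)
    have "emeasure (KD i) ((\<lambda>x. (x, X)) -` ?S) \<le> emeasure (KD i) {X j}"
      using pair_measureI[of "{fst (X j)}" borel "{snd (X j)}" borel] by (intro emeasure_mono) (auto simp: sets_KD)
    then show "emeasure (KD i) ((\<lambda>x. (x, X)) -` ?S) = 0" using z by simp
  qed
  finally have "emeasure (KD i \<Otimes>\<^sub>M PiM ?J KD) ?S = 0" by simp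
  then have "AE z in KD i \<Otimes>\<^sub>M PiM ?J KD. fst z \<noteq> snd z j"
    by (intro AE_I[where N = ?S] S) auto
  then have ae: "AE z in KD i \<Otimes>\<^sub>M PiM ?J KD. (case z of (x, X) \<Rightarrow> X(i := x)) i \<noteq> (case z of (x, X) \<Rightarrow> X(i := x)) j"
    using ij by (auto simp: case_prod_beta)
  have mm: "(\<lambda>(x, X). X(i := x)) \<in> KD i \<Otimes>\<^sub>M PiM ?J KD \<rightarrow>\<^sub>M KM"
    using measurable_fun_upd[of "{..<2 * n}" ?J i snd "KD i \<Otimes>\<^sub>M PiM ?J KD" KD fst] ins
    by (auto simp: case_prod_beta)
  have set: "{\<kappa> \<in> space KM. \<kappa> i \<noteq> \<kappa> j} \<in> sets KM"
  proof -
    have [measurable]: "Measurable.pred KM (\<lambda>\<kappa>. lex_less (\<kappa> i) (\<kappa> j))" "Measurable.pred KM (\<lambda>\<kappa>. lex_less (\<kappa> j) (\<kappa> i))"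
      using ij by (auto intro!: pred_lex_less measurable_key_component)
    have "{\<kappa> \<in> space KM. \<kappa> i \<noteq> \<kappa> j} = {\<kappa> \<in> space KM. lex_less (\<kappa> i) (\<kappa> j) \<or> lex_less (\<kappa> j) (\<kappa> i)}"
      using lex_less_total lex_less_irrefl by (intro Collect_cong) metis
    also have "\<dots> \<in> sets KM" by measurable
    finally show ?thesis .
  qed
  show ?thesis using ae AE_distr_iff[OF mm set] unfolding law by simp
qed

lemma AE_inj_keys: "AE \<kappa> in KM. inj_on \<kappa> {..<2 * n}"
proof -
  have "AE \<kappa> in KM. \<forall>i\<in>{..<2 * n}. \<forall>j\<in>{..<2 * n}. i \<noteq> j \<longrightarrow> \<kappa> i \<noteq> \<kappa> j"
    using AE_key_neq by (intro AE_finite_allI) (auto intro!: AE_finite_allI)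
  then show ?thesis by eventually_elim (auto simp: inj_on_def)
qed

subsection \<open>Success probability of the rule\<close>

abbreviation "perms \<equiv> {p. p permutes {..<n}}"

lemma perms: "finite perms" "perms \<noteq> {}" "card perms = fact n"
proof -
  show "finite perms" by (rule finite_permutations) simp
  show "perms \<noteq> {}" using permutes_id by blast
  show "card perms = fact n" by (rule card_permutations) auto
qed

lemma pred_success:
  assumes p: "p \<in> perms"
  shows "Measurable.pred base (\<lambda>(\<omega>, y, x). accepts_max (sample_rule \<omega> (map y [0..<n])) 0 (map (\<lambda>t. x (p t)) [0..<n]))"
proof -
  have pn: "p t < n" if "t < n" for t using permutes_in_image[of p "{..<n}" t] p that by simp
  let ?R = "\<lambda>z t. sample_rule (fst z) (map (fst (snd z)) [0..<n]) (map (\<lambda>t. snd (snd z) (p t)) [0..<Suc t])"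
  have comp: "(\<lambda>y. y j) \<in> DM \<rightarrow>\<^sub>M borel" if "j < n" for j
    using measurable_component_singleton[of j "{..<n}" D] that by (simp cong: measurable_cong_sets)
  have y: "(\<lambda>z. fst (snd z) j) \<in> base \<rightarrow>\<^sub>M borel" and x: "(\<lambda>z. snd (snd z) j) \<in> base \<rightarrow>\<^sub>M borel" if "j < n" for j
    using comp[OF that] by measurable
  have w: "(\<lambda>z. fst z j) \<in> base \<rightarrow>\<^sub>M borel" for j by measurable
  have R: "Measurable.pred base (\<lambda>z. ?R z t)" if "t < n" for t
    by (rule pred_sample_rule) (use w y x pn that in auto)
  have eq: "accepts_max (sample_rule (fst z) (map (fst (snd z)) [0..<n])) 0 (map (\<lambda>t. snd (snd z) (p t)) [0..<n]) \<longleftrightarrow>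
      (\<exists>t\<in>{..<n}. ?R z t \<and> (\<forall>s\<in>{..<t}. \<not> ?R z s) \<and> (\<forall>s\<in>{..<n}. snd (snd z) (p s) \<le> snd (snd z) (p t)))" for z
  proof -
    let ?x = "\<lambda>t. snd (snd z) (p t)"
    have take: "take (Suc t) (map ?x [0..<n]) = map ?x [0..<Suc t]" if "t < n" for t
      using that by (simp add: take_map take_upt)
    have max: "?x t = Max (set (drop 0 (map ?x [0..<n]))) \<longleftrightarrow> (\<forall>s\<in>{..<n}. ?x s \<le> ?x t)" if "t < n" for t
    proof
      assume "?x t = Max (set (drop 0 (map ?x [0..<n])))" then show "\<forall>s\<in>{..<n}. ?x s \<le> ?x t" by auto
    next
      assume "\<forall>s\<in>{..<n}. ?x s \<le> ?x t" then show "?x t = Max (set (drop 0 (map ?x [0..<n])))"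
        using that by (intro Max_eqI[symmetric]) auto
    qed
    have "accepts_at (sample_rule (fst z) (map (fst (snd z)) [0..<n])) 0 (map ?x [0..<n]) t \<and> map ?x [0..<n] ! t = Max (set (drop 0 (map ?x [0..<n]))) \<longleftrightarrow>
        t < n \<and> ?R z t \<and> (\<forall>s\<in>{..<t}. \<not> ?R z s) \<and> (\<forall>s\<in>{..<n}. ?x s \<le> ?x t)" for t
    proof (cases "t < n")
      case True
      have "(\<forall>s. 0 \<le> s \<and> s < t \<longrightarrow> \<not> sample_rule (fst z) (map (fst (snd z)) [0..<n]) (take (Suc s) (map ?x [0..<n]))) \<longleftrightarrow> (\<forall>s\<in>{..<t}. \<not> ?R z s)"
      proof -
        have "take (Suc s) (map ?x [0..<n]) = map ?x [0..<Suc s]" if "s < t" for s using take[of s] True that by linarith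
        then show ?thesis by (simp add: Ball_def del: upt_Suc)
      qed
      then show ?thesis using take[OF True] max[OF True] True unfolding accepts_at_def by simp
    qed (simp add: accepts_at_def)
    then show ?thesis unfolding accepts_max_def by blast
  qed
  have "Measurable.pred base (\<lambda>z. \<exists>t\<in>{..<n}. ?R z t \<and> (\<forall>s\<in>{..<t}. \<not> ?R z s) \<and> (\<forall>s\<in>{..<n}. snd (snd z) (p s) \<le> snd (snd z) (p t)))"
  proof (intro pred_intros_finite pred_intros_logic)
    fix t assume t: "t \<in> {..<n}"
    show "Measurable.pred base (\<lambda>z. ?R z t)" using R t by auto
    show "Measurable.pred base (\<lambda>z. ?R z s)" if "s \<in> {..<t}" for s using R t that by auto
    show "Measurable.pred base (\<lambda>z. snd (snd z) (p s) \<le> snd (snd z) (p t))" if "s \<in> {..<n}" for s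
    proof -
      have [measurable]: "(\<lambda>z. snd (snd z) (p s)) \<in> base \<rightarrow>\<^sub>M borel" "(\<lambda>z. snd (snd z) (p t)) \<in> base \<rightarrow>\<^sub>M borel"
        using x pn t that by auto
      show ?thesis by measurable
    qed
  qed auto
  then show ?thesis unfolding eq[symmetric] by (simp add: case_prod_beta)
qed

lemma single_sample_success_ge_key_win:
  "(\<Sum>p\<in>perms. \<P>(\<kappa> in KM. key_win n p \<kappa>)) / fact n \<le> single_sample_success sample_rule n D"
proof -
  let ?E = "\<lambda>\<omega> y x p. accepts_max (sample_rule \<omega> (map y [0..<n])) 0 (map (\<lambda>t. x (p t)) [0..<n])"
  let ?F = "\<lambda>v p. case v of (\<omega>, y, x) \<Rightarrow> ?E \<omega> y x p"
  have U: "prob_space (uniform_count_measure perms)" using perms by (intro prob_space_uniform_count_measure) auto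
  have Fp: "Measurable.pred base (\<lambda>v. ?F v p)" if "p \<in> perms" for p
    using pred_success[OF that] by simp
  have "Measurable.pred (base \<Otimes>\<^sub>M uniform_count_measure perms) (\<lambda>((\<omega>, y, x), p). ?E \<omega> y x p)"
    using measure_pair_uniform_count(1)[OF prob_base perms(1,2), of ?F, OF Fp] by (simp add: pred_def case_prod_beta')
  then have "single_sample_success sample_rule n D =
      \<P>(z in base \<Otimes>\<^sub>M uniform_count_measure perms. case z of (v, p) \<Rightarrow> ?F v p)"
    unfolding single_sample_success_def arrival_order_def
    using prob_space_seed prob_DM U by (intro measure_reassoc)
  also have "\<dots> = (\<Sum>p\<in>perms. \<P>(v in base. ?F v p)) / fact n"
    using measure_pair_uniform_count(2)[OF prob_base perms(1,2), of ?F, OF Fp] perms(3) by simp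
  finally have eq: "single_sample_success sample_rule n D = (\<Sum>p\<in>perms. \<P>(v in base. ?F v p)) / fact n" .
  have "\<P>(\<kappa> in KM. key_win n p \<kappa>) \<le> \<P>(v in base. ?F v p)" if p: "p \<in> perms" for p
  proof -
    let ?k = "\<lambda>(\<omega>, y, x). keys n p \<omega> y x"
    have pp: "p permutes {..<n}" using p by simp
    interpret base: prob_space base by (rule prob_base)
    have kw: "Measurable.pred KM (key_win n p)"
      unfolding key_win_def by (intro pred_pair_order_win measurable_key_component)
    have "\<P>(\<kappa> in KM. key_win n p \<kappa>) = measure (distr base KM ?k) {\<kappa> \<in> space KM. key_win n p \<kappa>}"
      unfolding keys_law(2)[OF pp] ..
    also have "\<dots> = measure base (?k -` {\<kappa> \<in> space KM. key_win n p \<kappa>} \<inter> space base)"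
      using keys_law(1)[OF pp] kw by (intro measure_distr) (auto simp: pred_def)
    also have "\<dots> \<le> \<P>(v in base. ?F v p)"
    proof (rule base.finite_measure_mono_AE)
      have "AE \<kappa> in distr base KM ?k. inj_on \<kappa> {..<2 * n}" unfolding keys_law(2)[OF pp] by (rule AE_inj_keys)
      from AE_distrD[OF keys_law(1)[OF pp] this]
      have "AE v in base. inj_on (?k v) {..<2 * n}" .
      then show "AE v in base. v \<in> ?k -` {\<kappa> \<in> space KM. key_win n p \<kappa>} \<inter> space base \<longrightarrow> v \<in> {v \<in> space base. ?F v p}"
      proof eventually_elim
        case (elim v)
        obtain \<omega> y x where v: "v = (\<omega>, y, x)" by (cases v)
        show ?case using accepts_max_if_key_win[OF pp, of \<omega> y x] elim unfolding v by auto
      qed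
      show "{v \<in> space base. ?F v p} \<in> sets base" using Fp[OF p] by (simp add: pred_def)
    qed
    finally show ?thesis .
  qed
  then show ?thesis unfolding eq by (intro divide_right_mono sum_mono) auto
qed

text \<open>The right-hand side does not depend on \<sigma>, so the success probability may be
  averaged over all \<sigma>.\<close>

lemma key_win_swap:
  assumes p: "p \<in> perms"
  shows "\<P>(\<kappa> in KM. key_win n p \<kappa>) = \<P>(\<kappa> in KM. rank_win n (pair_order n (key_rank n \<kappa>) \<sigma> p))"
proof -
  let ?s = "\<lambda>\<kappa>. \<lambda>i\<in>{..<2 * n}. \<kappa> (pair_swap n \<sigma> i)"
  have pp: "p permutes {..<n}" using p by simp
  have kw: "Measurable.pred KM (key_win n p)"
    unfolding key_win_def by (intro pred_pair_order_win measurable_key_component)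
  have "\<P>(\<kappa> in KM. key_win n p \<kappa>) = measure (distr KM KM ?s) {\<kappa> \<in> space KM. key_win n p \<kappa>}"
    unfolding swap_law(2) ..
  also have "\<dots> = measure KM (?s -` {\<kappa> \<in> space KM. key_win n p \<kappa>} \<inter> space KM)"
    using swap_law(1) kw by (intro measure_distr) (auto simp: pred_def)
  also have "?s -` {\<kappa> \<in> space KM. key_win n p \<kappa>} \<inter> space KM = {\<kappa> \<in> space KM. rank_win n (pair_order n (key_rank n \<kappa>) \<sigma> p)}"
    using measurable_space[OF swap_law(1)[of \<sigma>]] by (auto simp: key_win_def pair_order_swap[OF pp])
  finally show ?thesis .
qed

definition clear :: "nat \<Rightarrow> real \<times> real \<Rightarrow> (nat \<Rightarrow> real \<times> real) \<Rightarrow> bool" where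
  "clear K z \<kappa> \<longleftrightarrow> K \<le> card {i. i < n \<and> \<not> lex_less (\<kappa> (n + i)) z} \<and>
     (\<forall>i<n. lex_less (\<kappa> i) z \<or> lex_less (\<kappa> (n + i)) z)"

lemma pred_below[measurable]: "i < 2 * n \<Longrightarrow> Measurable.pred KM (\<lambda>\<kappa>. lex_less (\<kappa> i) z)"
  by (intro pred_lex_less measurable_key_component measurable_const) (auto simp: space_pair_measure)

lemma measurable_count_above[measurable]:
  "(\<lambda>\<kappa>. card {i. i < n \<and> \<not> lex_less (\<kappa> (n + i)) z}) \<in> KM \<rightarrow>\<^sub>M count_space UNIV"
proof (rule measurable_card)
  fix i
  show "{\<kappa> \<in> space KM. i \<in> {i. i < n \<and> \<not> lex_less (\<kappa> (n + i)) z}} \<in> sets KM"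
  proof (cases "i < n")
    case True
    then have "Measurable.pred KM (\<lambda>\<kappa>. \<not> lex_less (\<kappa> (n + i)) z)" by (intro pred_intros_logic pred_below) auto
    then show ?thesis using True by (simp add: pred_def)
  qed simp
qed

lemma pred_clear: "Measurable.pred KM (clear K z)"
proof -
  have "Measurable.pred KM (\<lambda>\<kappa>. K \<le> card {i. i < n \<and> \<not> lex_less (\<kappa> (n + i)) z})"
    by (rule measurable_compose[OF measurable_count_above]) simp
  moreover have "Measurable.pred KM (\<lambda>\<kappa>. \<forall>i\<in>{..<n}. lex_less (\<kappa> i) z \<or> lex_less (\<kappa> (n + i)) z)"
    by (intro pred_intros_finite pred_intros_logic pred_below) auto
  ultimately have "Measurable.pred KM (\<lambda>\<kappa>. K \<le> card {i. i < n \<and> \<not> lex_less (\<kappa> (n + i)) z} \<and>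
      (\<forall>i\<in>{..<n}. lex_less (\<kappa> i) z \<or> lex_less (\<kappa> (n + i)) z))" by (rule pred_intros_logic)
  then show ?thesis unfolding clear_def[abs_def] by (simp add: Ball_def)
qed

text \<open>At least \<open>K\<close> keys are not below \<open>z\<close>, so every item below
  \<open>z\<close> has rank at least \<open>K\<close>; and each pair contains an item below
  \<open>z\<close>.\<close>

lemma clear_distinct_pairs:
  assumes c: "clear K z \<kappa>" and i: "i < n"
  shows "\<not> (key_rank n \<kappa> i < K \<and> key_rank n \<kappa> (n + i) < K)"
proof -
  have "K \<le> key_rank n \<kappa> j" if j: "j < 2 * n" "lex_less (\<kappa> j) z" for j
  proof -
    have "K \<le> card ((\<lambda>i. n + i) ` {i. i < n \<and> \<not> lex_less (\<kappa> (n + i)) z})"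
      using c by (simp add: clear_def card_image)
    also have "\<dots> \<le> card {k. k < 2 * n \<and> lex_less (\<kappa> j) (\<kappa> k)}"
      by (intro card_mono) (auto intro: lex_less_not_trans[OF _ j(2)])
    finally show ?thesis using j by (simp add: key_rank_def)
  qed
  moreover have "lex_less (\<kappa> i) z \<or> lex_less (\<kappa> (n + i)) z" using c i by (simp add: clear_def)
  ultimately have "K \<le> key_rank n \<kappa> i \<or> K \<le> key_rank n \<kappa> (n + i)" using i by auto
  then show ?thesis by auto
qed

text \<open>The success probability is averaged over all \<sigma> and \<open>p\<close>, and the
  average is moved inside the integral over the keys. For each fixed \<open>clear\<close>
  configuration with distinct keys it is bounded by \<open>card_pair_order_win\<close>; all other
  configurations contribute at least 0.\<close>

lemma success_ge_clear:
  assumes K: "32 \<le> K" "K\<^sup>2 \<le> n"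
  shows "(1 - (real K)\<^sup>2 / real n) * (half_value n - 24 / real K) * \<P>(\<kappa> in KM. clear K z \<kappa>) \<le>
    single_sample_success sample_rule n D"
proof -
  define c where "c = (1 - (real K)\<^sup>2 / real n) * (half_value n - 24 / real K)"
  interpret KM: prob_space KM by (rule prob_KM)
  let ?S = "Pow {..<n} \<times> perms"
  let ?W = "\<lambda>\<kappa> s. rank_win n (pair_order n (key_rank n \<kappa>) (fst s) (snd s))"
  have finS: "finite ?S" using perms(1) by simp
  have Wm: "{\<kappa> \<in> space KM. ?W \<kappa> s} \<in> sets KM" for s
    using pred_pair_order_win[where F = "\<lambda>\<kappa>. \<kappa>" and M = KM and n = n and \<sigma> = "fst s" and p = "snd s", OF measurable_key_component] by (simp add: pred_def)
  have Cm: "{\<kappa> \<in> space KM. clear K z \<kappa>} \<in> sets KM" using pred_clear by (simp add: pred_def)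
  have int: "integrable KM (indicat_real {\<kappa> \<in> space KM. ?W \<kappa> s})" for s
    using Wm by (intro KM.integrable_const_bound[where B = 1]) auto
  have "2 ^ n * (\<Sum>p\<in>perms. \<P>(\<kappa> in KM. key_win n p \<kappa>)) = (\<Sum>\<sigma>\<in>Pow {..<n}. \<Sum>p\<in>perms. \<P>(\<kappa> in KM. key_win n p \<kappa>))"
    by (simp add: card_Pow)
  also have "\<dots> = (\<Sum>\<sigma>\<in>Pow {..<n}. \<Sum>p\<in>perms. \<P>(\<kappa> in KM. rank_win n (pair_order n (key_rank n \<kappa>) \<sigma> p)))"
    by (intro sum.cong refl key_win_swap)
  also have "\<dots> = (\<Sum>s\<in>?S. \<P>(\<kappa> in KM. ?W \<kappa> s))"
    by (simp add: sum.cartesian_product case_prod_beta)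
  also have "\<dots> = (\<Sum>s\<in>?S. integral\<^sup>L KM (indicat_real {\<kappa> \<in> space KM. ?W \<kappa> s}))"
    using Wm by simp
  also have "\<dots> = integral\<^sup>L KM (\<lambda>\<kappa>. \<Sum>s\<in>?S. indicat_real {\<kappa> \<in> space KM. ?W \<kappa> s} \<kappa>)"
    by (rule Bochner_Integration.integral_sum[symmetric]) (rule int)
  also have "\<dots> \<ge> integral\<^sup>L KM (\<lambda>\<kappa>. c * (2 ^ n * fact n) * indicat_real {\<kappa> \<in> space KM. clear K z \<kappa>} \<kappa>)"
  proof (rule integral_mono_AE)
    show "integrable KM (\<lambda>\<kappa>. c * (2 ^ n * fact n) * indicat_real {\<kappa> \<in> space KM. clear K z \<kappa>} \<kappa>)"
      using Cm by (intro integrable_mult_right KM.integrable_const_bound[where B = 1]) auto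
    show "integrable KM (\<lambda>\<kappa>. \<Sum>s\<in>?S. indicat_real {\<kappa> \<in> space KM. ?W \<kappa> s} \<kappa>)"
      by (intro Bochner_Integration.integrable_sum int)
    show "AE \<kappa> in KM. c * (2 ^ n * fact n) * indicat_real {\<kappa> \<in> space KM. clear K z \<kappa>} \<kappa> \<le>
        (\<Sum>s\<in>?S. indicat_real {\<kappa> \<in> space KM. ?W \<kappa> s} \<kappa>)"
      using AE_inj_keys AE_space
    proof eventually_elim
      case (elim \<kappa>)
      show ?case
      proof (cases "clear K z \<kappa>")
        case True
        have "(\<Sum>s\<in>?S. indicat_real {\<kappa> \<in> space KM. ?W \<kappa> s} \<kappa>) = (\<Sum>s\<in>?S. if ?W \<kappa> s then 1 else 0)"
          using elim(2) by (intro sum.cong) auto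
        also have "\<dots> = real (card {s \<in> ?S. ?W \<kappa> s})" using finS by (simp add: sum.If_cases Int_def)
        also have "{s \<in> ?S. ?W \<kappa> s} = {(\<sigma>, p). \<sigma> \<subseteq> {..<n} \<and> p permutes {..<n} \<and> rank_win n (pair_order n (key_rank n \<kappa>) \<sigma> p)}"
          by auto
        also have "c * (2 ^ n * fact n) \<le> real (card \<dots>)"
          unfolding c_def
          by (rule card_pair_order_win[OF permutes_key_rank[OF elim(1)] K clear_distinct_pairs[OF True]])
        finally show ?thesis using True elim(2) by simp
      next
        case False
        then show ?thesis by (simp add: sum_nonneg)
      qed
    qed
  qed
  finally have "c * (2 ^ n * fact n) * \<P>(\<kappa> in KM. clear K z \<kappa>) \<le> 2 ^ n * (\<Sum>p\<in>perms. \<P>(\<kappa> in KM. key_win n p \<kappa>))"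
    using Cm by simp
  then have "2 ^ n * (c * fact n * \<P>(\<kappa> in KM. clear K z \<kappa>)) \<le> 2 ^ n * (\<Sum>p\<in>perms. \<P>(\<kappa> in KM. key_win n p \<kappa>))"
    by (simp add: mult_ac)
  then have "c * fact n * \<P>(\<kappa> in KM. clear K z \<kappa>) \<le> (\<Sum>p\<in>perms. \<P>(\<kappa> in KM. key_win n p \<kappa>))" by simp
  then have "c * \<P>(\<kappa> in KM. clear K z \<kappa>) \<le> (\<Sum>p\<in>perms. \<P>(\<kappa> in KM. key_win n p \<kappa>)) / fact n"
    by (simp add: field_simps)
  then show ?thesis using single_sample_success_ge_key_win unfolding c_def by linarith
qed

subsection \<open>A threshold separating the largest keys\<close>

lemma measure_atMost_split: "measure (D i) {..c} = measure (D i) {..<c} + measure (D i) {c}"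
proof -
  interpret prob_space "D i" by (rule D)
  have "{..c} = {..<c} \<union> {c}" by auto
  moreover have "measure (D i) ({..<c} \<union> {c}) = measure (D i) {..<c} + measure (D i) {c}"
    by (rule finite_measure_Union) auto
  ultimately show ?thesis by simp
qed

text \<open>The cdf \<open>F\<close> of the maximum may jump across \<delta>. At the quantile
  \<open>c\<close> it is at least \<delta> by right continuity, and its left limit is at most
  \<delta>; interpolating the atoms at \<open>c\<close> with weight \<open>u\<close>, the
  intermediate value theorem attains \<delta> exactly.\<close>

lemma threshold_exists:
  assumes \<delta>: "0 < \<delta>" "\<delta> < 1"
  obtains c u where "0 \<le> u" "u \<le> 1" "(\<Prod>i<n. measure (D i) {..<c} + u * measure (D i) {c}) = \<delta>"
proof -
  have rd: "real_distribution (D i)" for i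
    using D by (intro real_distribution.intro real_distribution_axioms.intro) auto
  have fb: "finite_borel_measure (D i)" for i
    using rd real_distribution.axioms by (metis real_distribution.finite_borel_measure_M)
  define F where "F c = (\<Prod>i<n. cdf (D i) c)" for c
  have cdf0: "0 \<le> cdf (D i) c" for i c by (simp add: cdf_def)
  have mono: "F a \<le> F b" if "a \<le> b" for a b
    unfolding F_def by (intro prod_mono conjI cdf0 finite_borel_measure.cdf_nondecreasing[OF fb that])
  have top: "(F \<longlongrightarrow> (\<Prod>i<n. 1)) at_top"
    unfolding F_def by (intro tendsto_prod real_distribution.cdf_lim_at_top_prob[OF rd])
  have bot: "(F \<longlongrightarrow> (\<Prod>i<n. 0)) at_bot"
    unfolding F_def by (intro tendsto_prod finite_borel_measure.cdf_lim_at_bot[OF fb])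
  define S where "S = {c. \<delta> \<le> F c}"
  have ne: "S \<noteq> {}"
  proof -
    have "eventually (\<lambda>c. \<delta> < F c) at_top" using order_tendstoD(1)[OF top, of \<delta>] \<delta> by simp
    then show ?thesis unfolding S_def by (metis (mono_tags, lifting) empty_Collect_eq eventually_happens less_imp_le trivial_limit_at_top_linorder)
  qed
  have "eventually (\<lambda>c. F c < \<delta>) at_bot" using order_tendstoD(2)[OF bot, of \<delta>] \<delta> n by (simp add: power_0_left)
  then obtain b where b: "F b < \<delta>" by (metis (mono_tags, lifting) eventually_happens trivial_limit_at_bot_linorder)
  have bdd: "bdd_below S"
  proof (rule bdd_belowI)
    fix s assume "s \<in> S"
    then have "F b < F s" using b by (simp add: S_def)
    then show "b \<le> s" using mono[of s b] by linarith
  qed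
  define c where "c = Inf S"
  have "\<delta> \<le> F c"
  proof -
    have "continuous (at_right c) F"
      unfolding F_def by (intro continuous_prod finite_borel_measure.cdf_is_right_cont[OF fb])
    then have "(F \<longlongrightarrow> F c) (at_right c)" by (simp add: continuous_within)
    moreover have "eventually (\<lambda>x. \<delta> \<le> F x) (at_right c)"
      unfolding eventually_at_right_field
    proof (intro exI[of _ "c + 1"] conjI allI impI)
      fix x assume "c < x"
      then obtain s where "s \<in> S" "s < x" using cInf_lessD[OF ne] unfolding c_def by blast
      then show "\<delta> \<le> F x" using mono[of s x] by (auto simp: S_def)
    qed simp
    ultimately show ?thesis by (intro tendsto_lowerbound[of F "F c" "at_right c"]) auto
  qed
  moreover have "(\<Prod>i<n. measure (D i) {..<c}) \<le> \<delta>"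
  proof -
    have "(F \<longlongrightarrow> (\<Prod>i<n. measure (D i) {..<c})) (at_left c)"
      unfolding F_def by (intro tendsto_prod finite_borel_measure.cdf_at_left[OF fb])
    moreover have "eventually (\<lambda>x. F x \<le> \<delta>) (at_left c)"
      unfolding eventually_at_left_field
    proof (intro exI[of _ "c - 1"] conjI allI impI)
      fix x assume "x < c"
      then have "x \<notin> S" using cInf_lower[OF _ bdd, of x] unfolding c_def by auto
      then show "F x \<le> \<delta>" by (simp add: S_def)
    qed simp
    ultimately show ?thesis by (intro tendsto_upperbound[of F _ "at_left c"]) auto
  qed
  moreover have "continuous_on {0..1} (\<lambda>u. \<Prod>i<n. measure (D i) {..<c} + u * measure (D i) {c})"
    by (intro continuous_intros)
  ultimately have "\<exists>u\<ge>0. u \<le> 1 \<and> (\<Prod>i<n. measure (D i) {..<c} + u * measure (D i) {c}) = \<delta>"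
    by (intro IVT') (auto simp: F_def cdf_def measure_atMost_split)
  then show thesis using that by blast
qed

text \<open>The tie-breaker realizes the weight \<open>u\<close>: a value equal to \<open>c\<close>
  stays below the threshold key \<open>(c, u)\<close> with probability \<open>u\<close>. The product
  in \<open>threshold_exists\<close> is thus the probability that all \<open>n\<close> arrivals stay
  below this key.\<close>

lemma measure_key_below:
  assumes u: "0 \<le> u" "u \<le> 1"
  shows "measure (KD i) {a. lex_less a (c, u)} = measure (D (i mod n)) {..<c} + u * measure (D (i mod n)) {c}"
proof -
  interpret U: prob_space unif01 by (rule prob_space_unif01)
  interpret K: prob_space "KD i" by (rule prob_KD)
  have times: "measure (KD i) (A \<times> B) = measure (D (i mod n)) A * measure unif01 B" if "A \<in> sets borel" "B \<in> sets borel" for A B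
    using that U.emeasure_pair_measure_Times[of A "D (i mod n)" B] by (simp add: measure_def enn2real_mult)
  have "{0..1} \<inter> {..<u} = {0..<u}" using u by auto
  then have uu: "measure unif01 {..<u} = u"
    using u by (simp add: measure_uniform_measure)
  have "{a. lex_less a (c, u)} = {..<c} \<times> UNIV \<union> {c} \<times> {..<u}" by (auto simp: lex_less_def)
  moreover have "measure (KD i) ({..<c} \<times> UNIV \<union> {c} \<times> {..<u}) = measure (KD i) ({..<c} \<times> UNIV) + measure (KD i) ({c} \<times> {..<u})"
    by (rule K.finite_measure_Union) auto
  ultimately show ?thesis using times uu U.prob_space by simp
qed

lemma eq_Max_iff:
  fixes x :: "nat \<Rightarrow> real"
  assumes "i < n"
  shows "x i = Max (x ` {..<n}) \<longleftrightarrow> (\<forall>j\<in>{..<n}. x j \<le> x i)"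
proof
  assume "x i = Max (x ` {..<n})"
  then show "\<forall>j\<in>{..<n}. x j \<le> x i" by auto
next
  assume "\<forall>j\<in>{..<n}. x j \<le> x i"
  then show "x i = Max (x ` {..<n})" using assms by (intro Max_eqI[symmetric]) auto
qed

lemma sets_eq_Max:
  assumes i: "i < n"
  shows "{x \<in> space DM. x i = Max (x ` {..<n})} \<in> sets DM"
proof -
  have comp: "(\<lambda>x. x j) \<in> DM \<rightarrow>\<^sub>M borel" if "j < n" for j
    using measurable_component_singleton[of j "{..<n}" D] that by (simp cong: measurable_cong_sets)
  have "Measurable.pred DM (\<lambda>x. \<forall>j\<in>{..<n}. x j \<le> x i)"
  proof (intro pred_intros_finite)
    fix j assume "j \<in> {..<n}"
    then have "(\<lambda>x. x j) \<in> DM \<rightarrow>\<^sub>M borel" "(\<lambda>x. x i) \<in> DM \<rightarrow>\<^sub>M borel" using comp i by auto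
    then show "Measurable.pred DM (\<lambda>x. x j \<le> x i)" unfolding pred_def by (rule borel_measurable_le)
  qed simp
  then show ?thesis unfolding eq_Max_iff[OF i] by (simp add: pred_def)
qed

text \<open>If \<open>x i\<close> is at least \<open>c\<close> and all other values are at most
  \<open>c\<close>, then \<open>x i\<close> is a maximum. The bound \<open>b i \<le> 1\<close>
  allows the full product to appear in place of the product over the other indices.\<close>

lemma superstar_bound:
  fixes c u :: real
  assumes i: "i < n" and u: "0 \<le> u" "u \<le> 1"
  defines "b \<equiv> \<lambda>j. measure (D j) {..<c} + u * measure (D j) {c}"
  shows "(1 - b i) * (\<Prod>j<n. b j) \<le> \<P>(x in DM. x i = Max (x ` {..<n}))"
proof -
  interpret DD: product_sigma_finite D
    by (intro product_sigma_finite.intro prob_space_imp_sigma_finite D)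
  interpret DM: prob_space DM by (rule prob_DM)
  interpret Di: prob_space "D i" by (rule D)
  note max = eq_Max_iff[OF i] and m = sets_eq_Max[OF i]
  have b1: "0 \<le> b j" "b j \<le> measure (D j) {..c}" for j
    using u mult_right_mono[OF u(2), of "measure (D j) {c}"] by (auto simp: b_def measure_atMost_split)
  have bl: "b j \<le> 1" for j using b1(2)[of j] prob_space.prob_le_1[OF D, of j "{..c}"] by linarith
  let ?E = "\<lambda>j. if j = i then {c..} else {..c}"
  have ci: "1 - b i \<le> measure (D i) {c..}"
  proof -
    have "measure (D i) (space (D i) - {..<c}) = 1 - measure (D i) {..<c}" by (rule Di.prob_compl) simp
    moreover have "space (D i) - {..<c} = {c..}" by auto
    ultimately show ?thesis using u by (simp add: b_def)
  qed
  have "(\<Prod>j<n. b j) = b i * (\<Prod>j\<in>{..<n} - {i}. b j)" using i by (intro prod.remove) auto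
  also have "\<dots> \<le> 1 * (\<Prod>j\<in>{..<n} - {i}. measure (D j) {..c})"
    using b1 bl by (intro mult_mono prod_mono prod_nonneg) auto
  finally have "(1 - b i) * (\<Prod>j<n. b j) \<le> measure (D i) {c..} * (\<Prod>j\<in>{..<n} - {i}. measure (D j) {..c})"
    using ci bl[of i] b1 by (intro mult_mono prod_nonneg) auto
  also have "\<dots> = (\<Prod>j<n. measure (D j) (?E j))" using i by (subst (2) prod.remove[of _ i]) auto
  also have "\<dots> = measure DM (Pi\<^sub>E {..<n} ?E)"
  proof -
    have "emeasure DM (Pi\<^sub>E {..<n} ?E) = (\<Prod>j<n. emeasure (D j) (?E j))" by (intro DD.emeasure_PiM) auto
    also have "\<dots> = (\<Prod>j<n. ennreal (measure (D j) (?E j)))"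
      by (intro prod.cong refl finite_measure.emeasure_eq_measure prob_space.finite_measure D)
    also have "\<dots> = ennreal (\<Prod>j<n. measure (D j) (?E j))" by (intro prod_ennreal) auto
    finally show ?thesis by (simp add: measure_def prod_nonneg)
  qed
  also have "\<dots> \<le> measure DM {x \<in> space DM. x i = Max (x ` {..<n})}"
  proof (rule DM.finite_measure_mono[OF _ m])
    show "Pi\<^sub>E {..<n} ?E \<subseteq> {x \<in> space DM. x i = Max (x ` {..<n})}"
    proof
      fix x assume x: "x \<in> Pi\<^sub>E {..<n} ?E"
      have "x j \<le> x i" if "j \<in> {..<n}" for j
      proof (cases "j = i")
        case False
        then have "x j \<in> {..c}" "x i \<in> {c..}" using PiE_mem[OF x that] PiE_mem[OF x, of i] i by auto
        then show ?thesis by simp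
      qed simp
      moreover have "x \<in> space DM" using x by (auto simp: space_PiM PiE_iff)
      ultimately show "x \<in> {x \<in> space DM. x i = Max (x ` {..<n})}" using max by blast
    qed
  qed
  finally show ?thesis .
qed

text \<open>Some variable attains the maximum, so the \<open>n\<close> probabilities add up to at
  least 1.\<close>

lemma no_superstars_card:
  assumes "no_superstars \<epsilon> n D"
  shows "1 \<le> real n * \<epsilon>"
proof -
  interpret DM: prob_space DM by (rule prob_DM)
  let ?E = "\<lambda>i. {x \<in> space DM. x i = Max (x ` {..<n})}"
  have "space DM = (\<Union>i\<in>{..<n}. ?E i)"
  proof (intro equalityI subsetI)
    fix x assume x: "x \<in> space DM"
    have "Max (x ` {..<n}) \<in> x ` {..<n}" using n by (intro Max_in) auto
    then obtain i where "i < n" "x i = Max (x ` {..<n})" by auto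
    then show "x \<in> (\<Union>i\<in>{..<n}. ?E i)" using x by blast
  qed auto
  then have "1 = measure DM (\<Union>i\<in>{..<n}. ?E i)" using DM.prob_space by simp
  also have "\<dots> \<le> (\<Sum>i<n. measure DM (?E i))"
    using sets_eq_Max by (intro DM.finite_measure_subadditive_finite) auto
  also have "\<dots> \<le> (\<Sum>i<n. \<epsilon>)" using assms by (intro sum_mono) (auto simp: no_superstars_def)
  finally show ?thesis by simp
qed

section \<open>The probability of a clear threshold\<close>

text \<open>The number of arrivals not below \<open>z\<close> is a sum of independent indicators.
  Markov's inequality for \<open>1 / 2\<close> raised to this number bounds the probability that it
  is less than \<open>K\<close> by the first term. The second term is a union bound over the pairs
  whose two draws are both not below \<open>z\<close>.\<close>

lemma prob_not_clear:
  fixes q :: "nat \<Rightarrow> real"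
  assumes q: "\<And>i. measure (KD i) {a. lex_less a z} = 1 - q (i mod n)"
  shows "1 - \<P>(\<kappa> in KM. clear K z \<kappa>) \<le> 2 ^ K * (\<Prod>i<n. 1 - q i / 2) + (\<Sum>i<n. (q i)\<^sup>2)"
proof -
  interpret KM: prob_space KM by (rule prob_KM)
  interpret KP: product_sigma_finite KD
    by (intro product_sigma_finite.intro prob_space_imp_sigma_finite prob_KD)
  let ?A = "{a. \<not> lex_less a z}"
  have spK: "space (KD i) = UNIV" for i by (simp add: space_pair_measure)
  have Bs: "{a. lex_less a z} \<in> sets (KD i)" for i
  proof -
    have "Measurable.pred (borel \<Otimes>\<^sub>M borel) (\<lambda>a. lex_less a z)"
      by (intro pred_lex_less measurable_const measurable_ident_sets refl) (auto simp: space_pair_measure)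
    then show ?thesis unfolding sets_KD by (simp add: pred_def space_pair_measure)
  qed
  have As: "?A \<in> sets (KD i)" for i
    using sets.compl_sets[OF Bs[of i]] by (simp add: spK Compl_eq_Diff_UNIV[symmetric] Collect_neg_eq)
  have Aq: "measure (KD i) ?A = q (i mod n)" for i
    using prob_space.prob_compl[OF prob_KD Bs, of i] q[of i] by (simp add: spK Compl_eq_Diff_UNIV[symmetric] Collect_neg_eq)
  have emA: "emeasure (KD i) ?A = ennreal (q (i mod n))" for i
    using finite_measure.emeasure_eq_measure[OF prob_space.finite_measure[OF prob_KD[of i]], of ?A] Aq[of i] by simp
  have q0: "0 \<le> q i" if "i < n" for i
  proof -
    have "q i = measure (KD i) ?A" using Aq[of i] that by simp
    then show ?thesis by (simp only: measure_nonneg)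
  qed
  let ?N = "\<lambda>\<kappa>. card {i. i < n \<and> \<not> lex_less (\<kappa> (n + i)) z}"
  let ?few = "{\<kappa> \<in> space KM. ?N \<kappa> < K}"
  let ?two = "\<lambda>i. {\<kappa> \<in> space KM. \<not> lex_less (\<kappa> i) z \<and> \<not> lex_less (\<kappa> (n + i)) z}"
  have few: "?few \<in> sets KM"
  proof -
    have "Measurable.pred KM (\<lambda>\<kappa>. ?N \<kappa> < K)" by (rule measurable_compose[OF measurable_count_above]) simp
    then show ?thesis by (simp add: pred_def)
  qed
  have two: "?two i \<in> sets KM" if "i < n" for i
  proof -
    have "Measurable.pred KM (\<lambda>\<kappa>. \<not> lex_less (\<kappa> i) z \<and> \<not> lex_less (\<kappa> (n + i)) z)"
      using that by (intro pred_intros_logic pred_below) auto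
    then show ?thesis by (simp add: pred_def)
  qed
  have cl: "{\<kappa> \<in> space KM. clear K z \<kappa>} \<in> sets KM" using pred_clear by (simp add: pred_def)
  have "1 - \<P>(\<kappa> in KM. clear K z \<kappa>) = measure KM (space KM - {\<kappa> \<in> space KM. clear K z \<kappa>})"
    by (rule KM.prob_compl[OF cl, symmetric])
  also have "space KM - {\<kappa> \<in> space KM. clear K z \<kappa>} = ?few \<union> (\<Union>i<n. ?two i)"
    by (auto simp: clear_def)
  also have "measure KM \<dots> \<le> measure KM ?few + measure KM (\<Union>i<n. ?two i)"
    using few two by (intro measure_Un_le) auto
  also have "measure KM (\<Union>i<n. ?two i) \<le> (\<Sum>i<n. measure KM (?two i))"
    using two by (intro KM.finite_measure_subadditive_finite) auto
  also have "(\<Sum>i<n. measure KM (?two i)) = (\<Sum>i<n. (q i)\<^sup>2)"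
  proof (intro sum.cong refl)
    fix i assume "i \<in> {..<n}"
    then have i: "i < n" by simp
    have eq: "?two i = prod_emb {..<2 * n} KD {i, n + i} (Pi\<^sub>E {i, n + i} (\<lambda>_. ?A))"
      by (auto simp: prod_emb_def PiE_iff space_PiM extensional_def)
    have "emeasure KM (?two i) = (\<Prod>j\<in>{i, n + i}. emeasure (KD j) ?A)"
      unfolding eq using i As prob_KD by (intro emeasure_PiM_emb) auto
    also have "\<dots> = emeasure (KD i) ?A * emeasure (KD (n + i)) ?A" using n by simp
    also have "\<dots> = ennreal (q i) * ennreal (q i)"
      using i emA[of i] emA[of "n + i"] by simp
    finally show "measure KM (?two i) = (q i)\<^sup>2"
      using q0[OF i] by (simp add: measure_def enn2real_mult power2_eq_square)
  qed
  also have "measure KM ?few \<le> 2 ^ K * (\<Prod>i<n. 1 - q i / 2)"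
  proof -
    \<comment> \<open>Factors of \<open>1 / 2\<close> to the power of the count: the items below
      \<open>n\<close> contribute 1, the others \<open>1 / 2\<close> if they are not below
      \<open>z\<close>.\<close>
    define f where "f i = (if n \<le> i then (\<lambda>a. 1 - indicat_real ?A a / 2) else (\<lambda>_. 1))" for i :: nat
    have f: "integrable (KD i) (f i) \<and> integral\<^sup>L (KD i) (f i) = (if n \<le> i then 1 - q (i mod n) / 2 else 1)" for i
    proof -
      interpret K: prob_space "KD i" by (rule prob_KD)
      have "integrable (KD i) (indicat_real ?A)"
        using As[of i] by (intro K.integrable_const_bound[where B = 1] borel_measurable_indicator) auto
      then have "integrable (KD i) (\<lambda>a. 1 - indicat_real ?A a / 2)"
        "integral\<^sup>L (KD i) (\<lambda>a. 1 - indicat_real ?A a / 2) = 1 - q (i mod n) / 2"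
        using As[of i] Aq[of i] K.prob_space by (simp_all add: spK)
      moreover have "integrable (KD i) (\<lambda>_. 1 :: real)" "integral\<^sup>L (KD i) (\<lambda>_. 1 :: real) = 1"
        using K.prob_space by simp_all
      ultimately show ?thesis unfolding f_def by (cases "n \<le> i") (simp_all only: if_True if_False)
    qed
    then have fint: "integrable (KD i) (f i)" and fI: "integral\<^sup>L (KD i) (f i) = (if n \<le> i then 1 - q (i mod n) / 2 else 1)" for i
      by blast+
    have pow: "(1 / 2) ^ ?N \<kappa> = (\<Prod>i<2 * n. f i (\<kappa> i))" for \<kappa>
    proof -
      have "(\<Prod>i<2 * n. f i (\<kappa> i)) = (\<Prod>i<n. if \<not> lex_less (\<kappa> (n + i)) z then 1 / 2 else 1)"
        unfolding prod_lessThan_double by (auto simp: f_def indicator_def intro!: prod.cong)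
      also have "\<dots> = (1 / 2) ^ card {i \<in> {..<n}. \<not> lex_less (\<kappa> (n + i)) z}"
        by (subst prod.inter_filter[symmetric]) auto
      finally show ?thesis by simp
    qed
    have int: "integrable KM (\<lambda>\<kappa>. \<Prod>i<2 * n. f i (\<kappa> i))"
      using fint by (intro KP.product_integrable_prod) auto
    have "measure KM ?few = integral\<^sup>L KM (indicat_real ?few)" using few by simp
    also have "\<dots> \<le> integral\<^sup>L KM (\<lambda>\<kappa>. 2 ^ K * (\<Prod>i<2 * n. f i (\<kappa> i)))"
    proof (rule integral_mono)
      show "integrable KM (indicat_real ?few)" using few by (intro KM.integrable_const_bound[where B = 1]) auto
      show "integrable KM (\<lambda>\<kappa>. 2 ^ K * (\<Prod>i<2 * n. f i (\<kappa> i)))" using int by simp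
      fix \<kappa>
      have "1 \<le> (2::real) ^ K * (1 / 2) ^ k" if "k < K" for k
        using power_increasing[of k K "2::real"] that by (simp add: power_divide)
      then show "indicat_real ?few \<kappa> \<le> 2 ^ K * (\<Prod>i<2 * n. f i (\<kappa> i))"
        unfolding pow[symmetric] by (simp add: indicator_def)
    qed
    also have "\<dots> = 2 ^ K * (\<Prod>i<2 * n. integral\<^sup>L (KD i) (f i))"
      using KP.product_integral_prod[of "{..<2 * n}" f] fint by simp
    also have "(\<Prod>i<2 * n. integral\<^sup>L (KD i) (f i)) = (\<Prod>i<n. 1 - q i / 2)"
      unfolding prod_lessThan_double fI by simp
    finally show ?thesis .
  qed
  finally show ?thesis by simp
qed

text \<open>With \<epsilon> written as \<open>exp (- 2 * L)\<close>, the threshold is taken at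
  \<delta> = \<open>exp (- L)\<close>, the square root of \<epsilon>. Too few large arrivals cost
  \<open>8 / L\<close> and pairs with two large draws cost \<open>2 / L\<close>.\<close>

lemma prob_clear_ge:
  assumes ns: "no_superstars (exp (- 2 * L)) n D" and L: "1 \<le> L" and K: "real K \<le> L / 8"
  obtains z where "1 - 10 / L \<le> \<P>(\<kappa> in KM. clear K z \<kappa>)"
proof -
  have "0 < exp (- L)" "exp (- L) < 1" using L by auto
  from threshold_exists[OF this] obtain c u where u: "0 \<le> u" "u \<le> 1"
    and prod: "(\<Prod>i<n. measure (D i) {..<c} + u * measure (D i) {c}) = exp (- L)" by blast
  define b where "b i = measure (D i) {..<c} + u * measure (D i) {c}" for i
  define q where "q i = 1 - b i" for i
  have b1: "b i \<le> 1" for i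
  proof -
    have "u * measure (D i) {c} \<le> 1 * measure (D i) {c}" using u by (intro mult_right_mono) auto
    then have "b i \<le> measure (D i) {..c}" by (simp add: b_def measure_atMost_split)
    then show ?thesis using prob_space.prob_le_1[OF D, of i "{..c}"] by linarith
  qed
  have q0: "0 \<le> q i" for i using b1[of i] by (simp add: q_def)
  have qle: "q i \<le> exp (- L)" if i: "i < n" for i
  proof -
    have "q i * exp (- L) \<le> \<P>(x in DM. x i = Max (x ` {..<n}))"
      using superstar_bound[OF i u, of c] prod unfolding q_def b_def by simp
    also have "\<dots> \<le> exp (- 2 * L)" using ns i by (simp add: no_superstars_def)
    also have "\<dots> = exp (- L) * exp (- L)" by (simp flip: exp_add)
    finally show ?thesis by simp
  qed
  have "2 \<le> exp L" using exp_ge_add_one_self[of L] L by linarith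
  then have eL: "exp (- L) \<le> 1 / 2" using le_imp_inverse_le[of 2 "exp L"] by (simp add: exp_minus)
  have q12: "0 \<le> q i \<and> q i \<le> 1 / 2" if "i < n" for i using q0[of i] qle[OF that] eL by linarith
  have prodq: "(\<Prod>i<n. 1 - q i) = exp (- L)" using prod by (simp add: q_def b_def)
  define \<mu> where "\<mu> = (\<Sum>i<n. q i)"
  have \<mu>: "L / 2 \<le> \<mu>" "\<mu> \<le> L" using sum_bounds_of_prod[OF q12 prodq] by (auto simp: \<mu>_def)
  have "1 - \<P>(\<kappa> in KM. clear K (c, u) \<kappa>) \<le> 2 ^ K * (\<Prod>i<n. 1 - q i / 2) + (\<Sum>i<n. (q i)\<^sup>2)"
    by (rule prob_not_clear) (simp add: measure_key_below[OF u] q_def b_def)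
  also have "2 ^ K * (\<Prod>i<n. 1 - q i / 2) \<le> 8 / L"
  proof -
    have "(\<Prod>i<n. 1 - q i / 2) \<le> (\<Prod>i<n. exp (- (q i / 2)))"
    proof (intro prod_mono conjI)
      fix i assume "i \<in> {..<n}"
      then show "0 \<le> 1 - q i / 2" using q12[of i] by auto
      show "1 - q i / 2 \<le> exp (- (q i / 2))" using exp_ge_add_one_self[of "- (q i / 2)"] by simp
    qed
    also have "\<dots> = exp (- (\<mu> / 2))" by (simp add: exp_sum[symmetric] \<mu>_def sum_negf sum_divide_distrib)
    finally have 1: "(\<Prod>i<n. 1 - q i / 2) \<le> exp (- (\<mu> / 2))" .
    have "(2::real) ^ K \<le> exp 1 ^ K" using exp_ge_add_one_self[of 1] by (intro power_mono) auto
    also have "\<dots> = exp (real K)" by (simp flip: exp_of_nat_mult)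
    finally have "2 ^ K * (\<Prod>i<n. 1 - q i / 2) \<le> exp (real K) * exp (- (\<mu> / 2))"
    proof (intro mult_mono 1 prod_nonneg)
      fix i assume "i \<in> {..<n}"
      then show "0 \<le> 1 - q i / 2" using q12[of i] by auto
    qed auto
    also have "\<dots> = exp (real K - \<mu> / 2)" by (simp flip: exp_add)
    \<comment> \<open>\<open>K\<close> is at most \<open>L / 8\<close>, while
      \<open>\<mu> / 2\<close> is at least \<open>L / 4\<close>.\<close>
    also have "\<dots> \<le> exp (- (L / 8))" using K \<mu> by simp
    also have "\<dots> = inverse (exp (L / 8))" by (simp add: exp_minus)
    also have "\<dots> \<le> inverse (L / 8)" using exp_ge_add_one_self[of "L / 8"] L by (intro le_imp_inverse_le; linarith)
    also have "\<dots> = 8 / L" by simp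
    finally show ?thesis .
  qed
  also have "(\<Sum>i<n. (q i)\<^sup>2) \<le> 2 / L"
  proof -
    have "(\<Sum>i<n. (q i)\<^sup>2) \<le> (\<Sum>i<n. exp (- L) * q i)"
      using qle q0 by (intro sum_mono) (auto simp: power2_eq_square intro!: mult_right_mono)
    also have "\<dots> = exp (- L) * \<mu>" by (simp add: \<mu>_def sum_distrib_left)
    also have "\<dots> \<le> exp (- L) * L" using \<mu> by (intro mult_left_mono) auto
    also have "\<dots> \<le> 2 / L"
    proof -
      have "L\<^sup>2 / 2 \<le> exp L" using exp_lower_Taylor_quadratic[of L] L by linarith
      then have "L * L * exp (- L) \<le> 2 * (exp L * exp (- L))" by (simp add: power2_eq_square)
      also have "\<dots> = 2" by (simp flip: exp_add)
      finally show ?thesis using L by (simp add: field_simps)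
    qed
    finally show ?thesis .
  qed
  finally have "1 - \<P>(\<kappa> in KM. clear K (c, u) \<kappa>) \<le> 10 / L" by (simp add: add_divide_distrib[symmetric])
  then show thesis using that[of "(c, u)"] by simp
qed

text \<open>From \<open>264 \<le> L\<close> the integer part \<open>K\<close> of
  \<open>L / 8\<close> is at least 32, as Chebyshev requires, and at least \<open>L / 16\<close>.
  The losses are \<open>80 / L\<close> for the rate of convergence, \<open>384 / L\<close> for bad
  profiles, \<open>1 / L\<close> for the comparison of profiles and \<open>10 / L\<close> for the
  threshold, at most \<open>500 / L\<close> in total.\<close>

lemma success_bound_large:
  assumes ns: "no_superstars (exp (- 2 * L)) n D" and L: "264 \<le> L"
  shows "gamma_opt - 500 / L \<le> single_sample_success sample_rule n D"
proof -
  define K where "K = nat \<lfloor>L / 8\<rfloor>"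
  have Kr: "real K = of_int \<lfloor>L / 8\<rfloor>" using L by (simp add: K_def)
  have K: "real K \<le> L / 8" "L / 8 - 1 < real K" unfolding Kr by linarith+
  have K32: "32 \<le> K" using K(2) L by linarith
  have K16: "L / 16 \<le> real K" using K L by linarith
  obtain z where z: "1 - 10 / L \<le> \<P>(\<kappa> in KM. clear K z \<kappa>)"
    using prob_clear_ge[OF ns _ K(1)] L by auto
  have "1 \<le> real n * exp (- 2 * L)" by (rule no_superstars_card[OF ns])
  then have "exp (2 * L) * 1 \<le> exp (2 * L) * (real n * exp (- 2 * L))" by (intro mult_left_mono) auto
  also have "\<dots> = real n * (exp (2 * L) * exp (- 2 * L))" by simp
  also have "exp (2 * L) * exp (- 2 * L) = 1" by (simp flip: exp_add)
  finally have en: "exp (2 * L) \<le> real n" by simp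
  \<comment> \<open>As \<open>n\<close> is at least \<open>exp (2 * L)\<close>, the cube of
    \<open>L\<close> fits below it. This gives both \<open>K ^ 3 \<le> n\<close> for the rate and
    \<open>K^2 / n \<le> 1 / L\<close> for the comparison of profiles.\<close>
  have L3: "L ^ 3 \<le> real n"
  proof -
    have "L ^ 3 \<le> (1 + L / 2) ^ 4"
    proof -
      have "L ^ 3 * 16 \<le> L ^ 3 * L" using L by (intro mult_left_mono) auto
      then have "L ^ 3 \<le> (L / 2) ^ 4" by (simp add: power_divide power4_eq_xxxx power3_eq_cube)
      also have "\<dots> \<le> (1 + L / 2) ^ 4" using L by (intro power_mono) auto
      finally show ?thesis .
    qed
    also have "\<dots> \<le> exp (L / 2) ^ 4" using exp_ge_add_one_self[of "L / 2"] L by (intro power_mono) auto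
    also have "\<dots> = exp (2 * L)" by (simp flip: exp_of_nat_mult)
    finally show ?thesis using en by linarith
  qed
  have K3: "K ^ 3 \<le> n"
  proof -
    have "(real K) ^ 3 \<le> L ^ 3" using K L by (intro power_mono) auto
    then have "real (K ^ 3) \<le> real n" unfolding of_nat_power using L3 by (rule order_trans)
    then show ?thesis by (simp only: of_nat_le_iff)
  qed
  have "K\<^sup>2 \<le> K ^ 3" using K32 by (intro power_increasing) auto
  then have K2: "K\<^sup>2 \<le> n" using K3 by simp
  have Kn: "(real K)\<^sup>2 / real n \<le> 1 / L"
  proof -
    have "(real K)\<^sup>2 \<le> L\<^sup>2" using K L by (intro power_mono) auto
    then have "(real K)\<^sup>2 * L \<le> L\<^sup>2 * L" using L by (intro mult_right_mono) auto
    also have "\<dots> \<le> real n" using L3 by (simp add: power2_eq_square power3_eq_cube)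
    finally show ?thesis using L n by (simp add: field_simps)
  qed
  define h where "h = half_value n - 24 / real K"
  define x where "x = (real K)\<^sup>2 / real n"
  define P where "P = \<P>(\<kappa> in KM. clear K z \<kappa>)"
  interpret KM: prob_space KM by (rule prob_KM)
  have P1: "P \<le> 1" "1 - 10 / L \<le> P" using z by (auto simp: P_def)
  have x01: "0 \<le> x" "x \<le> 1 / L" "1 / L \<le> 1" using Kn L by (auto simp: x_def)
  have h1: "h \<le> 1" using half_value_bounds[of n] by (auto simp: h_def intro: order_trans[of _ "half_value n"])
  have s: "(1 - x) * h * P \<le> single_sample_success sample_rule n D"
    using success_ge_clear[OF K32 K2, of z] by (simp add: h_def x_def P_def)
  have s0: "0 \<le> single_sample_success sample_rule n D" by (simp add: single_sample_success_def)
  have main: "h - x - (1 - P) \<le> single_sample_success sample_rule n D"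
  \<comment> \<open>For negative \<open>h\<close> the factors \<open>1 - x\<close> and
    \<open>P\<close> would raise the product instead of lowering it, but then the claim is
    trivial.\<close>
  proof (cases "h \<le> 0")
    case True
    then show ?thesis using s0 x01 P1 by linarith
  next
    case False
    have "x * h \<le> x" using x01 h1 by (simp add: mult_left_le)
    moreover have "(1 - x) * h * (1 - P) \<le> 1 * (1 - P)"
      using x01 False h1 P1 by (intro mult_right_mono mult_le_one) auto
    ultimately have "h - x - 1 * (1 - P) \<le> h - x * h - (1 - x) * h * (1 - P)" by (intro diff_mono) auto
    also have "\<dots> = (1 - x) * h * P" by (simp add: algebra_simps)
    finally show ?thesis using s by simp
  qed
  have "24 / real K \<le> 24 / (L / 16)" "5 / real K \<le> 5 / (L / 16)" using K16 L by (intro frac_le; linarith)+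
  then have k: "24 / real K \<le> 384 / L" "5 / real K \<le> 80 / L" by auto
  have "gamma_opt - 5 / real K \<le> half_value n" using K32 K3 by (intro gamma_opt_le(1)) auto
  then have "gamma_opt - (80 / L + 384 / L + 1 / L + 10 / L) \<le> single_sample_success sample_rule n D"
    using main k x01 P1 by (simp add: h_def)
  moreover have "80 / L + 384 / L + 1 / L + 10 / L \<le> 500 / L" using L by (simp add: divide_right_mono flip: add_divide_distrib)
  ultimately show ?thesis by linarith
qed

end

theorem theorem2:
  "\<exists>(A :: (nat \<Rightarrow> real) \<Rightarrow> real list \<Rightarrow> real list \<Rightarrow> bool) (C :: real).
     single_sample_algorithm A \<and>
     (\<forall>(\<epsilon> :: real) (n :: nat) (D :: nat \<Rightarrow> real measure).
        0 < \<epsilon> \<and> \<epsilon> < 1 \<and> 1 \<le> n \<and>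
        (\<forall>i<n. prob_space (D i) \<and> sets (D i) = sets borel) \<and>
        no_superstars \<epsilon> n D \<longrightarrow>
        single_sample_success A n D \<ge> gamma_opt - C / ln (1 / \<epsilon>))"
\<comment> \<open>The constant doubles the 500 of \<open>success_bound_large\<close>, since
  \<open>ln (1 / \<epsilon>)\<close> is \<open>2 * L\<close>.\<close>
proof (intro exI[of _ sample_rule] exI[of _ 1000] conjI allI impI)
  show "single_sample_algorithm sample_rule" by (rule single_sample_algorithm_sample_rule)
next
  fix \<epsilon> :: real and n :: nat and D :: "nat \<Rightarrow> real measure"
  assume asm: "0 < \<epsilon> \<and> \<epsilon> < 1 \<and> 1 \<le> n \<and> (\<forall>i<n. prob_space (D i) \<and> sets (D i) = sets borel) \<and> no_superstars \<epsilon> n D"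
  define L where "L = ln (1 / \<epsilon>) / 2"
  have L0: "0 < L" using asm by (simp add: L_def)
  have lnL: "ln (1 / \<epsilon>) = 2 * L" by (simp add: L_def)
  have eps: "\<epsilon> = exp (- 2 * L)" using asm by (simp add: L_def ln_div)
  show "gamma_opt - 1000 / ln (1 / \<epsilon>) \<le> single_sample_success sample_rule n D"
  proof (cases "L < 264")
    case True
    \<comment> \<open>Below the range of \<open>success_bound_large\<close> the claimed bound is not
      positive, because \<open>gamma_opt\<close> is at most 1.\<close>
    have "1 \<le> 1000 / (2 * L)" using True L0 by (simp add: field_simps)
    moreover have "gamma_opt \<le> 1" using gamma_opt_le(2)[of 1 1] by simp
    moreover have "0 \<le> single_sample_success sample_rule n D" by (simp add: single_sample_success_def)
    ultimately show ?thesis unfolding lnL by linarith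
  next
    case False
    \<comment> \<open>Nothing is known about \<open>D i\<close> for \<open>i\<close> from
      \<open>n\<close> on, while the locale speaks of all indices; a default law fills the gap and
      leaves the product over \<open>{..<n}\<close> unchanged.\<close>
    define D' where "D' i = (if i < n then D i else unif01)" for i
    have PiM: "PiM {..<n} D = PiM {..<n} D'" by (intro PiM_cong) (auto simp: D'_def)
    interpret sample_instance n D'
    proof (rule sample_instance.intro)
      show "0 < n" using asm by simp
      show "prob_space (D' i)" for i
        using asm prob_space_unif01 unfolding D'_def by (cases "i < n") (simp_all only: if_True if_False simp_thms)
      show "sets (D' i) = sets borel" for i
        using asm sets_unif01 unfolding D'_def by (cases "i < n") (simp_all only: if_True if_False simp_thms)
    qed
    have "no_superstars (exp (- 2 * L)) n D'"
      using asm unfolding no_superstars_def PiM eps[symmetric] by blast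
    then have "gamma_opt - 500 / L \<le> single_sample_success sample_rule n D'"
      using False by (intro success_bound_large) auto
    moreover have "single_sample_success sample_rule n D' = single_sample_success sample_rule n D"
      unfolding single_sample_success_def PiM ..
    ultimately show ?thesis unfolding lnL by simp
  qed
qed

end
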